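(* Let $V$ be a vector field on a spray manifold $(M,G)$. Then the following assertions are mutually equivalent: (1) $V$ is an affine vector field; (2) $\mathcal{L}_{\hat V}G=0$, where $\hat V$ is the complete lift of $V$; (3) $V^i_{|0|0}+V^kR^i{}_k=0$ on $TM_0$ (for every $i$, in natural local coordinates).
   Context: Let $M$ be a smooth $n$-dimensional manifold, $TM_0=TM\setminus\{0\}$ with natural local coordinates $(x^i,y^i)$. A spray on $M$ is a smooth vector field $G$ on $TM_0$ of the local form $G=y^i\frac{\partial}{\partial x^i}-2G^i\frac{\partial}{\partial y^i}$ with $G^i(x,\lambda y)=\lambda^2G^i(x,y)$ for $\lambda>0$; $(M,G)$ is then a spray manifold. A geodesic is a curve $\gamma:(a,b)\to M$ such that $\dot\gamma$ is an integral curve of $G$ in $TM_0$. A diffeomorphism $\phi$ is an affine transformation if for every geodesic $\gamma$ the curve $\phi\circ\gamma$ is also a geodesic (for local diffeomorphisms, the same condition for geodesics in the domain). A vector field $V$ on $M$ is affine if the local one-parameter group $\phi_t$ generated by $V$ consists of (local) affine transformations. The complete lift $\hat V$ is the vector field on $TM$ generating the local one-parameter group $\hat\phi_t(x,y)=(\phi_t(x),\phi_{t*}(y))$; locally, if $V=V^i\frac{\partial}{\partial x^i}$, then $\hat V=V^i\frac{\partial}{\partial x^i}+y^j\frac{\partial V^i}{\partial x^j}\frac{\partial}{\partial y^i}$. $\mathcal{L}_{\hat V}G=[\hat V,G]$ is the Lie derivative on $TM_0$. Put $N^i_j=\frac{\partial G^i}{\partial y^j}$ and $R^j{}_i=2\frac{\partial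 G^j}{\partial x^i}-G(N^j_i)-N^j_kN^k_i$ (Riemann curvature). The dynamical derivative of a section $W=W^i\frac{\partial}{\partial x^i}$ of $\pi^*TM$ (so $W^i=W^i(x,y)$; $\pi:TM_0\to M$ the projection) is $W^i_{|0}=G(W^i)+W^lN^i_l$; $V^i_{|0|0}$ is obtained by applying this twice to $V$. *)

theory Defs
  imports "HOL-Analysis.Analysis"
begin

section \<open>Smooth functions between Euclidean spaces\<close>

text \<open>These notions are meant for open \<open>S\<close> only: derivatives are taken in the full space.\<close>

primrec C_k_on :: "nat \<Rightarrow> 'a::euclidean_space set \<Rightarrow> ('a \<Rightarrow> 'b::euclidean_space) \<Rightarrow> bool" where
  "C_k_on 0 S f \<longleftrightarrow> continuous_on S f"
| "C_k_on (Suc k) S f \<longleftrightarrow> (\<forall>x\<in>S. f differentiable (at x)) \<and>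
     (\<forall>v. C_k_on k S (\<lambda>x. frechet_derivative f (at x) v))"

definition smooth_on :: "'a::euclidean_space set \<Rightarrow> ('a \<Rightarrow> 'b::euclidean_space) \<Rightarrow> bool" where
  "smooth_on S f \<longleftrightarrow> (\<forall>k. C_k_on k S f)"


section \<open>Smooth manifolds\<close>

text \<open>A chart is a pair of its domain and its coordinate map; values of the map outside the domain
  are irrelevant. A manifold is given by its atlas, which determines the underlying set and the
  topology. The atlas need not be maximal. The model space is a type \<open>'e\<close>; it is
  \<open>real ^ 'n\<close> for a manifold of dimension \<open>CARD('n)\<close>, and \<open>'e \<times> 'e\<close> for a tangent bundle.\<close>

type_synonym ('m, 'e) chart = "'m set \<times> ('m \<Rightarrow> 'e)"
type_synonym ('m, 'e) atlas = "('m, 'e) chart set"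

definition carrier :: "('m, 'e) atlas \<Rightarrow> 'm set" where
  "carrier A = (\<Union>c\<in>A. fst c)"

abbreviation chart_inv :: "('m, 'e) chart \<Rightarrow> 'e \<Rightarrow> 'm" where
  "chart_inv c \<equiv> inv_into (fst c) (snd c)"

definition transition :: "('m, 'e) chart \<Rightarrow> ('m, 'e) chart \<Rightarrow> 'e \<Rightarrow> 'e" where
  "transition c d = snd d \<circ> chart_inv c"

definition smooth_atlas :: "('m, 'e::euclidean_space) atlas \<Rightarrow> bool" where
  "smooth_atlas A \<longleftrightarrow> (\<forall>c\<in>A. inj_on (snd c) (fst c)) \<and>
     (\<forall>c\<in>A. \<forall>d\<in>A. open (snd c ` (fst c \<inter> fst d)) \<and>
        smooth_on (snd c ` (fst c \<inter> fst d)) (transition c d))"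

definition atlas_topology :: "('m, 'e::euclidean_space) atlas \<Rightarrow> 'm topology" where
  "atlas_topology A =
     topology (\<lambda>W. W \<subseteq> carrier A \<and> (\<forall>c\<in>A. open (snd c ` (fst c \<inter> W))))"

lemma openin_atlas_topology:
  assumes "smooth_atlas A"
  shows "openin (atlas_topology A) W \<longleftrightarrow>
    W \<subseteq> carrier A \<and> (\<forall>c\<in>A. open (snd c ` (fst c \<inter> W)))"
proof -
  have inj: "inj_on (snd c) (fst c)" if "c \<in> A" for c
    using assms that unfolding smooth_atlas_def by auto
  have "istopology (\<lambda>W. W \<subseteq> carrier A \<and> (\<forall>c\<in>A. open (snd c ` (fst c \<inter> W))))"
    unfolding istopology_def
  proof (intro conjI allI impI ballI)
    fix S T and c :: "('a, 'b) chart"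
    assume S: "S \<subseteq> carrier A \<and> (\<forall>c\<in>A. open (snd c ` (fst c \<inter> S)))"
      and T: "T \<subseteq> carrier A \<and> (\<forall>c\<in>A. open (snd c ` (fst c \<inter> T)))" and c: "c \<in> A"
    have "snd c ` (fst c \<inter> (S \<inter> T)) = snd c ` (fst c \<inter> S) \<inter> snd c ` (fst c \<inter> T)"
      using inj[OF c] unfolding inj_on_def by blast
    then show "open (snd c ` (fst c \<inter> (S \<inter> T)))"
      using S T c by auto
  next
    fix K and c :: "('a, 'b) chart"
    assume K: "\<forall>W\<in>K. W \<subseteq> carrier A \<and> (\<forall>c\<in>A. open (snd c ` (fst c \<inter> W)))" and c: "c \<in> A"
    have "snd c ` (fst c \<inter> \<Union>K) = (\<Union>W\<in>K. snd c ` (fst c \<inter> W))"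
      by blast
    then show "open (snd c ` (fst c \<inter> \<Union>K))"
      using K c by auto
  qed auto
  then show ?thesis
    unfolding atlas_topology_def by (simp add: topology_inverse')
qed

definition smooth_manifold :: "('m, 'e::euclidean_space) atlas \<Rightarrow> bool" where
  "smooth_manifold A \<longleftrightarrow> smooth_atlas A \<and>
     Hausdorff_space (atlas_topology A) \<and> second_countable (atlas_topology A)"

definition smooth_map ::
  "('m, 'e::euclidean_space) atlas \<Rightarrow> 'm set \<Rightarrow> ('p, 'f::euclidean_space) atlas \<Rightarrow> ('m \<Rightarrow> 'p) \<Rightarrow> bool"
where
  "smooth_map A W B f \<longleftrightarrow> openin (atlas_topology A) W \<and>
     continuous_map (subtopology (atlas_topology A) W) (atlas_topology B) f \<and>
     (\<forall>c\<in>A. \<forall>d\<in>B. smooth_on (snd c ` {p \<in> fst c \<inter> W. f p \<in> fst d}) (snd d \<circ> f \<circ> chart_inv c))"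

text \<open>A diffeomorphism of the open subset \<open>U\<close> onto the open subset \<open>f ` U\<close>.\<close>

definition local_diffeo :: "('m, 'e::euclidean_space) atlas \<Rightarrow> 'm set \<Rightarrow> ('m \<Rightarrow> 'm) \<Rightarrow> bool" where
  "local_diffeo A U f \<longleftrightarrow> inj_on f U \<and> smooth_map A U A f \<and> smooth_map A (f ` U) A (inv_into U f)"


section \<open>Tangent vectors and vector fields\<close>

text \<open>A tangent vector at \<open>p\<close> is the family of its components with respect to all charts around
  \<open>p\<close>, related by the derivatives of the transition maps. Components with respect to other charts
  are set to zero, so that tangent vectors are equal iff their components are.\<close>

type_synonym ('m, 'e) tvec = "('m, 'e) chart \<Rightarrow> 'e"

definition tangent_space :: "('m, 'e::euclidean_space) atlas \<Rightarrow> 'm \<Rightarrow> ('m, 'e) tvec set" where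
  "tangent_space A p = {v.
     (\<forall>c. \<not> (c \<in> A \<and> p \<in> fst c) \<longrightarrow> v c = 0) \<and>
     (\<forall>c\<in>A. \<forall>d\<in>A. p \<in> fst c \<and> p \<in> fst d \<longrightarrow>
        v d = frechet_derivative (transition c d) (at (snd c p)) (v c))}"

text \<open>The components of a vector field in a chart, as a function of the coordinates.\<close>

definition local_rep :: "('m, 'e) chart \<Rightarrow> ('m \<Rightarrow> ('m, 'e) tvec) \<Rightarrow> 'e \<Rightarrow> 'e" where
  "local_rep c X x = X (chart_inv c x) c"

text \<open>Smooth vector fields on the open subset \<open>W\<close>.\<close>

definition smooth_vector_field ::
  "('m, 'e::euclidean_space) atlas \<Rightarrow> 'm set \<Rightarrow> ('m \<Rightarrow> ('m, 'e) tvec) \<Rightarrow> bool" where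
  "smooth_vector_field A W X \<longleftrightarrow> (\<forall>p\<in>W. X p \<in> tangent_space A p) \<and>
     (\<forall>c\<in>A. smooth_on (snd c ` (fst c \<inter> W)) (local_rep c X))"

definition lie_bracket ::
  "('m, 'e::euclidean_space) atlas \<Rightarrow> ('m \<Rightarrow> ('m, 'e) tvec) \<Rightarrow> ('m \<Rightarrow> ('m, 'e) tvec)
     \<Rightarrow> 'm \<Rightarrow> ('m, 'e) tvec" where
  "lie_bracket A X Y p = (\<lambda>c. if c \<in> A \<and> p \<in> fst c
     then frechet_derivative (local_rep c Y) (at (snd c p)) (X p c)
        - frechet_derivative (local_rep c X) (at (snd c p)) (Y p c)
     else 0)"

abbreviation lie_derivative ::
  "('m, 'e::euclidean_space) atlas \<Rightarrow> ('m \<Rightarrow> ('m, 'e) tvec) \<Rightarrow> ('m \<Rightarrow> ('m, 'e) tvec)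
     \<Rightarrow> 'm \<Rightarrow> ('m, 'e) tvec" where
  "lie_derivative A X Y \<equiv> lie_bracket A X Y"


section \<open>The tangent bundle\<close>

text \<open>The natural chart \<open>(x, y)\<close> of the tangent bundle induced by the chart \<open>c\<close> with coordinates \<open>x\<close>.\<close>

definition natural_chart ::
  "('m, 'e::euclidean_space) atlas \<Rightarrow> ('m, 'e) chart \<Rightarrow> ('m \<times> ('m, 'e) tvec, 'e \<times> 'e) chart" where
  "natural_chart A c =
     ({(p, v). p \<in> fst c \<and> v \<in> tangent_space A p}, \<lambda>(p, v). (snd c p, v c))"

definition tangent_atlas ::
  "('m, 'e::euclidean_space) atlas \<Rightarrow> ('m \<times> ('m, 'e) tvec, 'e \<times> 'e) atlas" where
  "tangent_atlas A = natural_chart A ` A"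

text \<open>The slit tangent bundle, an open subset of the tangent bundle.\<close>

definition slit_bundle :: "('m, 'e::euclidean_space) atlas \<Rightarrow> ('m \<times> ('m, 'e) tvec) set" where
  "slit_bundle A = {(p, v). p \<in> carrier A \<and> v \<in> tangent_space A p \<and> v \<noteq> (\<lambda>_. 0)}"

text \<open>The derivative \<open>f\<^sub>*\<close> of a smooth map, on the tangent bundle; the result does not depend on the
  chosen chart.\<close>

definition tangent_map ::
  "('m, 'e::euclidean_space) atlas \<Rightarrow> ('p, 'f::euclidean_space) atlas \<Rightarrow> ('m \<Rightarrow> 'p)
     \<Rightarrow> 'm \<times> ('m, 'e) tvec \<Rightarrow> 'p \<times> ('p, 'f) tvec" where
  "tangent_map A B f = (\<lambda>(p, v).
     let c = (SOME c. c \<in> A \<and> p \<in> fst c)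
     in (f p, \<lambda>d. if d \<in> B \<and> f p \<in> fst d
               then frechet_derivative (snd d \<circ> f \<circ> chart_inv c) (at (snd c p)) (v c) else 0))"


section \<open>Curves and flows\<close>

definition line_atlas :: "(real, real) atlas" where
  "line_atlas = {(UNIV, \<lambda>t. t)}"

definition velocity ::
  "('m, 'e::euclidean_space) atlas \<Rightarrow> (real \<Rightarrow> 'm) \<Rightarrow> real \<Rightarrow> ('m, 'e) tvec" where
  "velocity A \<gamma> t = (\<lambda>c. if c \<in> A \<and> \<gamma> t \<in> fst c then vector_derivative (snd c \<circ> \<gamma>) (at t) else 0)"

text \<open>The curve \<open>\<gamma>\<close> together with its velocity, as a curve in the tangent bundle.\<close>

definition dot ::
  "('m, 'e::euclidean_space) atlas \<Rightarrow> (real \<Rightarrow> 'm) \<Rightarrow> real \<Rightarrow> 'm \<times> ('m, 'e) tvec" where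
  "dot A \<gamma> t = (\<gamma> t, velocity A \<gamma> t)"

text \<open>Curves are defined on open intervals, which may be unbounded.\<close>

definition smooth_curve :: "('m, 'e::euclidean_space) atlas \<Rightarrow> real set \<Rightarrow> (real \<Rightarrow> 'm) \<Rightarrow> bool" where
  "smooth_curve A I \<gamma> \<longleftrightarrow> open I \<and> is_interval I \<and> I \<noteq> {} \<and> smooth_map line_atlas I A \<gamma>"

definition integral_curve ::
  "('m, 'e::euclidean_space) atlas \<Rightarrow> ('m \<Rightarrow> ('m, 'e) tvec) \<Rightarrow> real set \<Rightarrow> (real \<Rightarrow> 'm) \<Rightarrow> bool" where
  "integral_curve A X I \<gamma> \<longleftrightarrow> smooth_curve A I \<gamma> \<and> (\<forall>t\<in>I. velocity A \<gamma> t = X (\<gamma> t))"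

text \<open>The local one-parameter group of a vector field: \<open>flow A V t\<close>, with its maximal domain
  \<open>flow_dom A V t\<close>, moves a point for time \<open>t\<close> along the integral curve starting there.\<close>

definition flow_dom ::
  "('m, 'e::euclidean_space) atlas \<Rightarrow> ('m \<Rightarrow> ('m, 'e) tvec) \<Rightarrow> real \<Rightarrow> 'm set" where
  "flow_dom A V t = {p \<in> carrier A. \<exists>I \<gamma>. integral_curve A V I \<gamma> \<and> 0 \<in> I \<and> t \<in> I \<and> \<gamma> 0 = p}"

definition flow ::
  "('m, 'e::euclidean_space) atlas \<Rightarrow> ('m \<Rightarrow> ('m, 'e) tvec) \<Rightarrow> real \<Rightarrow> 'm \<Rightarrow> 'm" where
  "flow A V t p =
     (THE q. \<exists>I \<gamma>. integral_curve A V I \<gamma> \<and> 0 \<in> I \<and> t \<in> I \<and> \<gamma> 0 = p \<and> \<gamma> t = q)"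

text \<open>The complete lift is the infinitesimal generator of the lifted group
  \<open>(x, y) \<mapsto> (\<phi>\<^sub>t(x), \<phi>\<^sub>t\<^sub>*(y))\<close>.\<close>

definition complete_lift ::
  "('m, 'e::euclidean_space) atlas \<Rightarrow> ('m \<Rightarrow> ('m, 'e) tvec) \<Rightarrow>
     'm \<times> ('m, 'e) tvec \<Rightarrow> ('m \<times> ('m, 'e) tvec, 'e \<times> 'e) tvec" where
  "complete_lift A V u =
     velocity (tangent_atlas A) (\<lambda>t. tangent_map A A (flow A V t) u) 0"


section \<open>Sprays\<close>

type_synonym ('m, 'e) bundle_field =
  "'m \<times> ('m, 'e) tvec \<Rightarrow> ('m \<times> ('m, 'e) tvec, 'e \<times> 'e) tvec"

text \<open>The functions \<open>G\<^sup>i\<close>: the fibre components of \<open>G\<close> in natural coordinates are \<open>-2 G\<^sup>i\<close>.\<close>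

definition spray_coeff ::
  "('m, 'e::euclidean_space) atlas \<Rightarrow> ('m, 'e) bundle_field \<Rightarrow> ('m, 'e) chart \<Rightarrow> 'e \<times> 'e \<Rightarrow> 'e" where
  "spray_coeff A G c z = - (1/2) *\<^sub>R snd (local_rep (natural_chart A c) G z)"

text \<open>By definition of \<open>spray_coeff\<close>, the first equation constrains only the base component of \<open>G\<close>.\<close>

definition spray :: "('m, 'e::euclidean_space) atlas \<Rightarrow> ('m, 'e) bundle_field \<Rightarrow> bool" where
  "spray A G \<longleftrightarrow> smooth_vector_field (tangent_atlas A) (slit_bundle A) G \<and>
     (\<forall>c\<in>A. \<forall>x\<in>snd c ` fst c. \<forall>y. y \<noteq> 0 \<longrightarrow>
        local_rep (natural_chart A c) G (x, y) = (y, - 2 *\<^sub>R spray_coeff A G c (x, y)) \<and>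
        (\<forall>s>0. spray_coeff A G c (x, s *\<^sub>R y) = s\<^sup>2 *\<^sub>R spray_coeff A G c (x, y)))"

definition geodesic ::
  "('m, 'e::euclidean_space) atlas \<Rightarrow> ('m, 'e) bundle_field \<Rightarrow> real set \<Rightarrow> (real \<Rightarrow> 'm) \<Rightarrow> bool" where
  "geodesic A G I \<gamma> \<longleftrightarrow> smooth_curve A I \<gamma> \<and> dot A \<gamma> ` I \<subseteq> slit_bundle A \<and>
     integral_curve (tangent_atlas A) G I (dot A \<gamma>)"

definition affine_transformation ::
  "('m, 'e::euclidean_space) atlas \<Rightarrow> ('m, 'e) bundle_field \<Rightarrow> 'm set \<Rightarrow> ('m \<Rightarrow> 'm) \<Rightarrow> bool" where
  "affine_transformation A G U \<phi> \<longleftrightarrow> local_diffeo A U \<phi> \<and>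
     (\<forall>I \<gamma>. geodesic A G I \<gamma> \<and> \<gamma> ` I \<subseteq> U \<longrightarrow> geodesic A G I (\<phi> \<circ> \<gamma>))"

definition affine_vector_field ::
  "('m, 'e::euclidean_space) atlas \<Rightarrow> ('m, 'e) bundle_field \<Rightarrow> ('m \<Rightarrow> ('m, 'e) tvec) \<Rightarrow> bool" where
  "affine_vector_field A G V \<longleftrightarrow>
     (\<forall>t. affine_transformation A G (flow_dom A V t) (flow A V t))"


section \<open>Curvature and dynamical derivative in natural coordinates\<close>

text \<open>Functions of natural coordinates are functions of \<open>z = (x, y)\<close>; below, \<open>G\<close> is the
  function \<open>(G\<^sup>1, \<dots>, G\<^sup>n)\<close> of \<open>z\<close>, i.e. \<open>spray_coeff\<close>.\<close>

definition partial_x :: "'n \<Rightarrow> ((real^'n) \<times> (real^'n) \<Rightarrow> real) \<Rightarrow> (real^'n) \<times> (real^'n::finite) \<Rightarrow> real" where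
  "partial_x i f z = frechet_derivative f (at z) (axis i 1, 0)"

definition partial_y :: "'n \<Rightarrow> ((real^'n) \<times> (real^'n) \<Rightarrow> real) \<Rightarrow> (real^'n) \<times> (real^'n::finite) \<Rightarrow> real" where
  "partial_y i f z = frechet_derivative f (at z) (0, axis i 1)"

text \<open>The spray as a derivation: \<open>G(f) = y\<^sup>i \<partial>f/\<partial>x\<^sup>i - 2 G\<^sup>i \<partial>f/\<partial>y\<^sup>i\<close>.\<close>

definition spray_deriv ::
  "((real^'n) \<times> (real^'n) \<Rightarrow> real^'n) \<Rightarrow> ((real^'n) \<times> (real^'n) \<Rightarrow> real)
     \<Rightarrow> (real^'n) \<times> (real^'n::finite) \<Rightarrow> real" where
  "spray_deriv G f z = (\<Sum>i\<in>UNIV. snd z $ i * partial_x i f z - 2 * G z $ i * partial_y i f z)"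

text \<open>\<open>nonlinear_conn G i j\<close> is \<open>N\<^sup>i\<^sub>j\<close> (upper index first).\<close>

definition nonlinear_conn ::
  "((real^'n) \<times> (real^'n) \<Rightarrow> real^'n) \<Rightarrow> 'n \<Rightarrow> 'n \<Rightarrow> (real^'n) \<times> (real^'n::finite) \<Rightarrow> real" where
  "nonlinear_conn G i j = partial_y j (\<lambda>z. G z $ i)"

text \<open>\<open>riemann_curv G j i\<close> is \<open>R\<^sup>j\<^sub>i\<close> (upper index first).\<close>

definition riemann_curv ::
  "((real^'n) \<times> (real^'n) \<Rightarrow> real^'n) \<Rightarrow> 'n \<Rightarrow> 'n \<Rightarrow> (real^'n) \<times> (real^'n::finite) \<Rightarrow> real" where
  "riemann_curv G j i z = 2 * partial_x i (\<lambda>z. G z $ j) z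
     - spray_deriv G (nonlinear_conn G j i) z
     - (\<Sum>k\<in>UNIV. nonlinear_conn G j k z * nonlinear_conn G k i z)"

definition dyn_deriv ::
  "((real^'n) \<times> (real^'n) \<Rightarrow> real^'n) \<Rightarrow> ((real^'n) \<times> (real^'n) \<Rightarrow> real^'n)
     \<Rightarrow> (real^'n) \<times> (real^'n::finite) \<Rightarrow> real^'n" where
  "dyn_deriv G W z = (\<chi> i. spray_deriv G (\<lambda>z. W z $ i) z
     + (\<Sum>l\<in>UNIV. W z $ l * nonlinear_conn G i l z))"

text \<open>The components of a vector field on the base, as a section of the pulled-back bundle.\<close>

definition lifted_rep ::
  "('m, 'e) chart \<Rightarrow> ('m \<Rightarrow> ('m, 'e) tvec) \<Rightarrow> 'e \<times> 'e \<Rightarrow> 'e" where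
  "lifted_rep c V z = local_rep c V (fst z)"

end

theory Submission
  imports Defs
begin

text \<open>
  Both equivalences are reduced to one identity in natural coordinates. In a chart, let \<open>f\<close> represent
  \<open>V\<close>, let \<open>(x, y) \<mapsto> (f x, Df(x) y)\<close> represent the complete lift, and let \<open>g\<close> represent \<open>G\<close>. If \<open>\<phi>\<^sub>t\<close> is
  the flow of \<open>f\<close>, then the flow of the lift is \<open>\<psi>\<^sub>t(x, y) = (\<phi>\<^sub>t(x), D\<phi>\<^sub>t(x) y)\<close>, and \<open>\<phi>\<^sub>t\<close> maps
  geodesics to geodesics iff \<open>D\<psi>\<^sub>t g = g \<circ> \<psi>\<^sub>t\<close>. Differentiating at \<open>t = 0\<close> gives the vanishing of the
  bracket; conversely \<open>D\<psi>\<^sub>t g - g \<circ> \<psi>\<^sub>t\<close> solves the linear variational equation of the lift when the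
  bracket vanishes, so it is zero. Large times are reached by composing flow maps for short times
  along an integral curve. The Jacobi type equation is the fibre component of the bracket.

  Smooth dependence of flows on the initial point is obtained by one induction over the order of
  differentiability: the parameter derivatives of a solution of \<open>u' = F(t, x, u)\<close> solve an equation of
  the same shape, whose right-hand side is one order less smooth.
\<close>

text \<open>Smoothness of a flow box requires one time interval for all orders of differentiability;
  if the interval shrank with the order, no fixed domain would carry a smooth flow. This shapes the
  theory of differential equations here: the linearised equation inherits the Lipschitz constant
  \<open>L\<close> and is affine on the whole space, so the same \<open>d\<close> with
  \<open>d * L \<le> 1/2\<close> serves at every order. A further 1/4 is spent on the linearisation
  error, hence the threshold 3/4 in the a priori bound.

  The spray exists only over nonzero vectors, so the lifted flow must be kept inside the slit
  bundle. Linearity achieves this: a solution of the variational equation that vanishes once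
  vanishes always.

  Affine maps are tested on geodesics only. To recover an identity between vector fields, a geodesic
  is drawn through every nonzero vector, short enough to remain in a flow box of \<open>V\<close>,
  and the velocity curve of its image is differentiated at time 0.

  The flow of the statement is given by a definite description on a maximal domain. Uniqueness of
  integral curves, which rests on the Hausdorff property, ties it to the flow boxes in
  charts.\<close>

abbreviation fd :: "('a::real_normed_vector \<Rightarrow> 'b::real_normed_vector) \<Rightarrow> 'a \<Rightarrow> 'a \<Rightarrow> 'b" where
  "fd f x \<equiv> frechet_derivative f (at x)"

lemma fd_eq: "(f has_derivative f') (at x) \<Longrightarrow> fd f x = f'"
  using frechet_derivative_at by metis

lemma has_derivative_fd: "f differentiable at x \<Longrightarrow> (f has_derivative fd f x) (at x)"
  by (simp add: frechet_derivative_works)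

text \<open>Differentiability is not assumed: \<open>frechet_derivative\<close> is a choice among
  all derivatives at the point, and two functions that agree near the point have the same
  derivatives there, possibly none.\<close>

lemma fd_cong:
  assumes "open S" "x \<in> S" "\<And>y. y \<in> S \<Longrightarrow> f y = g y"
  shows "fd f x = fd g x"
proof -
  have "(f has_derivative D) (at x) \<longleftrightarrow> (g has_derivative D) (at x)" for D
    using has_derivative_transform_within_open[of f D x UNIV S g]
      has_derivative_transform_within_open[of g D x UNIV S f] assms by auto
  then show ?thesis unfolding frechet_derivative_def by simp
qed

lemma differentiable_cong_open:
  assumes "open S" "x \<in> S" "\<And>y. y \<in> S \<Longrightarrow> f y = g y" "f differentiable at x"
  shows "g differentiable at x"
  using assms has_derivative_transform_within_open unfolding differentiable_def by blast

lemma linear_fd: "f differentiable at x \<Longrightarrow> linear (fd f x)"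
  by (rule linear_frechet_derivative)

lemma bounded_linear_fd: "f differentiable at x \<Longrightarrow> bounded_linear (fd f x)"
  using has_derivative_fd has_derivative_bounded_linear by blast

text \<open>\<open>C_k_on\<close> differentiates in fixed directions only. Expanding a direction
  that depends on the point in the basis reduces such derivatives to finitely many fixed directions
  with variable coefficients.\<close>

lemma linear_basis_sum:
  fixes v :: "'a::euclidean_space"
  assumes "linear l" shows "l v = (\<Sum>b\<in>Basis. (v \<bullet> b) *\<^sub>R l b)"
proof -
  have "l v = l (\<Sum>b\<in>Basis. (v \<bullet> b) *\<^sub>R b)" by (simp add: euclidean_representation)
  also have "\<dots> = (\<Sum>b\<in>Basis. (v \<bullet> b) *\<^sub>R l b)"
    using assms by (simp add: linear_sum linear_scale)
  finally show ?thesis .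
qed

section \<open>Functions of class \<open>C\<^sup>k\<close>\<close>

lemma C_k_on_imp_continuous_on: "C_k_on k S f \<Longrightarrow> continuous_on S f"
  by (cases k) (auto intro!: continuous_at_imp_continuous_on differentiable_imp_continuous_within)

lemma C_k_on_SucD: "C_k_on (Suc k) S f \<Longrightarrow> C_k_on k S f"
proof (induction k arbitrary: f)
  case 0 then show ?case using C_k_on_imp_continuous_on by (metis C_k_on.simps(1))
next
  case (Suc k) then show ?case by (meson C_k_on.simps(2))
qed

lemma C_k_on_subset: "C_k_on k S f \<Longrightarrow> T \<subseteq> S \<Longrightarrow> C_k_on k T f"
  by (induction k arbitrary: f) (auto intro: continuous_on_subset)

lemma C_k_on_cong:
  assumes "open S" "\<And>x. x \<in> S \<Longrightarrow> f x = g x" "C_k_on k S f"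
  shows "C_k_on k S g"
  using assms
proof (induction k arbitrary: f g)
  case 0 then show ?case using continuous_on_cong by (metis C_k_on.simps(1))
next
  case (Suc k)
  have "C_k_on k S (\<lambda>x. fd g x v)" for v
  proof (rule Suc.IH[where f="\<lambda>x. fd f x v"])
    show "fd f x v = fd g x v" if "x \<in> S" for x
      using fd_cong[OF Suc.prems(1) that, of f g] Suc.prems(2) by simp
  qed (use Suc.prems in simp_all)
  moreover have "g differentiable at x" if "x \<in> S" for x
    by (rule differentiable_cong_open[OF Suc.prems(1) that, of f]) (use Suc.prems(2,3) that in simp_all)
  ultimately show ?case by auto
qed

lemma C_k_on_locally:
  assumes "\<And>x. x \<in> S \<Longrightarrow> \<exists>T. open T \<and> x \<in> T \<and> C_k_on k T f"
  shows "C_k_on k S f"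
  using assms
proof (induction k arbitrary: f)
  case 0
  then show ?case
    by (auto intro!: continuous_at_imp_continuous_on) (meson continuous_on_eq_continuous_at)
next
  case (Suc k)
  have *: "\<exists>T. open T \<and> x \<in> T \<and> f differentiable at x \<and> (\<forall>v. C_k_on k T (\<lambda>x. fd f x v))"
    if "x \<in> S" for x
    using Suc.prems[OF that] by (metis C_k_on.simps(2))
  have "C_k_on k S (\<lambda>x. fd f x v)" for v
    by (rule Suc.IH) (use * in metis)
  then show ?case using * by (metis C_k_on.simps(2))
qed

text \<open>The closure rules below all follow this pattern: exhibit the derivative, then recognise
  it as an expression covered by the induction hypothesis.\<close>

lemma C_k_on_SucI:
  assumes "open S" "\<And>x. x \<in> S \<Longrightarrow> (f has_derivative f' x) (at x)" "\<And>v. C_k_on k S (\<lambda>x. f' x v)"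
  shows "C_k_on (Suc k) S f"
proof -
  have "C_k_on k S (\<lambda>x. fd f x v)" for v
    by (rule C_k_on_cong[OF assms(1) _ assms(3)[of v]]) (simp add: fd_eq[OF assms(2)])
  moreover have "f differentiable at x" if "x \<in> S" for x
    using assms(2)[OF that] differentiableI by blast
  ultimately show ?thesis by auto
qed

lemma C_k_on_const: "C_k_on k S (\<lambda>x. c)"
  by (induction k arbitrary: c) auto

lemma C_k_on_bounded_linear_comp:
  assumes "bounded_linear l" "C_k_on k S f" "open S"
  shows "C_k_on k S (\<lambda>x. l (f x))"
  using assms(2)
proof (induction k arbitrary: f)
  case 0 then show ?case using bounded_linear.continuous_on[OF assms(1)] by auto
next
  case (Suc k)
  show ?case
    by (rule C_k_on_SucI[where f'="\<lambda>x v. l (fd f x v)"])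
       (use Suc assms in \<open>auto intro!: bounded_linear.has_derivative[OF assms(1)] has_derivative_fd\<close>)
qed

lemma C_k_on_bounded_linear:
  assumes "bounded_linear l" "open S"
  shows "C_k_on k S l"
proof (cases k)
  case 0 then show ?thesis by (simp add: linear_continuous_on assms(1))
next
  case (Suc j)
  show ?thesis unfolding Suc
    by (intro C_k_on_SucI[where f'="\<lambda>x v. l v"] assms bounded_linear_imp_has_derivative C_k_on_const)
qed

lemma C_k_on_add:
  assumes "open S" "C_k_on k S f" "C_k_on k S g"
  shows "C_k_on k S (\<lambda>x. f x + g x)"
  using assms(2,3)
proof (induction k arbitrary: f g)
  case 0 then show ?case by (auto intro: continuous_on_add)
next
  case (Suc k)
  show ?case
    by (rule C_k_on_SucI[where f'="\<lambda>x v. fd f x v + fd g x v"])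
       (use Suc assms in \<open>auto intro!: has_derivative_add has_derivative_fd\<close>)
qed

lemma C_k_on_sum:
  assumes "open S" "finite I" "\<And>i. i \<in> I \<Longrightarrow> C_k_on k S (f i)"
  shows "C_k_on k S (\<lambda>x. \<Sum>i\<in>I. f i x)"
  using assms(2,3)
  by (induction I rule: finite_induct) (auto intro: C_k_on_const C_k_on_add assms(1))

lemma C_k_on_bilinear:
  assumes "bounded_bilinear B" "open S" "C_k_on k S f" "C_k_on k S g"
  shows "C_k_on k S (\<lambda>x. B (f x) (g x))"
  using assms(3,4)
proof (induction k arbitrary: f g)
  case 0 then show ?case by (auto intro: bounded_bilinear.continuous_on[OF assms(1)])
next
  case (Suc k)
  have k: "C_k_on k S f" "C_k_on k S g" using Suc.prems C_k_on_SucD by blast+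
  show ?case
    by (rule C_k_on_SucI[where f'="\<lambda>x v. B (f x) (fd g x v) + B (fd f x v) (g x)"])
       (use Suc k assms in \<open>auto intro!: bounded_bilinear.FDERIV[OF assms(1)] has_derivative_fd C_k_on_add\<close>)
qed

lemma C_k_on_Pair:
  assumes "open S" "C_k_on k S f" "C_k_on k S g"
  shows "C_k_on k S (\<lambda>x. (f x, g x))"
  using assms(2,3)
proof (induction k arbitrary: f g)
  case 0 then show ?case by (auto intro: continuous_on_Pair)
next
  case (Suc k)
  show ?case
    by (rule C_k_on_SucI[where f'="\<lambda>x v. (fd f x v, fd g x v)"])
       (use Suc assms in \<open>auto intro!: has_derivative_Pair has_derivative_fd\<close>)
qed

text \<open>Only \<open>f\<close> varies in the induction. The chain rule produces
  \<open>fd f (g x) b\<close>, to which the hypothesis applies with a directional derivative of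
  \<open>f\<close> in place of \<open>f\<close>, and \<open>fd g x v\<close>, whose class is part of
  the assumption on \<open>g\<close>.\<close>

lemma C_k_on_compose:
  assumes "open S" "open T" "C_k_on k S g" "C_k_on k T f" "g ` S \<subseteq> T"
  shows "C_k_on k S (\<lambda>x. f (g x))"
  using assms(3,4)
proof (induction k arbitrary: f)
  case 0 then show ?case using assms(5) by (auto intro: continuous_on_compose2)
next
  case (Suc k)
  have k: "C_k_on k S g" using Suc.prems C_k_on_SucD by blast
  have d: "f differentiable at (g x)" "g differentiable at x" if "x \<in> S" for x
    using Suc.prems that assms(5) by auto
  have IH: "C_k_on k S (\<lambda>x. fd f (g x) b)" for b
    using Suc.IH[OF k, of "\<lambda>x. fd f x b"] Suc.prems(2) by simp
  have sum: "C_k_on k S (\<lambda>x. \<Sum>b\<in>Basis. (fd g x v \<bullet> b) *\<^sub>R fd f (g x) b)" for v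
    by (intro C_k_on_sum C_k_on_bilinear[OF bounded_bilinear_scaleR] assms finite_Basis
          C_k_on_bounded_linear_comp[OF bounded_linear_inner_left] IH)
       (use Suc.prems in simp)
  have *: "C_k_on k S (\<lambda>x. fd f (g x) (fd g x v))" for v
    by (rule C_k_on_cong[OF assms(1) _ sum[of v]]) (intro linear_basis_sum[symmetric] linear_fd d(1))
  show ?case
  proof (rule C_k_on_SucI[where f'="\<lambda>x v. fd f (g x) (fd g x v)"])
    fix x assume "x \<in> S"
    from has_derivative_compose[OF has_derivative_fd[OF d(2)[OF this]] has_derivative_fd[OF d(1)[OF this]]]
    show "((\<lambda>x. f (g x)) has_derivative (\<lambda>v. fd f (g x) (fd g x v))) (at x)" .
  qed (rule assms(1) *)+
qed

section \<open>Smooth functions\<close>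

lemma smooth_onD: "smooth_on S f \<Longrightarrow> C_k_on k S f"
  by (simp add: smooth_on_def)

lemma smooth_on_subset: "smooth_on S f \<Longrightarrow> T \<subseteq> S \<Longrightarrow> smooth_on T f"
  using C_k_on_subset unfolding smooth_on_def by blast

lemma smooth_on_cong: "smooth_on S f \<Longrightarrow> open S \<Longrightarrow> (\<And>x. x \<in> S \<Longrightarrow> f x = g x) \<Longrightarrow> smooth_on S g"
  using C_k_on_cong unfolding smooth_on_def by blast

lemma smooth_on_locally:
  assumes "\<And>x. x \<in> S \<Longrightarrow> \<exists>T. open T \<and> x \<in> T \<and> smooth_on T f"
  shows "smooth_on S f"
  using assms C_k_on_locally unfolding smooth_on_def by metis

lemma smooth_on_imp_continuous_on: "smooth_on S f \<Longrightarrow> continuous_on S f"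
  using C_k_on_imp_continuous_on smooth_onD by blast

lemma smooth_on_differentiable: "smooth_on S f \<Longrightarrow> x \<in> S \<Longrightarrow> f differentiable at x"
  using smooth_onD[of S f "Suc 0"] by auto

lemma smooth_on_has_derivative: "smooth_on S f \<Longrightarrow> x \<in> S \<Longrightarrow> (f has_derivative fd f x) (at x)"
  using smooth_on_differentiable has_derivative_fd by blast

lemma smooth_on_fd:
  assumes "smooth_on S f" shows "smooth_on S (\<lambda>x. fd f x v)"
  unfolding smooth_on_def
proof
  fix k
  have "C_k_on (Suc k) S f" using assms by (rule smooth_onD)
  then show "C_k_on k S (\<lambda>x. fd f x v)" by simp
qed

lemma smooth_on_const: "smooth_on S (\<lambda>x. c)"
  by (simp add: smooth_on_def C_k_on_const)

lemma smooth_on_bounded_linear: "bounded_linear l \<Longrightarrow> open S \<Longrightarrow> smooth_on S l"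
  by (simp add: smooth_on_def C_k_on_bounded_linear)

lemma smooth_on_id: "open S \<Longrightarrow> smooth_on S (\<lambda>x. x)"
  by (simp add: smooth_on_bounded_linear bounded_linear_ident)

lemma smooth_on_bounded_linear_comp:
  "bounded_linear l \<Longrightarrow> open S \<Longrightarrow> smooth_on S f \<Longrightarrow> smooth_on S (\<lambda>x. l (f x))"
  by (simp add: smooth_on_def C_k_on_bounded_linear_comp)

lemma smooth_on_add: "open S \<Longrightarrow> smooth_on S f \<Longrightarrow> smooth_on S g \<Longrightarrow> smooth_on S (\<lambda>x. f x + g x)"
  by (simp add: smooth_on_def C_k_on_add)

lemma smooth_on_Pair: "open S \<Longrightarrow> smooth_on S f \<Longrightarrow> smooth_on S g \<Longrightarrow> smooth_on S (\<lambda>x. (f x, g x))"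
  by (simp add: smooth_on_def C_k_on_Pair)

lemma smooth_on_fst: "open S \<Longrightarrow> smooth_on S f \<Longrightarrow> smooth_on S (\<lambda>x. fst (f x))"
  by (simp add: smooth_on_bounded_linear_comp bounded_linear_fst)

lemma smooth_on_snd: "open S \<Longrightarrow> smooth_on S f \<Longrightarrow> smooth_on S (\<lambda>x. snd (f x))"
  by (simp add: smooth_on_bounded_linear_comp bounded_linear_snd)

lemma smooth_on_compose:
  "open S \<Longrightarrow> open T \<Longrightarrow> smooth_on T f \<Longrightarrow> smooth_on S g \<Longrightarrow> g ` S \<subseteq> T \<Longrightarrow> smooth_on S (\<lambda>x. f (g x))"
  using C_k_on_compose unfolding smooth_on_def by blast

text \<open>Base point and direction both move, and one order of \<open>f\<close> is spent.
  Derivatives occur in this form in the variational equation and, through the smooth version below,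
  in lifts and in the transition maps of the tangent bundle.\<close>

lemma C_k_on_fd_comp:
  assumes "open S" "open T" "C_k_on (Suc k) T f" "C_k_on k S g" "C_k_on k S h" "g ` S \<subseteq> T"
  shows "C_k_on k S (\<lambda>x. fd f (g x) (h x))"
proof -
  have b: "C_k_on k S (\<lambda>x. fd f (g x) b)" for b
    using C_k_on_compose[OF assms(1,2,4) _ assms(6), of "\<lambda>x. fd f x b"] assms(3) by simp
  have sum: "C_k_on k S (\<lambda>x. \<Sum>b\<in>Basis. (h x \<bullet> b) *\<^sub>R fd f (g x) b)"
    by (intro C_k_on_sum C_k_on_bilinear[OF bounded_bilinear_scaleR] assms(1,5) finite_Basis b
          C_k_on_bounded_linear_comp[OF bounded_linear_inner_left])
  have d: "f differentiable at (g x)" if "x \<in> S" for x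
    using assms(3,6) that by auto
  show ?thesis
    by (rule C_k_on_cong[OF assms(1) _ sum]) (intro linear_basis_sum[symmetric] linear_fd d)
qed

lemma smooth_on_fd_comp:
  assumes "open S" "open T" "smooth_on T f" "smooth_on S g" "smooth_on S h" "g ` S \<subseteq> T"
  shows "smooth_on S (\<lambda>x. fd f (g x) (h x))"
  unfolding smooth_on_def using smooth_onD[OF assms(3)] smooth_onD[OF assms(4)] smooth_onD[OF assms(5)]
  by (intro allI C_k_on_fd_comp[OF assms(1,2) _ _ _ assms(6)])

text \<open>Compactness arguments need the derivative to be continuous in operator norm. In finite
  dimension this follows from continuity of the finitely many directional derivatives along the
  basis.\<close>

lemma C1_blinfun:
  assumes "C_k_on (Suc k) S f" "open S"
  obtains f' where "continuous_on S f'" "\<And>x. x \<in> S \<Longrightarrow> (f has_derivative blinfun_apply (f' x)) (at x)"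
    "\<And>x. x \<in> S \<Longrightarrow> blinfun_apply (f' x) = fd f x"
proof
  let ?f = "\<lambda>x. Blinfun (fd f x)"
  have *: "blinfun_apply (?f x) = fd f x" if "x \<in> S" for x
    using assms(1) that by (simp add: bounded_linear_Blinfun_apply bounded_linear_fd)
  then show "blinfun_apply (?f x) = fd f x" if "x \<in> S" for x using that .
  show "(f has_derivative blinfun_apply (?f x)) (at x)" if "x \<in> S" for x
    using assms(1) that by (simp add: * has_derivative_fd)
  show "continuous_on S ?f"
  proof (rule continuous_on_blinfun_componentwise)
    fix b :: 'a
    have "continuous_on S (\<lambda>x. fd f x b)" using assms(1) C_k_on_imp_continuous_on[of k S "\<lambda>x. fd f x b"] by simp
    then show "continuous_on S (\<lambda>x. blinfun_apply (?f x) b)"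
      by (rule continuous_on_eq) (simp add: *)
  qed
qed

text \<open>The second difference is the increment over \<open>[0, s]\<close> of \<open>h\<close>,
  itself a difference in direction \<open>w\<close>. The mean value theorem for \<open>h\<close>
  yields \<open>a\<close> and one factor \<open>s\<close>; applied once more in direction
  \<open>w\<close> it yields \<open>b\<close> and the other factor.\<close>

lemma second_difference_mvt:
  fixes f :: "'a::euclidean_space \<Rightarrow> real"
  assumes "C_k_on 2 S f" "0 < s"
    and sub: "\<And>a b. \<lbrakk>0 \<le> a; a \<le> s; 0 \<le> b; b \<le> s\<rbrakk> \<Longrightarrow> x + a *\<^sub>R v + b *\<^sub>R w \<in> S"
  obtains a b where "0 \<le> a" "a \<le> s" "0 \<le> b" "b \<le> s"
    "f (x + s *\<^sub>R v + s *\<^sub>R w) - f (x + s *\<^sub>R v) - f (x + s *\<^sub>R w) + f x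
      = s * s * fd (\<lambda>y. fd f y v) (x + a *\<^sub>R v + b *\<^sub>R w) w"
proof -
  have df: "(f has_derivative fd f y) (at y)" if "y \<in> S" for y
    using assms(1) that by (auto simp: numeral_2_eq_2 intro: has_derivative_fd)
  have ddf: "((\<lambda>y. fd f y v) has_derivative fd (\<lambda>y. fd f y v) y) (at y)" if "y \<in> S" for y
    using assms(1) that by (auto simp: numeral_2_eq_2 intro: has_derivative_fd)
  have ray: "((\<lambda>r. g (p + r *\<^sub>R u)) has_real_derivative fd g (p + r *\<^sub>R u) u) (at r)"
    if "(g has_derivative fd g (p + r *\<^sub>R u)) (at (p + r *\<^sub>R u))" for p u r and g :: "'a \<Rightarrow> real"
  proof -
    have "((\<lambda>r. p + r *\<^sub>R u) has_derivative (\<lambda>h. h *\<^sub>R u)) (at r)"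
      by (auto intro!: derivative_eq_intros)
    from has_derivative_compose[OF this that]
    have "((\<lambda>r. g (p + r *\<^sub>R u)) has_derivative (\<lambda>h. fd g (p + r *\<^sub>R u) (h *\<^sub>R u))) (at r)" .
    moreover have "fd g (p + r *\<^sub>R u) (h *\<^sub>R u) = fd g (p + r *\<^sub>R u) u * h" for h
      using linear_cmul[OF has_derivative_linear[OF that]] by simp
    ultimately show ?thesis by (simp add: has_field_derivative_def)
  qed
  define h where "h r = f ((x + s *\<^sub>R w) + r *\<^sub>R v) - f (x + r *\<^sub>R v)" for r
  have "\<exists>a. 0 < a \<and> a < s \<and> h s - h 0 = (s - 0) * (fd f ((x + s *\<^sub>R w) + a *\<^sub>R v) v - fd f (x + a *\<^sub>R v) v)"
  proof (rule MVT2[OF assms(2)])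
    fix r assume r: "0 \<le> r" "r \<le> s"
    have "(x + s *\<^sub>R w) + r *\<^sub>R v \<in> S" "x + r *\<^sub>R v \<in> S"
      using sub[of r s] sub[of r 0] r assms(2) by (auto simp: algebra_simps)
    then show "(h has_real_derivative (fd f ((x + s *\<^sub>R w) + r *\<^sub>R v) v - fd f (x + r *\<^sub>R v) v)) (at r)"
      unfolding h_def by (intro DERIV_diff ray df)
  qed
  then obtain a where a: "0 < a" "a < s"
    "h s - h 0 = s * (fd f ((x + s *\<^sub>R w) + a *\<^sub>R v) v - fd f (x + a *\<^sub>R v) v)" by auto
  have "\<exists>b. 0 < b \<and> b < s \<and> fd f ((x + a *\<^sub>R v) + s *\<^sub>R w) v - fd f ((x + a *\<^sub>R v) + 0 *\<^sub>R w) v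
      = (s - 0) * fd (\<lambda>y. fd f y v) ((x + a *\<^sub>R v) + b *\<^sub>R w) w"
    by (rule MVT2[OF assms(2), where f="\<lambda>b. fd f ((x + a *\<^sub>R v) + b *\<^sub>R w) v"])
       (intro ray ddf, use sub a in auto)
  then obtain b where b: "0 < b" "b < s" "fd f ((x + a *\<^sub>R v) + s *\<^sub>R w) v - fd f (x + a *\<^sub>R v) v
      = s * fd (\<lambda>y. fd f y v) ((x + a *\<^sub>R v) + b *\<^sub>R w) w" by auto
  have "h s - h 0 = s * (fd f ((x + a *\<^sub>R v) + s *\<^sub>R w) v - fd f (x + a *\<^sub>R v) v)"
    unfolding a(3) by (simp add: algebra_simps)
  also have "\<dots> = s * s * fd (\<lambda>y. fd f y v) ((x + a *\<^sub>R v) + b *\<^sub>R w) w" by (simp add: b(3))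
  finally have "h s - h 0 = s * s * fd (\<lambda>y. fd f y v) ((x + a *\<^sub>R v) + b *\<^sub>R w) w" .
  moreover have "h s - h 0 = f (x + s *\<^sub>R v + s *\<^sub>R w) - f (x + s *\<^sub>R v) - f (x + s *\<^sub>R w) + f x"
    by (simp add: h_def algebra_simps)
  ultimately show ?thesis using that[of a b] a(1,2) b(1,2) by simp
qed

text \<open>The second difference does not change when \<open>v\<close> and \<open>w\<close> are
  exchanged, so both mixed derivatives attain a common value at points near \<open>x\<close>.
  Continuity at \<open>x\<close> then rules out different values there.\<close>

lemma fd_commute_real:
  fixes f :: "'a::euclidean_space \<Rightarrow> real"
  assumes "C_k_on 2 S f" "open S" "x \<in> S"
  shows "fd (\<lambda>y. fd f y v) x w = fd (\<lambda>y. fd f y w) x v"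
proof (rule ccontr)
  let ?a = "\<lambda>y. fd (\<lambda>y. fd f y v) y w" and ?b = "\<lambda>y. fd (\<lambda>y. fd f y w) y v"
  define e where "e = dist (?a x) (?b x)"
  assume "?a x \<noteq> ?b x"
  then have "e > 0" by (simp add: e_def)
  have c: "continuous_on S ?a" "continuous_on S ?b"
    using assms(1) by (auto simp: numeral_2_eq_2)
  obtain d1 where d1: "d1 > 0" "\<And>y. y \<in> S \<Longrightarrow> dist y x \<le> d1 \<Longrightarrow> dist (?a y) (?a x) < e/2"
    using continuous_onE[OF c(1) assms(3), of "e/2"] \<open>e > 0\<close> by auto
  obtain d2 where d2: "d2 > 0" "\<And>y. y \<in> S \<Longrightarrow> dist y x \<le> d2 \<Longrightarrow> dist (?b y) (?b x) < e/2"
    using continuous_onE[OF c(2) assms(3), of "e/2"] \<open>e > 0\<close> by auto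
  obtain d3 where d3: "d3 > 0" "ball x d3 \<subseteq> S" using assms open_contains_ball by blast
  define d where "d = min d1 (min d2 d3)"
  have "d > 0" using d1 d2 d3 by (simp add: d_def)
  \<comment> \<open>Chosen so that the whole parallelogram with sides \<open>s *\<^sub>R v\<close>
    and \<open>s *\<^sub>R w\<close> at \<open>x\<close> stays within \<open>d / 2\<close> of
    \<open>x\<close>; the summand 1 keeps the denominator positive when \<open>v\<close> and
    \<open>w\<close> vanish.\<close>
  define s where "s = (d / 2) / (norm v + norm w + 1)"
  have n: "norm v + norm w + 1 > 0" by (smt (verit) norm_ge_zero)
  have s: "s > 0" using \<open>d > 0\<close> n by (simp add: s_def)
  have sn: "s * (norm v + norm w + 1) = d / 2"
    using n nonzero_divide_eq_eq[of "norm v + norm w + 1" "d/2" s] by (simp add: s_def)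
  have near: "dist (x + a *\<^sub>R v + b *\<^sub>R w) x < d" if "0 \<le> a" "a \<le> s" "0 \<le> b" "b \<le> s" for a b
  proof -
    have "dist (x + a *\<^sub>R v + b *\<^sub>R w) x = norm (a *\<^sub>R v + b *\<^sub>R w)" by (simp add: dist_norm algebra_simps)
    also have "\<dots> \<le> a * norm v + b * norm w" using that norm_triangle_ineq[of "a *\<^sub>R v" "b *\<^sub>R w"] by simp
    also have "\<dots> \<le> s * norm v + s * norm w" using that by (intro add_mono mult_right_mono) auto
    also have "\<dots> \<le> s * (norm v + norm w + 1)" using s by (simp add: algebra_simps)
    finally show ?thesis using sn \<open>d > 0\<close> by linarith
  qed
  then have sub: "x + a *\<^sub>R v + b *\<^sub>R w \<in> S" if "0 \<le> a" "a \<le> s" "0 \<le> b" "b \<le> s" for a b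
    using that d3 by (auto simp: d_def dist_commute mem_ball subset_iff)
  obtain a b where ab: "0 \<le> a" "a \<le> s" "0 \<le> b" "b \<le> s"
    "f (x + s *\<^sub>R v + s *\<^sub>R w) - f (x + s *\<^sub>R v) - f (x + s *\<^sub>R w) + f x = s * s * ?a (x + a *\<^sub>R v + b *\<^sub>R w)"
    using second_difference_mvt[OF assms(1) s sub] by blast
  have sub': "x + a *\<^sub>R w + b *\<^sub>R v \<in> S" if "0 \<le> a" "a \<le> s" "0 \<le> b" "b \<le> s" for a b
    using sub[OF that(3,4,1,2)] by (simp add: algebra_simps)
  obtain a' b' where ab': "0 \<le> a'" "a' \<le> s" "0 \<le> b'" "b' \<le> s"
    "f (x + s *\<^sub>R w + s *\<^sub>R v) - f (x + s *\<^sub>R w) - f (x + s *\<^sub>R v) + f x = s * s * ?b (x + a' *\<^sub>R w + b' *\<^sub>R v)"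
    using second_difference_mvt[OF assms(1) s sub'] by blast
  define y where "y = x + a *\<^sub>R v + b *\<^sub>R w"
  define z where "z = x + b' *\<^sub>R v + a' *\<^sub>R w"
  have z: "z = x + a' *\<^sub>R w + b' *\<^sub>R v" by (simp add: z_def algebra_simps)
  have "s * s * ?a y = s * s * ?b z" using ab(5) ab'(5) unfolding y_def z by (simp add: algebra_simps)
  then have "?a y = ?b z" using s by simp
  moreover have "dist (?a y) (?a x) < e/2"
    using near[OF ab(1-4)] sub[OF ab(1-4)] d1 unfolding y_def by (simp add: d_def)
  moreover have "dist (?b z) (?b x) < e/2"
    using near[OF ab'(3,4,1,2)] sub[OF ab'(3,4,1,2)] d2 unfolding z_def by (simp add: d_def)
  ultimately have "e < e"
    using dist_triangle[of "?a x" "?b x" "?a y"] by (simp add: e_def dist_commute)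
  then show False by simp
qed

lemma fd_commute:
  fixes f :: "'a::euclidean_space \<Rightarrow> 'b::euclidean_space"
  assumes "smooth_on S f" "open S" "x \<in> S"
  shows "fd (\<lambda>y. fd f y v) x w = fd (\<lambda>y. fd f y w) x v"
proof (rule euclidean_eqI)
  fix b :: 'b
  have *: "fd (\<lambda>y. fd f y v) x w \<bullet> b = fd (\<lambda>y. fd (\<lambda>z. f z \<bullet> b) y v) x w" for v w
  proof -
    have "fd (\<lambda>z. f z \<bullet> b) y v = fd f y v \<bullet> b" if "y \<in> S" for y
      using fd_eq[OF has_derivative_inner_left[OF smooth_on_has_derivative[OF assms(1) that]]] by simp
    then have "fd (\<lambda>y. fd (\<lambda>z. f z \<bullet> b) y v) x w = fd (\<lambda>y. fd f y v \<bullet> b) x w"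
      using fd_cong[OF assms(2,3), of "\<lambda>y. fd (\<lambda>z. f z \<bullet> b) y v" "\<lambda>y. fd f y v \<bullet> b"] by simp
    also have "\<dots> = fd (\<lambda>y. fd f y v) x w \<bullet> b"
      using fd_eq[OF has_derivative_inner_left[OF smooth_on_has_derivative[OF smooth_on_fd[OF assms(1)] assms(3)]]] by simp
    finally show ?thesis by simp
  qed
  have "smooth_on S (\<lambda>z. f z \<bullet> b)"
    by (intro smooth_on_bounded_linear_comp[OF bounded_linear_inner_left] assms)
  then show "fd (\<lambda>y. fd f y v) x w \<bullet> b = fd (\<lambda>y. fd f y w) x v \<bullet> b"
    unfolding * by (intro fd_commute_real[OF _ assms(2,3)] smooth_onD)
qed

section \<open>Ordinary differential equations\<close>

lemma vector_mvt_bound: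
  fixes e :: "real \<Rightarrow> 'a::real_normed_vector"
  assumes "\<And>t. t \<in> {-T..T} \<Longrightarrow> (e has_vector_derivative e' t) (at t within {-T..T})"
    and "\<And>t. t \<in> {-T..T} \<Longrightarrow> norm (e' t) \<le> B" and "t \<in> {-T..T}"
  shows "norm (e t - e 0) \<le> B * \<bar>t\<bar>"
proof -
  have "norm (e t - e 0) \<le> B * norm (t - 0)"
  proof (rule differentiable_bound[of "{-T..T}" e "\<lambda>t h. h *\<^sub>R e' t"])
    fix s assume s: "s \<in> {-T..T}"
    show "(e has_derivative (\<lambda>h. h *\<^sub>R e' s)) (at s within {-T..T})"
      using assms(1)[OF s] by (simp add: has_vector_derivative_def)
    show "onorm (\<lambda>h. h *\<^sub>R e' s) \<le> B"
      using assms(2)[OF s]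
      by (intro onorm_le) (simp add: mult.commute[of B] mult_left_mono)
  qed (use assms(3) in auto)
  then show ?thesis by simp
qed

text \<open>A short-interval substitute for the inequality of Gronwall. Where
  \<open>norm (e t)\<close> attains its maximum \<open>m\<close>, one has
  \<open>m \<le> norm (e 0) + T * (a * m + b)\<close>; three quarters of \<open>m\<close> are
  absorbed on the left, which leaves the factor 4. The threshold 3/4 instead of 1/2 leaves room for
  a small enlargement of the Lipschitz constant.\<close>

lemma short_time_bound:
  fixes e :: "real \<Rightarrow> 'a::real_normed_vector"
  assumes de: "\<And>t. t \<in> {-T..T} \<Longrightarrow> (e has_vector_derivative e' t) (at t within {-T..T})"
    and bound: "\<And>t. t \<in> {-T..T} \<Longrightarrow> norm (e' t) \<le> a * norm (e t) + b"
    and "0 \<le> a" "T * a \<le> 3/4" "t \<in> {-T..T}"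
  shows "norm (e t) \<le> 4 * (norm (e 0) + T * b)"
proof -
  have T: "T \<ge> 0" using assms(5) by auto
  have "continuous_on {-T..T} (\<lambda>t. norm (e t))"
    using de by (intro continuous_on_norm continuous_on_vector_derivative)
  then obtain s where s: "s \<in> {-T..T}" "\<And>t. t \<in> {-T..T} \<Longrightarrow> norm (e t) \<le> norm (e s)"
    using continuous_attains_sup[of "{-T..T}" "\<lambda>t. norm (e t)"] T by auto
  define m where "m = norm (e s)"
  have B: "norm (e' t) \<le> a * m + b" if "t \<in> {-T..T}" for t
    using bound[OF that] mult_left_mono[OF s(2)[OF that] assms(3)] by (simp add: m_def)
  have "0 \<le> a * m + b" using B[OF s(1)] norm_ge_zero order_trans by blast
  then have "(a * m + b) * \<bar>s\<bar> \<le> (a * m + b) * T" using s(1) by (intro mult_left_mono) auto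
  moreover have "norm (e s - e 0) \<le> (a * m + b) * \<bar>s\<bar>"
    by (rule vector_mvt_bound[OF de B s(1)])
  ultimately have "norm (e s - e 0) \<le> (T * a) * m + T * b" by (simp add: algebra_simps)
  moreover have "(T * a) * m \<le> 3/4 * m" using assms(4) by (intro mult_right_mono) (auto simp: m_def)
  moreover have "m \<le> norm (e 0) + norm (e s - e 0)" using norm_triangle_sub unfolding m_def by blast
  ultimately have "m \<le> 4 * (norm (e 0) + T * b)" by simp
  then show ?thesis using s(2)[OF assms(5)] by (simp add: m_def)
qed

text \<open>The Picard operator is written with antiderivatives; on an interval of half-length \<open>T\<close> with
  \<open>T L \<le> 1/2\<close> it contracts the supremum distance by the factor \<open>1/2\<close>.\<close>

lemma picard:
  fixes F :: "real \<Rightarrow> 'a::banach \<Rightarrow> 'a"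
  assumes T: "0 \<le> T" and cont: "continuous_on ({-T..T} \<times> UNIV) (\<lambda>(t, u). F t u)"
    and lip: "\<And>t u w. t \<in> {-T..T} \<Longrightarrow> norm (F t u - F t w) \<le> L * norm (u - w)"
    and L: "0 \<le> L" "T * L \<le> 1/2"
  obtains u where "u 0 = u0"
    "\<And>t. t \<in> {-T..T} \<Longrightarrow> (u has_vector_derivative F t (u t)) (at t within {-T..T})"
proof -
  have "\<exists>g. g 0 = u0 \<and> (\<forall>t\<in>{-T..T}. (g has_vector_derivative F t (apply_bcontfun v t)) (at t within {-T..T}))"
    for v :: "real \<Rightarrow>\<^sub>C 'a"
  proof -
    have "continuous_on {-T..T} (\<lambda>t. (case (t, apply_bcontfun v t) of (t, u) \<Rightarrow> F t u))"
      by (rule continuous_on_compose2[OF cont]) (auto intro!: continuous_intros)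
    then have "continuous_on {-T..T} (\<lambda>t. F t (apply_bcontfun v t))" by simp
    from antiderivative_continuous[OF this] obtain g where
      g: "\<And>t. t \<in> {-T..T} \<Longrightarrow> (g has_vector_derivative F t (apply_bcontfun v t)) (at t within {-T..T})"
      by blast
    have "((\<lambda>t. g t + (u0 - g 0)) has_vector_derivative F t (apply_bcontfun v t)) (at t within {-T..T})"
      if "t \<in> {-T..T}" for t
      using has_vector_derivative_add[OF g[OF that] has_vector_derivative_const] by simp
    then show ?thesis by (intro exI[of _ "\<lambda>t. g t + (u0 - g 0)"]) auto
  qed
  then obtain J where J0: "\<And>v. J v 0 = u0" and J: "\<And>v t. t \<in> {-T..T} \<Longrightarrow>
      (J v has_vector_derivative F t (apply_bcontfun v t)) (at t within {-T..T})"
    by metis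
  \<comment> \<open>Clamping the time extends the antiderivative by constants beyond the interval,
    so that it becomes an element of the complete space of bounded continuous functions on the
    line.\<close>
  have "\<exists>g :: real \<Rightarrow>\<^sub>C 'a. \<forall>x. apply_bcontfun g x = J v (clamp (-T) T x)" for v
  proof -
    have "continuous_on (cbox (-T) T) (J v)"
      using J by (intro continuous_on_vector_derivative) auto
    then obtain g :: "real \<Rightarrow>\<^sub>C 'a" where "\<And>x. apply_bcontfun g x = J v (clamp (-T) T x)"
      by (rule continuous_on_cbox_bcontfunE) blast
    then show ?thesis by blast
  qed
  then obtain \<Phi> :: "(real \<Rightarrow>\<^sub>C 'a) \<Rightarrow> (real \<Rightarrow>\<^sub>C 'a)"
    where \<Phi>: "\<And>v x. apply_bcontfun (\<Phi> v) x = J v (clamp (-T) T x)" by metis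
  have "dist (\<Phi> v) (\<Phi> w) \<le> 1/2 * dist v w" for v w
  proof (rule dist_bound)
    fix x
    let ?x = "clamp (-T) T x"
    have x: "?x \<in> {-T..T}" using T clamp_in_interval[of "-T" T x] by simp
    have "norm ((J v ?x - J w ?x) - (J v 0 - J w 0)) \<le> (L * dist v w) * \<bar>?x\<bar>"
    proof (rule vector_mvt_bound[where e="\<lambda>t. J v t - J w t"])
      fix t assume t: "t \<in> {-T..T}"
      show "((\<lambda>t. J v t - J w t) has_vector_derivative
          F t (apply_bcontfun v t) - F t (apply_bcontfun w t)) (at t within {-T..T})"
        by (intro has_vector_derivative_diff J t)
      have "norm (F t (apply_bcontfun v t) - F t (apply_bcontfun w t))
          \<le> L * dist (apply_bcontfun v t) (apply_bcontfun w t)"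
        using lip[OF t] by (simp add: dist_norm)
      also have "\<dots> \<le> L * dist v w" using L dist_bounded by (intro mult_left_mono) auto
      finally show "norm (F t (apply_bcontfun v t) - F t (apply_bcontfun w t)) \<le> L * dist v w" .
    qed (rule x)
    also have "\<dots> \<le> (L * dist v w) * T" using x L by (intro mult_left_mono) auto
    also have "\<dots> = (T * L) * dist v w" by simp
    also have "\<dots> \<le> 1/2 * dist v w" using L by (intro mult_right_mono) auto
    finally show "dist (apply_bcontfun (\<Phi> v) x) (apply_bcontfun (\<Phi> w) x) \<le> 1/2 * dist v w"
      by (simp add: \<Phi> J0 dist_norm)
  qed
  then have "\<exists>!v. \<Phi> v = v" by (intro banach_fix_type[of "1/2"]) auto
  then obtain v where v: "\<Phi> v = v" by auto
  have "apply_bcontfun v t = J v t" if "t \<in> {-T..T}" for t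
    using \<Phi>[of v t] v that by simp
  then show ?thesis using J[of _ v] J0[of v] that[of "J v"] by simp
qed

text \<open>\<open>d\<close> is a Lebesgue number of the cover of \<open>C\<close> by open sets on
  which \<open>g\<close> varies by less than \<open>e\<close>. In contrast to uniform continuity on
  \<open>C\<close>, it controls points \<open>z\<close> off \<open>C\<close>; perturbed solutions
  leave the compact reference curve.\<close>

lemma uniform_near_compact:
  fixes g :: "'a::metric_space \<Rightarrow> 'b::metric_space"
  assumes "compact C" "C \<subseteq> S" "open S" "continuous_on S g" "e > 0"
  obtains d where "d > 0" "\<And>c z. c \<in> C \<Longrightarrow> dist z c < d \<Longrightarrow> z \<in> S \<and> dist (g z) (g c) < e"
proof -
  let ?G = "{U. open U \<and> U \<subseteq> S \<and> (\<forall>z\<in>U. \<forall>w\<in>U. dist (g z) (g w) < e)}"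
  have "C \<subseteq> \<Union>?G"
  proof
    fix c assume "c \<in> C"
    then have c: "c \<in> S" using assms by auto
    define U where "U = S \<inter> g -` ball (g c) (e/2)"
    have "open U" unfolding U_def using assms(3,4) by (simp add: continuous_open_preimage)
    moreover have "dist (g z) (g w) < e" if "z \<in> U" "w \<in> U" for z w
      using that dist_triangle_half_r[of "g c" "g z" e "g w"] by (simp add: U_def)
    ultimately have "U \<in> ?G" by (auto simp: U_def)
    moreover have "c \<in> U" using c assms(5) by (simp add: U_def)
    ultimately show "c \<in> \<Union>?G" by blast
  qed
  then obtain d where d: "d > 0" "\<And>c. c \<in> C \<Longrightarrow> \<exists>U\<in>?G. ball c d \<subseteq> U"
    by (rule Heine_Borel_lemma[OF assms(1)]) auto
  show ?thesis
  proof (rule that[OF d(1)])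
    fix c z assume c: "c \<in> C" and z: "dist z c < d"
    from d(2)[OF c] obtain U where U: "U \<in> ?G" "ball c d \<subseteq> U" ..
    have "z \<in> U" "c \<in> U" using U(2) z d(1) by (auto simp: subset_iff dist_commute)
    then show "z \<in> S \<and> dist (g z) (g c) < e" using U(1) by blast
  qed
qed

text \<open>The difference of two solutions satisfies the short-time bound with
  \<open>a = L\<close>; the inhomogeneity \<open>b\<close> is the variation of \<open>F\<close> in
  the parameter alone, with the unknown frozen on the reference solution.\<close>

lemma ode_uniform_continuity:
  fixes F :: "(real \<times> 'p::euclidean_space) \<times> 'e::euclidean_space \<Rightarrow> 'e"
  assumes op: "open P" "open D" and dL: "d * L \<le> 1/2" "0 \<le> L"
    and F: "continuous_on (({-d<..<d} \<times> P) \<times> D) F"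
    and lip: "\<And>t x v w. \<lbrakk>\<bar>t\<bar> < d; x \<in> P; v \<in> D; w \<in> D\<rbrakk> \<Longrightarrow>
        norm (F ((t, x), v) - F ((t, x), w)) \<le> L * norm (v - w)"
    and uD: "\<And>t x. \<lbrakk>\<bar>t\<bar> < d; x \<in> P\<rbrakk> \<Longrightarrow> u (t, x) \<in> D"
    and du: "\<And>t x. \<lbrakk>\<bar>t\<bar> < d; x \<in> P\<rbrakk> \<Longrightarrow>
        ((\<lambda>s. u (s, x)) has_vector_derivative F ((t, x), u (t, x))) (at t)"
    and u0: "continuous_on P (\<lambda>x. u (0, x))"
    and x1: "x1 \<in> P" and T: "0 < T" "T < d" and e: "e > 0"
  obtains r where "r > 0" "\<And>x. dist x x1 < r \<Longrightarrow> x \<in> P"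
    "\<And>t x. dist x x1 < r \<Longrightarrow> \<bar>t\<bar> \<le> T \<Longrightarrow> norm (u (t, x) - u (t, x1)) < e"
proof -
  let ?I = "{-T..T}"
  have dI: "((\<lambda>s. u (s, x)) has_vector_derivative F ((t, x), u (t, x))) (at t within ?I)"
    if "t \<in> ?I" "x \<in> P" for t x
    by (rule has_vector_derivative_at_within[OF du]) (use that T in auto)
  define C where "C = (\<lambda>t. ((t, x1), u (t, x1))) ` ?I"
  have "continuous_on ?I (\<lambda>t. u (t, x1))"
    by (rule continuous_on_vector_derivative[OF dI]) (use x1 in auto)
  then have "compact C" unfolding C_def
    by (intro compact_continuous_image continuous_on_Pair continuous_on_id continuous_on_const) auto
  moreover have "C \<subseteq> ({-d<..<d} \<times> P) \<times> D" using uD x1 T by (auto simp: C_def)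
  moreover have "open (({-d<..<d} \<times> P) \<times> D)" using op by (simp add: open_Times)
  \<comment> \<open>This error, multiplied by \<open>T\<close>, is at most \<open>e / 16\<close>.
    Together with an initial difference below \<open>e / 16\<close> and the factor 4 of the
    short-time bound, the total stays below \<open>e / 2\<close>.\<close>
  moreover have e1: "e / (16 * (T + 1)) > 0" using e T by simp
  ultimately obtain r1 where r1: "r1 > 0" "\<And>c z. c \<in> C \<Longrightarrow> dist z c < r1 \<Longrightarrow>
      z \<in> ({-d<..<d} \<times> P) \<times> D \<and> dist (F z) (F c) < e / (16 * (T + 1))"
    using uniform_near_compact F by metis
  obtain r2 where r2: "r2 > 0" "\<And>x. x \<in> P \<Longrightarrow> dist x x1 \<le> r2 \<Longrightarrow> dist (u (0, x)) (u (0, x1)) < e/16"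
    using continuous_onE[OF u0 x1, of "e/16"] e by auto
  obtain r3 where r3: "r3 > 0" "ball x1 r3 \<subseteq> P" using op(1) x1 open_contains_ball by blast
  define r where "r = min r1 (min r2 r3)"
  show ?thesis
  proof (rule that[of r])
    show "r > 0" using r1 r2 r3 by (simp add: r_def)
    show P: "x \<in> P" if "dist x x1 < r" for x
      using that r3(2) by (auto simp: r_def dist_commute subset_iff)
    fix t x assume x: "dist x x1 < r" and t: "\<bar>t\<bar> \<le> T"
    have "norm (u (t, x) - u (t, x1)) \<le> 4 * (norm (u (0, x) - u (0, x1)) + T * (e / (16 * (T + 1))))"
    proof (rule short_time_bound[where e="\<lambda>t. u (t, x) - u (t, x1)" and a=L and T=T])
      fix s assume s: "s \<in> ?I"
      show "((\<lambda>t. u (t, x) - u (t, x1)) has_vector_derivative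
          F ((s, x), u (s, x)) - F ((s, x1), u (s, x1))) (at s within ?I)"
        by (intro has_vector_derivative_diff dI s P x x1)
      have sd: "\<bar>s\<bar> < d" using s T by auto
      have "dist ((s, x), u (s, x1)) ((s, x1), u (s, x1)) < r1"
        using x by (simp add: dist_Pair_Pair r_def)
      from r1(2)[OF _ this] have "dist (F ((s, x), u (s, x1))) (F ((s, x1), u (s, x1))) < e / (16 * (T + 1))"
        using s by (auto simp: C_def)
      moreover have "norm (F ((s, x), u (s, x)) - F ((s, x), u (s, x1))) \<le> L * norm (u (s, x) - u (s, x1))"
        by (intro lip uD sd P x x1)
      ultimately show "norm (F ((s, x), u (s, x)) - F ((s, x1), u (s, x1)))
          \<le> L * norm (u (s, x) - u (s, x1)) + e / (16 * (T + 1))"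
        unfolding dist_norm
        using norm_triangle_ineq[of "F ((s, x), u (s, x)) - F ((s, x), u (s, x1))"
            "F ((s, x), u (s, x1)) - F ((s, x1), u (s, x1))"] by simp
    next
      have "T * L \<le> d * L" using T dL by (intro mult_right_mono) auto
      then show "T * L \<le> 3/4" using dL by simp
    qed (use dL t in auto)
    moreover have "norm (u (0, x) - u (0, x1)) < e/16"
      using r2(2)[OF P[OF x]] x by (simp add: r_def dist_norm)
    moreover have "T * (e / (16 * (T + 1))) \<le> e / 16" using T e by (simp add: field_simps)
    moreover have "n < e" if "n \<le> 4 * (a + b)" "a < e/16" "b \<le> e/16" for n a b :: real
      using that e by argo
    ultimately show "norm (u (t, x) - u (t, x1)) < e" by blast
  qed
qed

lemma ode_continuous:
  fixes F :: "(real \<times> 'p::euclidean_space) \<times> 'e::euclidean_space \<Rightarrow> 'e"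
  assumes op: "open P" "open D" and dL: "d * L \<le> 1/2" "0 \<le> L"
    and F: "continuous_on (({-d<..<d} \<times> P) \<times> D) F"
    and lip: "\<And>t x v w. \<lbrakk>\<bar>t\<bar> < d; x \<in> P; v \<in> D; w \<in> D\<rbrakk> \<Longrightarrow>
        norm (F ((t, x), v) - F ((t, x), w)) \<le> L * norm (v - w)"
    and uD: "\<And>t x. \<lbrakk>\<bar>t\<bar> < d; x \<in> P\<rbrakk> \<Longrightarrow> u (t, x) \<in> D"
    and du: "\<And>t x. \<lbrakk>\<bar>t\<bar> < d; x \<in> P\<rbrakk> \<Longrightarrow>
        ((\<lambda>s. u (s, x)) has_vector_derivative F ((t, x), u (t, x))) (at t)"
    and u0: "continuous_on P (\<lambda>x. u (0, x))"
  shows "continuous_on ({-d<..<d} \<times> P) u"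
  unfolding continuous_on_iff
proof (intro ballI allI impI)
  fix z e assume z: "z \<in> {-d<..<d} \<times> P" and e: "(0::real) < e"
  obtain t1 x1 where z_eq: "z = (t1, x1)" by (cases z)
  have t1: "\<bar>t1\<bar> < d" and x1: "x1 \<in> P" using z z_eq by auto
  \<comment> \<open>Strictly between the absolute value of \<open>t1\<close> and \<open>d\<close>: a
    neighbourhood of \<open>t1\<close> lies in the compact interval on which the parameter
    dependence is uniform.\<close>
  define T where "T = (\<bar>t1\<bar> + d) / 2"
  have T: "0 < T" "T < d" "\<bar>t1\<bar> < T" using t1 by (auto simp: T_def)
  obtain r where r: "r > 0" "\<And>t x. dist x x1 < r \<Longrightarrow> \<bar>t\<bar> \<le> T \<Longrightarrow> norm (u (t, x) - u (t, x1)) < e/2"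
    by (rule ode_uniform_continuity[where u=u and F=F and e="e/2", OF op dL F lip uD du u0 x1 T(1,2)])
       (use e in simp_all)
  have "continuous (at t1) (\<lambda>s. u (s, x1))"
    using du[OF t1 x1] has_vector_derivative_continuous by blast
  then obtain r' where r': "r' > 0" "\<And>s. dist s t1 < r' \<Longrightarrow> dist (u (s, x1)) (u (t1, x1)) < e/2"
    using e unfolding continuous_at_eps_delta by (meson half_gt_zero)
  show "\<exists>\<delta>>0. \<forall>w\<in>{-d<..<d} \<times> P. dist w z < \<delta> \<longrightarrow> dist (u w) (u z) < e"
  proof (intro exI[of _ "min r (min r' (T - \<bar>t1\<bar>))"] conjI ballI impI)
    show "0 < min r (min r' (T - \<bar>t1\<bar>))" using r(1) r'(1) T(3) by simp
    fix w assume w: "dist w z < min r (min r' (T - \<bar>t1\<bar>))"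
    obtain s x where w_eq: "w = (s, x)" by (cases w)
    have "dist s t1 \<le> dist w z" "dist x x1 \<le> dist w z"
      using dist_fst_le[of w z] dist_snd_le[of w z] by (auto simp: w_eq z_eq)
    with w have s: "dist s t1 < r'" "dist s t1 < T - \<bar>t1\<bar>" and x: "dist x x1 < r" by auto
    have "\<bar>s\<bar> \<le> T" using s(2) by (simp add: dist_real_def)
    then have "dist (u (s, x)) (u (s, x1)) < e/2" using r(2)[OF x] by (simp add: dist_norm)
    then show "dist (u w) (u z) < e"
      using r'(2)[OF s(1)] dist_triangle_half_l[of "u (s, x1)" "u (s, x)" e "u (t1, x1)"]
        dist_triangle[of "u (s, x)" "u (t1, x1)" "u (s, x1)"]
      by (simp add: w_eq z_eq)
  qed
qed

section \<open>Differentiability in parameters, to all orders\<close>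

lemma norm_vector_derivative_le:
  fixes g :: "real \<Rightarrow> 'a::real_normed_vector"
  assumes g: "(g has_vector_derivative g') (at 0)" and r: "r > 0"
    and le: "\<And>s. \<bar>s\<bar> < r \<Longrightarrow> norm (g s - g 0) \<le> B * \<bar>s\<bar>"
  shows "norm g' \<le> B"
proof (rule field_le_epsilon)
  fix \<epsilon> :: real assume "\<epsilon> > 0"
  have "(g has_derivative (\<lambda>h. h *\<^sub>R g')) (at 0)" using g by (simp add: has_vector_derivative_def)
  then obtain d where d: "d > 0" "\<And>s. norm (s - 0) < d \<Longrightarrow> norm (g s - g 0 - (s - 0) *\<^sub>R g') \<le> \<epsilon> * norm (s - 0)"
    using \<open>\<epsilon> > 0\<close> unfolding has_derivative_at_alt by meson
  define s where "s = min d r / 2"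
  have s: "s > 0" "s < d" "s < r" using d(1) r by (auto simp: s_def)
  have "norm (g s - g 0 - s *\<^sub>R g') \<le> \<epsilon> * s" using d(2)[of s] s by simp
  moreover have "norm (g s - g 0) \<le> B * s" using le[of s] s by simp
  moreover have "norm (s *\<^sub>R g') \<le> norm (g s - g 0) + norm (g s - g 0 - s *\<^sub>R g')"
    using norm_triangle_ineq4[of "g s - g 0" "g s - g 0 - s *\<^sub>R g'"] by simp
  ultimately have "s * norm g' \<le> s * (B + \<epsilon>)" using s(1) by (simp add: algebra_simps)
  then show "norm g' \<le> B + \<epsilon>" using s(1) by simp
qed

text \<open>Through this bound the linearised equation inherits the Lipschitz constant of the
  original one: a directional derivative is a limit of difference quotients, each bounded by
  \<open>B * norm v\<close>.\<close>

lemma fd_lipschitz_bound: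
  assumes "(f has_derivative f') (at x)" "open S" "x \<in> S"
    and "\<And>y. y \<in> S \<Longrightarrow> norm (f y - f x) \<le> B * norm (y - x)"
  shows "norm (f' v) \<le> B * norm v"
proof -
  have lin: "linear f'" using assms(1) has_derivative_linear by blast
  obtain r where r: "r > 0" "ball x r \<subseteq> S" using assms(2,3) open_contains_ball by blast
  have "((\<lambda>s. x + s *\<^sub>R v) has_derivative (\<lambda>h. h *\<^sub>R v)) (at 0)" by (auto intro!: derivative_eq_intros)
  moreover have "(f has_derivative f') (at (x + 0 *\<^sub>R v))" using assms(1) by simp
  ultimately have "((\<lambda>s. f (x + s *\<^sub>R v)) has_derivative (\<lambda>h. f' (h *\<^sub>R v))) (at 0)"
    by (rule has_derivative_compose)
  then have d: "((\<lambda>s. f (x + s *\<^sub>R v)) has_vector_derivative f' v) (at 0)"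
    by (simp add: has_vector_derivative_def linear_scale[OF lin])
  show ?thesis
  proof (rule norm_vector_derivative_le[OF d])
    show "r / (norm v + 1) > 0" using r by (simp add: add_nonneg_pos)
    fix s :: real assume s: "\<bar>s\<bar> < r / (norm v + 1)"
    have n: "norm v + 1 > 0" by (simp add: add_nonneg_pos)
    have "norm (s *\<^sub>R v) \<le> \<bar>s\<bar> * (norm v + 1)" by (simp add: mult_left_mono)
    also have "\<dots> < r" using s n by (simp add: pos_less_divide_eq)
    finally have "x + s *\<^sub>R v \<in> S" using r(2) by (auto simp: subset_iff dist_norm)
    from assms(4)[OF this] show "norm (f (x + s *\<^sub>R v) - f (x + 0 *\<^sub>R v)) \<le> B * norm v * \<bar>s\<bar>"
      by (simp add: mult.commute mult.left_commute)
  qed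
qed

text \<open>The parameter derivative of a solution is obtained as the operator-valued solution \<open>Y\<close> of the
  variational equation; \<open>e(t) = u(t, x) - u(t, x\<^sub>1) - Y(t)(x - x\<^sub>1)\<close> solves that equation up to an error
  \<open>o(\<bar>x - x\<^sub>1\<bar> + \<bar>e(t)\<bar>)\<close>.\<close>

lemma ode_variational:
  fixes F :: "(real \<times> 'p::euclidean_space) \<times> 'e::euclidean_space \<Rightarrow> 'e"
  assumes op: "open P" "open D" and dL: "d * L \<le> 1/2" "0 \<le> L"
    and F: "C_k_on (Suc 0) (({-d<..<d} \<times> P) \<times> D) F"
    and lip: "\<And>t x v w. \<lbrakk>\<bar>t\<bar> < d; x \<in> P; v \<in> D; w \<in> D\<rbrakk> \<Longrightarrow>
        norm (F ((t, x), v) - F ((t, x), w)) \<le> L * norm (v - w)"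
    and uD: "\<And>t x. \<lbrakk>\<bar>t\<bar> < d; x \<in> P\<rbrakk> \<Longrightarrow> u (t, x) \<in> D"
    and du: "\<And>t x. \<lbrakk>\<bar>t\<bar> < d; x \<in> P\<rbrakk> \<Longrightarrow>
        ((\<lambda>s. u (s, x)) has_vector_derivative F ((t, x), u (t, x))) (at t)"
    and u0: "C_k_on (Suc 0) P (\<lambda>x. u (0, x))"
    and x1: "x1 \<in> P" and T: "0 < T" "T < d"
  shows "\<exists>Y :: real \<Rightarrow> 'p \<Rightarrow>\<^sub>L 'e. \<forall>t. \<bar>t\<bar> < T \<longrightarrow>
    (\<forall>h. ((\<lambda>s. Y s h) has_vector_derivative fd F ((t, x1), u (t, x1)) ((0, h), Y t h)) (at t)) \<and>
    (u has_derivative (\<lambda>(\<tau>, h). \<tau> *\<^sub>R F ((t, x1), u (t, x1)) + Y t h)) (at (t, x1))"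
proof -
  let ?I = "{-T..T}" and ?S = "({-d<..<d} \<times> P) \<times> D"
  have opS: "open ?S" using op by (simp add: open_Times)
  obtain F' where F': "continuous_on ?S F'" "\<And>z. z \<in> ?S \<Longrightarrow> (F has_derivative blinfun_apply (F' z)) (at z)"
    "\<And>z. z \<in> ?S \<Longrightarrow> blinfun_apply (F' z) = fd F z"
    using C1_blinfun[OF F opS] by blast
  have dI: "((\<lambda>s. u (s, x)) has_vector_derivative F ((t, x), u (t, x))) (at t within ?I)"
    if "t \<in> ?I" "x \<in> P" for t x
    by (rule has_vector_derivative_at_within[OF du]) (use that T in auto)
  define z where "z t = ((t, x1), u (t, x1))" for t
  have zS: "z t \<in> ?S" if "t \<in> ?I" for t
    using that T x1 uD by (auto simp: z_def)
  have contu: "continuous_on ?I (\<lambda>t. u (t, x1))"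
    by (rule continuous_on_vector_derivative[OF dI]) (use x1 in auto)
  have contz: "continuous_on ?I z" unfolding z_def
    by (intro continuous_on_Pair continuous_on_id continuous_on_const contu)
  have contF'z: "continuous_on ?I (\<lambda>t. F' (z t))"
    by (rule continuous_on_compose2[OF F'(1) contz]) (use zS in blast)
  \<comment> \<open>Composing \<open>F'\<close> with these two embeddings gives \<open>B\<close> and
    \<open>A\<close>, the partial derivatives of \<open>F\<close> in the parameter and in the
    unknown along the reference solution.\<close>
  define ip :: "'p \<Rightarrow>\<^sub>L ((real \<times> 'p) \<times> 'e)" where "ip = Blinfun (\<lambda>h. ((0, h), 0))"
  define ie :: "'e \<Rightarrow>\<^sub>L ((real \<times> 'p) \<times> 'e)" where "ie = Blinfun (\<lambda>w. ((0, 0), w))"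
  have "bounded_linear (\<lambda>h::'p. ((0::real, h), 0::'e))" "bounded_linear (\<lambda>w::'e. ((0::real, 0::'p), w))"
    by (intro bounded_linear_Pair bounded_linear_zero bounded_linear_ident)+
  then have ip: "blinfun_apply ip h = ((0, h), 0)" and ie: "blinfun_apply ie w = ((0, 0), w)" for h w
    by (simp_all add: ip_def ie_def bounded_linear_Blinfun_apply)
  define A where "A t = F' (z t) o\<^sub>L ie" for t
  define B where "B t = F' (z t) o\<^sub>L ip" for t
  have AB: "A t w + B t h = F' (z t) ((0, h), w)" for t w h
    unfolding A_def B_def blinfun_compose.rep_eq o_def ip ie
    by (simp flip: blinfun.add_right)
  have contA: "continuous_on ?I A" and contB: "continuous_on ?I B"
    unfolding A_def B_def
    by (intro bounded_bilinear.continuous_on[OF bounded_bilinear_blinfun_compose] contF'z continuous_on_const)+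
  have A: "norm (A t w) \<le> L * norm w" if t: "t \<in> ?I" for t w
  proof -
    have t': "\<bar>t\<bar> < d" using t T by auto
    have i: "((\<lambda>w. ((t, x1), w)) has_derivative (\<lambda>w. ((0, 0), w))) (at (u (t, x1)))"
      unfolding zero_prod_def[symmetric]
      by (intro has_derivative_Pair has_derivative_const has_derivative_ident)
    have "(F has_derivative F' (z t)) (at ((t, x1), u (t, x1)))"
      using F'(2)[OF zS[OF t]] by (simp add: z_def)
    from has_derivative_compose[OF i this]
    have "((\<lambda>w. F ((t, x1), w)) has_derivative (\<lambda>w. A t w)) (at (u (t, x1)))"
      by (simp only: A_def blinfun_compose.rep_eq o_def ie)
    then show ?thesis
      by (rule fd_lipschitz_bound[OF _ op(2) uD[OF t' x1]]) (intro lip t' x1 uD)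
  qed
  have nA: "norm (A t) \<le> L" if "t \<in> ?I" for t
    by (rule norm_blinfun_bound) (use A that dL in auto)
  have TL: "T * L \<le> 1/2" using mult_right_mono[of T d L] T dL by simp
  obtain u0' where u0': "((\<lambda>x. u (0, x)) has_derivative blinfun_apply u0') (at x1)"
    using C1_blinfun[OF u0 op(1)] x1 by metis
  \<comment> \<open>A single operator-valued equation handles all directions \<open>h\<close> at
    once and gives continuity of \<open>Y\<close> in operator norm; this is the use of Picard
    iteration in a general Banach space. The initial value is the derivative of the initial
    data.\<close>
  obtain Y where Y0: "Y 0 = u0'"
    and Y: "\<And>t. t \<in> ?I \<Longrightarrow> (Y has_vector_derivative ((A t o\<^sub>L Y t) + B t)) (at t within ?I)"
  proof (rule picard[of T "\<lambda>t Y. (A t o\<^sub>L Y) + B t" L u0'])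
    have "continuous_on (?I \<times> UNIV) (\<lambda>p::real \<times> ('p \<Rightarrow>\<^sub>L 'e). (A (fst p) o\<^sub>L snd p) + B (fst p))"
      by (intro continuous_on_add bounded_bilinear.continuous_on[OF bounded_bilinear_blinfun_compose]
          continuous_on_compose2[OF contA] continuous_on_compose2[OF contB] continuous_on_fst
          continuous_on_snd continuous_on_id) auto
    then show "continuous_on (?I \<times> UNIV) (\<lambda>(t, Y). (A t o\<^sub>L Y) + B t)"
      by (simp add: case_prod_unfold)
    fix t and U W :: "'p \<Rightarrow>\<^sub>L 'e" assume t: "t \<in> ?I"
    have "norm ((A t o\<^sub>L U) + B t - ((A t o\<^sub>L W) + B t)) = norm (A t o\<^sub>L (U - W))"
      by (simp add: bounded_bilinear.diff_right[OF bounded_bilinear_blinfun_compose])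
    also have "\<dots> \<le> norm (A t) * norm (U - W)" by (rule norm_blinfun_compose)
    also have "\<dots> \<le> L * norm (U - W)" by (intro mult_right_mono nA t) simp
    finally show "norm ((A t o\<^sub>L U) + B t - ((A t o\<^sub>L W) + B t)) \<le> L * norm (U - W)" .
  qed (use T dL TL in auto)
  have Yh: "((\<lambda>s. Y s h) has_vector_derivative F' (z t) ((0, h), Y t h)) (at t within ?I)" if "t \<in> ?I" for t h
  proof -
    have "((\<lambda>s. Y s h) has_vector_derivative ((A t o\<^sub>L Y t) + B t) h) (at t within ?I)"
      using bounded_linear.has_vector_derivative[OF blinfun.bounded_linear_left Y[OF that]] .
    then show ?thesis by (simp add: blinfun.add_left AB)
  qed
  have contY: "continuous_on ?I Y" using Y by (rule continuous_on_vector_derivative)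
  have "compact (Y ` ?I)" using contY by (intro compact_continuous_image) auto
  then obtain N where N: "N > 0" "\<And>t. t \<in> ?I \<Longrightarrow> norm (Y t) \<le> N"
    using bounded_pos compact_imp_bounded by (metis imageI)
  have key: "\<exists>r>0. \<forall>x. norm (x - x1) < r \<longrightarrow>
      (\<forall>t\<in>?I. norm (u (t, x) - u (t, x1) - Y t (x - x1)) \<le> \<epsilon> * norm (x - x1))" if "\<epsilon> > 0" for \<epsilon>
  proof -
    \<comment> \<open>\<open>q * e1\<close> is the factor that the short-time bound returns for an
      initial error \<open>e1 * norm h\<close> and an inhomogeneity
      \<open>e1 * (1 + N) * norm h\<close>. Hence \<open>e1\<close> is at most
      \<open>\<epsilon> / q\<close>; the other bound \<open>1 / (4 * T)\<close> secures
      \<open>T * (L + e1) \<le> 3/4\<close>.\<close>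
    define q where "q = 4 * (1 + T * (1 + N))"
    have q: "q > 0" using T N unfolding q_def by (intro mult_pos_pos add_pos_pos) auto
    define e1 where "e1 = min (1 / (4 * T)) (\<epsilon> / q)"
    have e1: "e1 > 0" "T * e1 \<le> 1/4" "q * e1 \<le> \<epsilon>"
    proof -
      show "e1 > 0" using T q that by (simp add: e1_def)
      have "T * e1 \<le> T * (1 / (4 * T))" using T by (intro mult_left_mono) (auto simp: e1_def)
      then show "T * e1 \<le> 1/4" using T by simp
      have "q * e1 \<le> q * (\<epsilon> / q)" using q by (intro mult_left_mono) (auto simp: e1_def)
      then show "q * e1 \<le> \<epsilon>" using q by simp
    qed
    have "compact (z ` ?I)" using contz by (intro compact_continuous_image) auto
    moreover have "z ` ?I \<subseteq> ?S" using zS by blast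
    ultimately obtain r1 where r1: "r1 > 0"
      "\<And>c y. c \<in> z ` ?I \<Longrightarrow> dist y c < r1 \<Longrightarrow> y \<in> ?S \<and> dist (F' y) (F' c) < e1"
      using uniform_near_compact[OF _ _ opS F'(1) e1(1)] by metis
    obtain r2 where r2: "r2 > 0" "\<And>x. dist x x1 < r2 \<Longrightarrow> x \<in> P"
      "\<And>t x. dist x x1 < r2 \<Longrightarrow> \<bar>t\<bar> \<le> T \<Longrightarrow> norm (u (t, x) - u (t, x1)) < r1/2"
      by (rule ode_uniform_continuity[where u=u and F=F and e="r1/2", OF op dL
            C_k_on_imp_continuous_on[OF F] lip uD du C_k_on_imp_continuous_on[OF u0] x1 T])
         (use r1(1) in simp_all)
    obtain r3 where r3: "r3 > 0" "\<And>x. norm (x - x1) < r3 \<Longrightarrow>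
        norm (u (0, x) - u (0, x1) - u0' (x - x1)) \<le> e1 * norm (x - x1)"
      using u0' e1(1) unfolding has_derivative_at_alt by meson
    define r where "r = min (r1/2) (min r2 r3)"
    show ?thesis
    proof (intro exI[of _ r] conjI allI impI ballI)
      show "r > 0" using r1 r2 r3 by (simp add: r_def)
      fix x t assume x: "norm (x - x1) < r" and t: "t \<in> ?I"
      define h where "h = x - x1"
      have xP: "x \<in> P" using x r2(2) by (simp add: r_def dist_norm)
      define e where "e t = u (t, x) - u (t, x1) - Y t h" for t
      \<comment> \<open>First-order expansion of \<open>F\<close> at the reference point, by the
        mean value inequality on the ball of radius \<open>r1\<close>, where \<open>F'\<close> moves
        by less than \<open>e1\<close>. The radius is split in halves between \<open>h\<close> and
        the difference of the solutions.\<close>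
      have lin: "norm (F ((s, x), u (s, x)) - F (z s) - F' (z s) ((0, h), u (s, x) - u (s, x1)))
          \<le> e1 * (norm h + norm (u (s, x) - u (s, x1)))" if s: "s \<in> ?I" for s
      proof -
        define y where "y = ((s, x), u (s, x))"
        have yz: "y - z s = ((0, h), u (s, x) - u (s, x1))" by (simp add: y_def z_def h_def)
        have "norm (y - z s) \<le> norm h + norm (u (s, x) - u (s, x1))"
          unfolding yz using norm_Pair_le[of "(0::real, h)" "u (s, x) - u (s, x1)"] by simp
        moreover have "norm (u (s, x) - u (s, x1)) < r1/2"
          by (intro r2(3)) (use x s in \<open>auto simp: r_def dist_norm\<close>)
        moreover have "norm h < r1/2" using x by (simp add: h_def r_def)
        ultimately have dy: "norm (y - z s) < r1" by argo
        have B: "y' \<in> ?S \<and> norm (F' y' - F' (z s)) < e1" if "y' \<in> ball (z s) r1" for y'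
          using r1(2)[of "z s" y'] s that by (auto simp: dist_norm norm_minus_commute)
        have "norm (F y - F (z s) - F' (z s) (y - z s)) \<le> norm (y - z s) * e1"
        proof (rule differentiable_bound_linearization[where S="ball (z s) r1"])
          fix \<theta> :: real assume "\<theta> \<in> {0..1}"
          then have "norm (\<theta> *\<^sub>R (y - z s)) \<le> norm (y - z s)" by (simp add: mult_left_le_one_le)
          then show "z s + \<theta> *\<^sub>R (y - z s) \<in> ball (z s) r1" using dy by (simp add: dist_norm)
        next
          fix y' assume y': "y' \<in> ball (z s) r1"
          show "(F has_derivative F' y') (at y' within ball (z s) r1)"
            using B[OF y'] F'(2) has_derivative_at_withinI by blast
          have "blinfun_apply (F' y') - blinfun_apply (F' (z s)) = blinfun_apply (F' y' - F' (z s))"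
            by (simp add: fun_eq_iff blinfun.diff_left)
          then show "onorm (blinfun_apply (F' y') - blinfun_apply (F' (z s))) \<le> e1"
            using B[OF y'] by (simp add: norm_blinfun.rep_eq)
        qed (use r1 in auto)
        also have "\<dots> \<le> e1 * (norm h + norm (u (s, x) - u (s, x1)))"
          using \<open>norm (y - z s) \<le> _\<close> e1(1) by (simp add: mult.commute[of _ e1])
        finally show ?thesis unfolding yz by (simp add: y_def)
      qed
      have "norm (e t) \<le> 4 * (norm (e 0) + T * (e1 * (1 + N) * norm h))"
      proof (rule short_time_bound[where T=T and a="L + e1"])
        fix s assume s: "s \<in> ?I"
        show "(e has_vector_derivative F ((s, x), u (s, x)) - F (z s) - F' (z s) ((0, h), Y s h))
            (at s within ?I)"
          unfolding e_def z_def
          by (intro has_vector_derivative_diff dI s xP x1 Yh[unfolded z_def])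
        have *: "F' (z s) ((0, h), u (s, x) - u (s, x1)) = F' (z s) ((0, h), Y s h) + A s (e s)"
          unfolding AB[symmetric] by (simp add: e_def blinfun.diff_right blinfun.add_right)
        have "norm (u (s, x) - u (s, x1)) \<le> norm (e s) + norm (Y s h)"
          unfolding e_def using norm_triangle_sub[of "u (s, x) - u (s, x1)" "Y s h"] by simp
        also have "norm (Y s h) \<le> N * norm h"
          using norm_blinfun[of "Y s" h] mult_right_mono[OF N(2)[OF s], of "norm h"] by simp
        finally have "e1 * (norm h + norm (u (s, x) - u (s, x1))) \<le> e1 * (norm h + (norm (e s) + N * norm h))"
          using e1(1) by simp
        with lin[OF s] have 1: "norm (F ((s, x), u (s, x)) - F (z s) - (F' (z s) ((0, h), Y s h) + A s (e s)))
          \<le> e1 * (norm h + (norm (e s) + N * norm h))" unfolding * by linarith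
        have "norm (F ((s, x), u (s, x)) - F (z s) - F' (z s) ((0, h), Y s h))
          \<le> norm (F ((s, x), u (s, x)) - F (z s) - (F' (z s) ((0, h), Y s h) + A s (e s))) + norm (A s (e s))"
          by (rule order_trans[OF _ norm_triangle_ineq]) simp
        also have "\<dots> \<le> e1 * (norm h + (norm (e s) + N * norm h)) + L * norm (e s)"
          by (intro add_mono 1 A s)
        also have "\<dots> = (L + e1) * norm (e s) + e1 * (1 + N) * norm h" by (simp add: algebra_simps)
        finally show "norm (F ((s, x), u (s, x)) - F (z s) - F' (z s) ((0, h), Y s h))
          \<le> (L + e1) * norm (e s) + e1 * (1 + N) * norm h" .
      next
        have "T * (L + e1) = T * L + T * e1" by (simp add: algebra_simps)
        then show "T * (L + e1) \<le> 3/4" using TL e1(2) by linarith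
      qed (use dL e1 t in auto)
      moreover have "norm (e 0) \<le> e1 * norm h"
        using r3(2)[of x] x by (simp add: e_def h_def Y0 r_def)
      ultimately have "norm (e t) \<le> 4 * (e1 * norm h + T * (e1 * (1 + N) * norm h))" by argo
      also have "\<dots> = q * e1 * norm h" by (simp add: q_def algebra_simps)
      also have "\<dots> \<le> \<epsilon> * norm h" using e1(3) by (rule mult_right_mono) simp
      finally show "norm (u (t, x) - u (t, x1) - Y t (x - x1)) \<le> \<epsilon> * norm (x - x1)"
        by (simp add: e_def h_def)
    qed
  qed
  show ?thesis
  proof (intro exI[of _ Y] allI impI conjI)
    fix t :: real assume t: "\<bar>t\<bar> < T"
    then have tI: "t \<in> ?I" and tint: "t \<in> interior ?I" by auto
    show "((\<lambda>s. Y s h) has_vector_derivative fd F ((t, x1), u (t, x1)) ((0, h), Y t h)) (at t)" for h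
      using Yh[OF tI, of h] F'(3)[OF zS[OF tI]] at_within_interior[OF tint] by (simp add: z_def)
    let ?D = "\<lambda>(\<tau>, h). \<tau> *\<^sub>R F ((t, x1), u (t, x1)) + Y t h"
    show "(u has_derivative ?D) (at (t, x1))"
      unfolding has_derivative_at_alt
    proof (intro conjI allI impI)
      have "bounded_linear (\<lambda>p. fst p *\<^sub>R F ((t, x1), u (t, x1)) + Y t (snd p))"
        by (intro bounded_linear_add bounded_linear_scaleR_const bounded_linear_fst
            blinfun.bounded_linear_right[THEN bounded_linear_compose] bounded_linear_snd)
      then show "bounded_linear ?D" by (simp add: case_prod_unfold)
      fix \<epsilon> :: real assume "\<epsilon> > 0"
      then have \<epsilon>: "\<epsilon>/3 > 0" by simp
      obtain r1 where r1: "r1 > 0" "\<And>x s. norm (x - x1) < r1 \<Longrightarrow> s \<in> ?I \<Longrightarrow>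
          norm (u (s, x) - u (s, x1) - Y s (x - x1)) \<le> \<epsilon>/3 * norm (x - x1)"
        using key[OF \<epsilon>] by blast
      obtain r2 where r2: "r2 > 0" "\<And>s. s \<in> ?I \<Longrightarrow> dist s t \<le> r2 \<Longrightarrow> dist (Y s) (Y t) < \<epsilon>/3"
        using continuous_onE[OF contY tI \<epsilon>] by auto
      have "((\<lambda>s. u (s, x1)) has_derivative (\<lambda>\<tau>. \<tau> *\<^sub>R F ((t, x1), u (t, x1)))) (at t)"
        using du[of t x1] x1 t T by (simp add: has_vector_derivative_def)
      then obtain r3 where r3: "r3 > 0" "\<And>s. norm (s - t) < r3 \<Longrightarrow>
          norm (u (s, x1) - u (t, x1) - (s - t) *\<^sub>R F ((t, x1), u (t, x1))) \<le> \<epsilon>/3 * norm (s - t)"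
        using \<epsilon> unfolding has_derivative_at_alt by meson
      define r where "r = min (min r1 r2) (min r3 (T - \<bar>t\<bar>))"
      show "\<exists>r>0. \<forall>y. norm (y - (t, x1)) < r \<longrightarrow>
          norm (u y - u (t, x1) - ?D (y - (t, x1))) \<le> \<epsilon> * norm (y - (t, x1))"
      proof (intro exI[of _ r] conjI allI impI)
        show "r > 0" using r1(1) r2(1) r3(1) t by (simp add: r_def)
        fix y assume y: "norm (y - (t, x1)) < r"
        obtain s x where y_eq: "y = (s, x)" by (cases y)
        define \<nu> where "\<nu> = norm (y - (t, x1))"
        have n: "norm (s - t) \<le> \<nu>" "norm (x - x1) \<le> \<nu>"
          using norm_fst_le[of "s - t" "x - x1"] norm_snd_le[of "x - x1" "s - t"] by (auto simp: y_eq \<nu>_def)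
        have lt: "norm (s - t) < r" "norm (x - x1) < r" using n y by (auto simp: \<nu>_def)
        have sI: "s \<in> ?I" using lt(1) by (auto simp: r_def)
        have "norm (u (s, x) - u (s, x1) - Y s (x - x1)) \<le> \<epsilon>/3 * norm (x - x1)"
          using lt sI by (intro r1) (auto simp: r_def)
        moreover have "\<dots> \<le> \<epsilon>/3 * \<nu>" using n \<epsilon> by (intro mult_left_mono) auto
        ultimately have 1: "norm (u (s, x) - u (s, x1) - Y s (x - x1)) \<le> \<epsilon>/3 * \<nu>" by linarith
        have "norm (Y s (x - x1) - Y t (x - x1)) \<le> norm (Y s - Y t) * norm (x - x1)"
          using norm_blinfun[of "Y s - Y t" "x - x1"] by (simp add: blinfun.diff_left)
        also have "\<dots> \<le> \<epsilon>/3 * \<nu>"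
          using r2(2)[OF sI] lt(1) n \<epsilon> by (intro mult_mono) (auto simp: r_def dist_norm)
        finally have 2: "norm (Y s (x - x1) - Y t (x - x1)) \<le> \<epsilon>/3 * \<nu>" .
        have "norm (u (s, x1) - u (t, x1) - (s - t) *\<^sub>R F ((t, x1), u (t, x1))) \<le> \<epsilon>/3 * norm (s - t)"
          using lt by (intro r3) (auto simp: r_def)
        moreover have "\<dots> \<le> \<epsilon>/3 * \<nu>" using n \<epsilon> by (intro mult_left_mono) auto
        ultimately have 3: "norm (u (s, x1) - u (t, x1) - (s - t) *\<^sub>R F ((t, x1), u (t, x1))) \<le> \<epsilon>/3 * \<nu>" by linarith
        \<comment> \<open>Three contributions: the parameter moves at the new time \<open>s\<close>,
          where uniformity of \<open>key\<close> in time is essential; \<open>Y\<close> is carried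
          back from \<open>s\<close> to \<open>t\<close>; the reference solution moves in
          time.\<close>
        have "u y - u (t, x1) - ?D (y - (t, x1)) = (u (s, x) - u (s, x1) - Y s (x - x1))
          + (Y s (x - x1) - Y t (x - x1)) + (u (s, x1) - u (t, x1) - (s - t) *\<^sub>R F ((t, x1), u (t, x1)))"
          by (simp add: y_eq algebra_simps)
        also have "norm \<dots> \<le> norm (u (s, x) - u (s, x1) - Y s (x - x1))
          + norm (Y s (x - x1) - Y t (x - x1)) + norm (u (s, x1) - u (t, x1) - (s - t) *\<^sub>R F ((t, x1), u (t, x1)))"
          by (intro norm_triangle_mono norm_triangle_ineq order_refl)
        also have "\<dots> \<le> \<epsilon>/3 * \<nu> + \<epsilon>/3 * \<nu> + \<epsilon>/3 * \<nu>" by (intro add_mono 1 2 3)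
        also have "\<dots> = \<epsilon> * \<nu>" by simp
        finally show "norm (u y - u (t, x1) - ?D (y - (t, x1))) \<le> \<epsilon> * norm (y - (t, x1))"
          by (simp add: \<nu>_def)
      qed
    qed
  qed
qed

lemma partial_lipschitz_bound:
  assumes "(F has_derivative F') (at (a, b))" "open D" "b \<in> D"
    and "\<And>v. v \<in> D \<Longrightarrow> norm (F (a, v) - F (a, b)) \<le> L * norm (v - b)"
  shows "norm (F' (0, w)) \<le> L * norm w"
proof -
  have "((\<lambda>w. (a, w)) has_derivative (\<lambda>w. (0, w))) (at b)"
    by (intro has_derivative_Pair has_derivative_const has_derivative_ident)
  from has_derivative_compose[OF this assms(1)]
  show ?thesis by (rule fd_lipschitz_bound[OF _ assms(2-4)])
qed

lemma C_k_on_Suc_imp_C1: "C_k_on (Suc k) S f \<Longrightarrow> C_k_on (Suc 0) S f"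
  by (induction k) (auto dest: C_k_on_SucD simp del: C_k_on.simps)

text \<open>\<open>F\<close>, \<open>D\<close> and \<open>u\<close> vary in the induction because
  the step uses the hypothesis twice: for the equation itself at the lower order, and for its
  linearisation posed on the whole space. The data \<open>d\<close>, \<open>L\<close> and
  \<open>P\<close> stay fixed.\<close>

lemma ode_C_k:
  fixes F :: "(real \<times> 'p::euclidean_space) \<times> 'e::euclidean_space \<Rightarrow> 'e"
  assumes P: "open P" and dL: "d * L \<le> 1/2" "0 \<le> L"
    and "open D"
    and "C_k_on k (({-d<..<d} \<times> P) \<times> D) F"
    and "\<And>t x v w. \<lbrakk>\<bar>t\<bar> < d; x \<in> P; v \<in> D; w \<in> D\<rbrakk> \<Longrightarrow>
        norm (F ((t, x), v) - F ((t, x), w)) \<le> L * norm (v - w)"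
    and "\<And>t x. \<lbrakk>\<bar>t\<bar> < d; x \<in> P\<rbrakk> \<Longrightarrow> u (t, x) \<in> D"
    and "\<And>t x. \<lbrakk>\<bar>t\<bar> < d; x \<in> P\<rbrakk> \<Longrightarrow>
        ((\<lambda>s. u (s, x)) has_vector_derivative F ((t, x), u (t, x))) (at t)"
    and "C_k_on k P (\<lambda>x. u (0, x))"
  shows "C_k_on k ({-d<..<d} \<times> P) u"
  using assms(4-)
proof (induction k arbitrary: F D u)
  case 0
  show ?case
    using ode_continuous[where u=u and F=F, OF P 0(1) dL _ 0(3,4,5)] 0(2,6) by simp
next
  case (Suc k)
  note D = Suc.prems(1) and F = Suc.prems(2) and lip = Suc.prems(3) and uD = Suc.prems(4)
    and du = Suc.prems(5) and u0 = Suc.prems(6)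
  let ?O = "{-d<..<d} \<times> P"
  have opO: "open ?O" using P by (simp add: open_Times)
  have opS: "open (?O \<times> D)" using opO D by (rule open_Times)
  \<comment> \<open>Needed beforehand: \<open>u\<close> enters the right-hand side of the equation
    for its own parameter derivative.\<close>
  have uk: "C_k_on k ?O u"
    by (rule Suc.IH[OF D C_k_on_SucD[OF F] lip uD du C_k_on_SucD[OF u0]])
  have F1: "C_k_on (Suc 0) (?O \<times> D) F" and u1: "C_k_on (Suc 0) P (\<lambda>x. u (0, x))"
    by (rule C_k_on_Suc_imp_C1[OF F], rule C_k_on_Suc_imp_C1[OF u0])
  have der: "(u has_derivative (\<lambda>v. fst v *\<^sub>R F ((t, x), u (t, x)) + fd u (t, x) (0, snd v))) (at (t, x))" (is ?A)
   and ode: "\<And>h. ((\<lambda>s. fd u (s, x) (0, h)) has_vector_derivative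
      fd F ((t, x), u (t, x)) ((0, h), fd u (t, x) (0, h))) (at t)"
    if t: "\<bar>t\<bar> < d" and x: "x \<in> P" for t x
  proof -
    define T where "T = (\<bar>t\<bar> + d) / 2"
    have T: "0 < T" "T < d" "\<bar>t\<bar> < T" using t by (auto simp: T_def)
    have "\<exists>Y :: real \<Rightarrow> 'p \<Rightarrow>\<^sub>L 'e. \<forall>t. \<bar>t\<bar> < T \<longrightarrow>
        (\<forall>h. ((\<lambda>s. Y s h) has_vector_derivative fd F ((t, x), u (t, x)) ((0, h), Y t h)) (at t)) \<and>
        (u has_derivative (\<lambda>(\<tau>, h). \<tau> *\<^sub>R F ((t, x), u (t, x)) + Y t h)) (at (t, x))"
      by (rule ode_variational[where u=u and F=F, OF P D dL F1 _ _ _ u1 x T(1,2)]) (fact lip uD du)+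
    then obtain Y :: "real \<Rightarrow> 'p \<Rightarrow>\<^sub>L 'e" where
      Y: "\<And>t h. \<bar>t\<bar> < T \<Longrightarrow> ((\<lambda>s. Y s h) has_vector_derivative
          fd F ((t, x), u (t, x)) ((0, h), Y t h)) (at t)" and
      du: "\<And>t. \<bar>t\<bar> < T \<Longrightarrow> (u has_derivative (\<lambda>(\<tau>, h). \<tau> *\<^sub>R F ((t, x), u (t, x)) + Y t h)) (at (t, x))"
      by blast
    have fdY: "fd u (s, x) (0, h) = Y s h" if "\<bar>s\<bar> < T" for s h
      using fd_eq[OF du[OF that]] by simp
    show ?A using du[OF T(3)] fdY[OF T(3)] by (simp add: case_prod_unfold)
    show "((\<lambda>s. fd u (s, x) (0, h)) has_vector_derivative
        fd F ((t, x), u (t, x)) ((0, h), fd u (t, x) (0, h))) (at t)" for h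
      unfolding fdY[OF T(3)]
      by (rule has_vector_derivative_transform_within_open[OF Y[OF T(3)], of "{-T<..<T}"])
         (use T fdY in auto)
  qed
  have "C_k_on k ?O (\<lambda>p. fd u p (0, h))" for h
  \<comment> \<open>For \<open>d \<le> 0\<close> the domain is empty. Otherwise time 0 belongs to
    it, and the initial value of the parameter derivative can be read off there.\<close>
  proof (cases "d > 0")
    case True
    \<comment> \<open>Affine in the last argument, with the partial derivative of \<open>F\<close>
      in the unknown as linear part. Therefore it is Lipschitz with the old constant
      \<open>L\<close> on all of \<open>UNIV\<close>.\<close>
    define F2 :: "(real \<times> 'p) \<times> 'e \<Rightarrow> 'e"
      where "F2 q = fd F (fst q, u (fst q)) ((0, h), snd q)" for q
    have opU: "open (?O \<times> (UNIV :: 'e set))" by (rule open_Times[OF opO open_UNIV])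
    show ?thesis
    proof (rule Suc.IH[where F=F2 and D=UNIV])
      show "C_k_on k (?O \<times> UNIV) F2"
        unfolding F2_def
      proof (rule C_k_on_fd_comp[OF opU opS F])
        have f: "C_k_on k (?O \<times> (UNIV :: 'e set)) fst"
          by (rule C_k_on_bounded_linear[OF bounded_linear_fst opU])
        show "C_k_on k (?O \<times> (UNIV :: 'e set)) (\<lambda>q. (fst q, u (fst q)))"
          by (rule C_k_on_Pair[OF opU f C_k_on_compose[OF opU opO f uk]]) auto
        show "C_k_on k (?O \<times> (UNIV :: 'e set)) (\<lambda>q. ((0::real, h), snd q))"
          by (intro C_k_on_Pair opU C_k_on_const C_k_on_bounded_linear[OF bounded_linear_snd opU])
        show "(\<lambda>q. (fst q, u (fst q))) ` (?O \<times> (UNIV :: 'e set)) \<subseteq> ?O \<times> D" using uD by auto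
      qed
      fix t x and v w :: 'e assume t: "\<bar>t\<bar> < d" and x: "x \<in> P"
      have "((t, x), u (t, x)) \<in> ?O \<times> D" using t x uD[OF t x] by auto
      then have dF: "F differentiable at ((t, x), u (t, x))" using F1 unfolding C_k_on.simps(2) by blast
      have "F2 ((t, x), v) - F2 ((t, x), w) = fd F ((t, x), u (t, x)) (0, v - w)"
        using linear_diff[OF linear_fd[OF dF], of "((0, h), v)" "((0, h), w)"] by (simp add: F2_def zero_prod_def)
      also have "norm \<dots> \<le> L * norm (v - w)"
        by (rule partial_lipschitz_bound[OF has_derivative_fd[OF dF] D uD[OF t x]]) (intro lip t x uD)
      finally show "norm (F2 ((t, x), v) - F2 ((t, x), w)) \<le> L * norm (v - w)" .
    next
      fix t x assume "\<bar>t\<bar> < d" "x \<in> P"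
      from ode[OF this, of h] show "((\<lambda>s. fd u (s, x) (0, h)) has_vector_derivative F2 ((t, x), fd u (t, x) (0, h))) (at t)"
        by (simp add: F2_def)
    next
      have e: "fd (\<lambda>x. u (0, x)) x h = fd u (0, x) (0, h)" if "x \<in> P" for x
      proof -
        have i: "((\<lambda>w. (0::real, w)) has_derivative (\<lambda>w. (0, w))) (at x)"
          by (intro has_derivative_Pair has_derivative_const has_derivative_ident)
        from fd_eq[OF has_derivative_compose[OF i der[of 0 x]]] True that show ?thesis by simp
      qed
      have c: "C_k_on k P (\<lambda>x. fd (\<lambda>x. u (0, x)) x h)" using u0 by simp
      show "C_k_on k P (\<lambda>x. fd u (0, x) (0, h))"
        by (rule C_k_on_cong[OF P _ c]) (rule e)
    qed auto
  next
    case False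
    then show ?thesis by (intro C_k_on_locally) auto
  qed
  \<comment> \<open>The time derivative comes from the equation itself, as a composition of
    functions already known to be of class k.\<close>
  moreover have "C_k_on k ?O (\<lambda>p. F (p, u p))"
    by (rule C_k_on_compose[OF opO opS _ C_k_on_SucD[OF F]])
       (use uD in \<open>auto intro!: C_k_on_Pair[OF opO] uk C_k_on_bounded_linear[OF bounded_linear_ident opO]\<close>)
  ultimately show ?case
    by (intro C_k_on_SucI[OF opO, where f'="\<lambda>p v. fst v *\<^sub>R F (p, u p) + fd u p (0, snd v)"] C_k_on_add[OF opO]
          C_k_on_bounded_linear_comp[OF bounded_linear_scaleR_right _ opO])
       (use der in auto)
qed

section \<open>Local flows and local uniqueness\<close>

lemma smooth_on_lipschitz_cball:
  fixes f :: "'a::euclidean_space \<Rightarrow> 'b::euclidean_space"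
  assumes "smooth_on U f" "open U" "cball x r \<subseteq> U"
  obtains L where "L \<ge> 0" "\<And>a b. \<lbrakk>a \<in> cball x r; b \<in> cball x r\<rbrakk> \<Longrightarrow> norm (f a - f b) \<le> L * norm (a - b)"
proof -
  obtain f' where f': "continuous_on U f'" "\<And>x. x \<in> U \<Longrightarrow> (f has_derivative blinfun_apply (f' x)) (at x)"
    using C1_blinfun[OF smooth_onD[OF assms(1)] assms(2)] by metis
  have "compact (f' ` cball x r)"
    by (intro compact_continuous_image continuous_on_subset[OF f'(1) assms(3)] compact_cball)
  then obtain L where L: "L > 0" "\<And>a. a \<in> cball x r \<Longrightarrow> norm (f' a) \<le> L"
    using bounded_pos compact_imp_bounded by (metis imageI)
  show ?thesis
  proof (rule that[of L])
    fix a b assume ab: "a \<in> cball x r" "b \<in> cball x r"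
    show "norm (f a - f b) \<le> L * norm (a - b)"
    proof (rule differentiable_bound[of "cball x r" f "\<lambda>a. blinfun_apply (f' a)"])
      show "(f has_derivative blinfun_apply (f' a)) (at a within cball x r)" if "a \<in> cball x r" for a
        using f'(2) that assms(3) has_derivative_at_withinI by blast
      show "onorm (blinfun_apply (f' a)) \<le> L" if "a \<in> cball x r" for a
        using L(2)[OF that] by (simp add: norm_blinfun.rep_eq)
    qed (use ab in auto)
  qed (use L in simp)
qed

text \<open>A flow box: one time bound \<open>d\<close> for all initial points of \<open>N\<close>,
  with orbits that may leave \<open>N\<close> but not \<open>U\<close>. Joint smoothness on a
  product domain makes mixed derivatives in time and space available.\<close>

locale local_flow =
  fixes f :: "'e::euclidean_space \<Rightarrow> 'e" and U N :: "'e set" and d :: real and \<phi> :: "real \<times> 'e \<Rightarrow> 'e"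
  assumes open_U: "open U" and open_N: "open N" and smooth_f: "smooth_on U f" and d_pos: "0 < d"
    and smooth_flow: "smooth_on ({-d<..<d} \<times> N) \<phi>"
    and flow_0: "\<And>x. x \<in> N \<Longrightarrow> \<phi> (0, x) = x"
    and flow_in: "\<And>t x. \<lbrakk>\<bar>t\<bar> < d; x \<in> N\<rbrakk> \<Longrightarrow> \<phi> (t, x) \<in> U"
    and flow_deriv: "\<And>t x. \<lbrakk>\<bar>t\<bar> < d; x \<in> N\<rbrakk> \<Longrightarrow>
        ((\<lambda>s. \<phi> (s, x)) has_vector_derivative f (\<phi> (t, x))) (at t)"

text \<open>Composing \<open>f\<close> with the closest-point projection onto a ball makes it globally Lipschitz, so
  the Picard solutions exist for a time that does not depend on the initial point.\<close>

lemma local_flow_exists: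
  fixes f :: "'e::euclidean_space \<Rightarrow> 'e"
  assumes f: "smooth_on U f" and U: "open U" and x0: "x0 \<in> U"
  obtains d N \<phi> where "x0 \<in> N" "local_flow f U N d \<phi>"
proof -
  obtain r where r: "r > 0" "cball x0 (2 * r) \<subseteq> U"
  proof -
    obtain e where "e > 0" "cball x0 e \<subseteq> U" using U x0 open_contains_cball by blast
    then show ?thesis by (intro that[of "e / 2"]) auto
  qed
  let ?K = "cball x0 (2 * r)"
  have K: "convex ?K" "closed ?K" "?K \<noteq> {}" using r by auto
  obtain L where L: "L \<ge> 0" "\<And>a b. \<lbrakk>a \<in> ?K; b \<in> ?K\<rbrakk> \<Longrightarrow> norm (f a - f b) \<le> L * norm (a - b)"
    using smooth_on_lipschitz_cball[OF f U r(2)] by blast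
  have contK: "continuous_on ?K f" using continuous_on_subset[OF smooth_on_imp_continuous_on[OF f] r(2)] .
  then have "compact (f ` ?K)" by (intro compact_continuous_image) auto
  then obtain M where M: "M > 0" "\<And>a. a \<in> ?K \<Longrightarrow> norm (f a) \<le> M"
    using bounded_pos compact_imp_bounded by (metis imageI)
  \<comment> \<open>The first bound gives \<open>d * L \<le> 1/2\<close>, with \<open>L + 1\<close>
    because \<open>L\<close> may vanish. The second keeps orbits that start in the ball of radius
    \<open>r\<close> inside the ball of radius \<open>2 * r\<close>, where the modified field
    \<open>g\<close> agrees with \<open>f\<close>.\<close>
  define d where "d = min (1 / (2 * (L + 1))) (r / (2 * M))"
  have d: "d > 0" using L(1) M(1) r(1) by (simp add: d_def)
  have dL: "d * L \<le> 1/2"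
  proof -
    have "d * (L + 1) \<le> (1 / (2 * (L + 1))) * (L + 1)" using L(1) by (intro mult_right_mono) (auto simp: d_def)
    also have "\<dots> = 1/2" using L(1) by (simp add: field_simps)
    finally show ?thesis using d by (simp add: algebra_simps)
  qed
  have dM: "d * M < r"
  proof -
    have "d * M \<le> (r / (2 * M)) * M" using M(1) by (intro mult_right_mono) (auto simp: d_def)
    also have "\<dots> < r" using M(1) r(1) by simp
    finally show ?thesis .
  qed
  define g where "g x = f (closest_point ?K x)" for x
  have cpK: "closest_point ?K x \<in> ?K" for x using closest_point_in_set[OF K(2,3)] .
  have g_eq: "g x = f x" if "x \<in> ?K" for x using that by (simp add: g_def closest_point_self)
  have gM: "norm (g x) \<le> M" for x using M(2)[OF cpK] by (simp add: g_def)
  have glip: "norm (g x - g y) \<le> L * norm (x - y)" for x y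
  proof -
    have "norm (g x - g y) \<le> L * norm (closest_point ?K x - closest_point ?K y)"
      unfolding g_def by (intro L cpK)
    also have "\<dots> \<le> L * norm (x - y)"
      using closest_point_lipschitz[OF K, of x y] L(1) by (intro mult_left_mono) (auto simp: dist_norm)
    finally show ?thesis .
  qed
  have contg: "continuous_on UNIV g"
    unfolding g_def by (rule continuous_on_compose2[OF contK continuous_on_closest_point[OF K]]) (use cpK in auto)
  have "\<exists>v. v 0 = x \<and> (\<forall>t\<in>{-d..d}. (v has_vector_derivative g (v t)) (at t within {-d..d}))" for x
  proof (rule picard[of d "\<lambda>t. g" L x])
    show "continuous_on ({-d..d} \<times> UNIV) (\<lambda>(t::real, u). g u)"
      unfolding case_prod_unfold
      by (rule continuous_on_compose2[OF contg continuous_on_snd[OF continuous_on_id]]) auto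
  qed (use d L dL glip in auto)
  then obtain v where v0: "\<And>x. v x 0 = x"
    and v: "\<And>x t. t \<in> {-d..d} \<Longrightarrow> (v x has_vector_derivative g (v x t)) (at t within {-d..d})"
    by metis
  define \<phi> where "\<phi> = (\<lambda>(t, x). v x t)"
  have near: "\<phi> (t, x) \<in> ball x0 (2 * r)" if t: "\<bar>t\<bar> < d" and x: "x \<in> ball x0 r" for t x
  proof -
    have "norm (v x t - v x 0) \<le> M * \<bar>t\<bar>"
      by (rule vector_mvt_bound[OF v gM]) (use t in auto)
    also have "\<dots> \<le> M * d" using t M by (intro mult_left_mono) auto
    finally have "norm (v x t - x) < r" using dM by (simp add: v0 mult.commute)
    then have "dist x (v x t) < r" by (simp add: dist_norm norm_minus_commute)
    moreover have "dist x0 (v x t) \<le> dist x0 x + dist x (v x t)" by (rule dist_triangle)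
    ultimately show ?thesis using x by (simp add: \<phi>_def)
  qed
  have deriv: "((\<lambda>s. \<phi> (s, x)) has_vector_derivative f (\<phi> (t, x))) (at t)"
    if t: "\<bar>t\<bar> < d" and x: "x \<in> ball x0 r" for t x
  proof -
    have "t \<in> interior {-d..d}" using t by auto
    then have "(v x has_vector_derivative g (v x t)) (at t)"
      using v[of t x] at_within_interior[of t "{-d..d}"] interior_subset[of "{-d..d}"] by auto
    moreover have "g (v x t) = f (v x t)" using near[OF t x] by (intro g_eq) (simp add: \<phi>_def)
    ultimately show ?thesis by (simp add: \<phi>_def)
  qed
  have opB: "open (({-d<..<d} \<times> ball x0 r) \<times> ball x0 (2 * r))" by (intro open_Times) auto
  have "C_k_on k ({-d<..<d} \<times> ball x0 r) \<phi>" for k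
  proof (rule ode_C_k[where F="\<lambda>q. f (snd q)" and u=\<phi> and D="ball x0 (2 * r)", OF open_ball dL L(1) open_ball])
    show "C_k_on k (({-d<..<d} \<times> ball x0 r) \<times> ball x0 (2 * r)) (\<lambda>q. f (snd q))"
      by (rule C_k_on_compose[OF opB U C_k_on_bounded_linear[OF bounded_linear_snd opB] smooth_onD[OF f]])
         (use r in auto)
    show "C_k_on k (ball x0 r) (\<lambda>x. \<phi> (0, x))"
      using C_k_on_bounded_linear[OF bounded_linear_ident open_ball] by (simp add: \<phi>_def v0)
  qed (use near deriv L in auto)
  then have sm: "smooth_on ({-d<..<d} \<times> ball x0 r) \<phi>" by (simp add: smooth_on_def)
  have "local_flow f U (ball x0 r) d \<phi>"
  proof
    show "\<phi> (t, x) \<in> U" if "\<bar>t\<bar> < d" "x \<in> ball x0 r" for t x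
      using near[OF that] r(2) by auto
  qed (use U f d sm v0 deriv in \<open>simp_all add: \<phi>_def\<close>)
  then show ?thesis using that[of "ball x0 r"] r by simp
qed

text \<open>An integrating factor, without restriction on the length of the interval:
  \<open>(e r \<bullet> e r) * exp (c * r)\<close> does not increase to the right of
  \<open>s\<close> for \<open>c = - 2 * a\<close> and does not decrease to the left for
  \<open>c = 2 * a\<close>. It vanishes at \<open>s\<close> and is never negative.\<close>

lemma ode_zero:
  fixes e :: "real \<Rightarrow> 'a::real_inner"
  assumes I: "is_interval I" "s \<in> I" "t \<in> I"
    and de: "\<And>r. r \<in> I \<Longrightarrow> (e has_vector_derivative e' r) (at r)"
    and le: "\<And>r. r \<in> I \<Longrightarrow> norm (e' r) \<le> a * norm (e r)" and "e s = 0"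
  shows "e t = 0"
proof -
  have sub: "r \<in> I" if "min s t \<le> r" "r \<le> max s t" for r
    by (rule mem_is_interval_1_I[OF I(1), of "min s t" "max s t"]) (use that I in \<open>auto simp: min_def max_def\<close>)
  have bnd: "\<bar>2 * (e r \<bullet> e' r)\<bar> \<le> 2 * a * (e r \<bullet> e r)" if "r \<in> I" for r
  proof -
    have "\<bar>e r \<bullet> e' r\<bar> \<le> norm (e r) * (a * norm (e r))"
      using Cauchy_Schwarz_ineq2[of "e r" "e' r"] mult_left_mono[OF le[OF that], of "norm (e r)"] by simp
    then show ?thesis by (simp add: dot_square_norm power2_eq_square algebra_simps)
  qed
  have q: "((\<lambda>r. (e r \<bullet> e r) * exp (c * r)) has_real_derivative
      (2 * (e r \<bullet> e' r) + c * (e r \<bullet> e r)) * exp (c * r)) (at r)" if "r \<in> I" for r c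
  proof -
    have "((\<lambda>r. e r \<bullet> e r) has_real_derivative 2 * (e r \<bullet> e' r)) (at r)"
      using bounded_bilinear.has_vector_derivative[OF bounded_bilinear_inner de[OF that] de[OF that]]
      by (simp add: has_real_derivative_iff_has_vector_derivative inner_commute)
    then show ?thesis by (auto intro!: derivative_eq_intros simp: algebra_simps)
  qed
  have "(e t \<bullet> e t) * exp (c * t) \<le> 0" if c: "c = (if s \<le> t then - 2 * a else 2 * a)" for c
  proof (cases "s \<le> t")
    case True
    have "(e t \<bullet> e t) * exp (c * t) \<le> (e s \<bullet> e s) * exp (c * s)"
    proof (rule DERIV_nonpos_imp_nonincreasing[OF True, of "\<lambda>r. (e r \<bullet> e r) * exp (c * r)"])
      fix r assume "s \<le> r" "r \<le> t"
      then have r: "r \<in> I" using sub True by auto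
      show "\<exists>y. ((\<lambda>r. (e r \<bullet> e r) * exp (c * r)) has_real_derivative y) (at r) \<and> y \<le> 0"
        using bnd[OF r] True c
        by (intro exI[of _ "(2 * (e r \<bullet> e' r) + c * (e r \<bullet> e r)) * exp (c * r)"] conjI q[OF r] mult_nonpos_nonneg)
           (auto simp: abs_le_iff)
    qed
    then show ?thesis using assms(6) by simp
  next
    case False
    have "(e t \<bullet> e t) * exp (c * t) \<le> (e s \<bullet> e s) * exp (c * s)"
    proof (rule DERIV_nonneg_imp_nondecreasing[of t s "\<lambda>r. (e r \<bullet> e r) * exp (c * r)"])
      fix r assume "t \<le> r" "r \<le> s"
      then have r: "r \<in> I" using sub False by auto
      show "\<exists>y. ((\<lambda>r. (e r \<bullet> e r) * exp (c * r)) has_real_derivative y) (at r) \<and> 0 \<le> y"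
        using bnd[OF r] False c
        by (intro exI[of _ "(2 * (e r \<bullet> e' r) + c * (e r \<bullet> e r)) * exp (c * r)"] conjI q[OF r] mult_nonneg_nonneg)
           (auto simp: abs_le_iff)
    qed (use False in simp)
    then show ?thesis using assms(6) by simp
  qed
  then have "e t \<bullet> e t \<le> 0" by (metis exp_gt_zero mult_le_0_iff not_less)
  then show ?thesis by (metis inner_gt_zero_iff not_less)
qed

lemma ode_unique_local:
  fixes f :: "'e::euclidean_space \<Rightarrow> 'e"
  assumes f: "smooth_on U f" and U: "open U" and J: "open J" "t0 \<in> J"
    and \<alpha>: "\<And>t. t \<in> J \<Longrightarrow> \<alpha> t \<in> U" "\<And>t. t \<in> J \<Longrightarrow> (\<alpha> has_vector_derivative f (\<alpha> t)) (at t)"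
    and \<beta>: "\<And>t. t \<in> J \<Longrightarrow> \<beta> t \<in> U" "\<And>t. t \<in> J \<Longrightarrow> (\<beta> has_vector_derivative f (\<beta> t)) (at t)"
    and eq: "\<alpha> t0 = \<beta> t0"
  obtains e where "e > 0" "\<And>t. \<bar>t - t0\<bar> < e \<Longrightarrow> \<alpha> t = \<beta> t"
proof -
  obtain r where r: "r > 0" "cball (\<alpha> t0) r \<subseteq> U" using U \<alpha>(1)[OF J(2)] open_contains_cball by blast
  obtain L where L: "L \<ge> 0" "\<And>a b. \<lbrakk>a \<in> cball (\<alpha> t0) r; b \<in> cball (\<alpha> t0) r\<rbrakk> \<Longrightarrow> norm (f a - f b) \<le> L * norm (a - b)"
    using smooth_on_lipschitz_cball[OF f U r(2)] by blast
  have "isCont \<alpha> t0" "isCont \<beta> t0"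
    using has_vector_derivative_continuous[OF \<alpha>(2)[OF J(2)]] has_vector_derivative_continuous[OF \<beta>(2)[OF J(2)]] .
  then obtain e1 e2 where e1: "e1 > 0" "\<And>t. dist t t0 < e1 \<Longrightarrow> dist (\<alpha> t) (\<alpha> t0) < r"
    and e2: "e2 > 0" "\<And>t. dist t t0 < e2 \<Longrightarrow> dist (\<beta> t) (\<beta> t0) < r"
    using r(1) unfolding continuous_at_eps_delta by metis
  obtain e3 where e3: "e3 > 0" "ball t0 e3 \<subseteq> J" using J open_contains_ball by blast
  define e where "e = min e1 (min e2 e3)"
  show ?thesis
  proof (rule that[of e])
    show e: "e > 0" using e1 e2 e3 by (simp add: e_def)
    fix t assume t: "\<bar>t - t0\<bar> < e"
    have "(\<lambda>t. \<alpha> t - \<beta> t) t = 0"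
    proof (rule ode_zero[where I="ball t0 e" and s=t0 and a=L and e="\<lambda>t. \<alpha> t - \<beta> t"])
      fix s assume s: "s \<in> ball t0 e"
      then have sJ: "s \<in> J" using e3 by (auto simp: e_def)
      show "((\<lambda>t. \<alpha> t - \<beta> t) has_vector_derivative f (\<alpha> s) - f (\<beta> s)) (at s)"
        by (intro has_vector_derivative_diff \<alpha> \<beta> sJ)
      show "norm (f (\<alpha> s) - f (\<beta> s)) \<le> L * norm (\<alpha> s - \<beta> s)"
        using s e1(2)[of s] e2(2)[of s] eq by (intro L) (auto simp: e_def dist_commute less_imp_le)
    qed (use e t eq in \<open>auto simp: dist_real_def is_interval_ball_real\<close>)
    then show "\<alpha> t = \<beta> t" by simp
  qed
qed

section \<open>Flows and commuting vector fields\<close>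

lemma time_derivative:
  assumes "g differentiable at (t, x)"
  shows "((\<lambda>s. g (s, x)) has_vector_derivative fd g (t, x) (1, 0)) (at t)"
proof -
  have "((\<lambda>s. (s, x)) has_derivative (\<lambda>h. (h, 0))) (at t)"
    by (intro has_derivative_Pair has_derivative_const has_derivative_ident)
  from has_derivative_compose[OF this has_derivative_fd[OF assms]]
  have 1: "((\<lambda>s. g (s, x)) has_derivative (\<lambda>h. fd g (t, x) (h, 0))) (at t)" .
  have "(\<lambda>h. fd g (t, x) (h, 0)) = (\<lambda>h. h *\<^sub>R fd g (t, x) (1, 0))"
  proof
    fix h
    have "fd g (t, x) (h *\<^sub>R (1, 0)) = h *\<^sub>R fd g (t, x) (1, 0)"
      by (rule linear_scale[OF linear_fd[OF assms]])
    then show "fd g (t, x) (h, 0) = h *\<^sub>R fd g (t, x) (1, 0)"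
      by (simp only: scaleR_Pair scaleR_zero_right real_scaleR_def mult_1_right)
  qed
  with 1 show ?thesis by (simp only: has_vector_derivative_def)
qed

lemma space_derivative:
  assumes "g differentiable at (t, x)"
  shows "((\<lambda>y. g (t, y)) has_derivative (\<lambda>v. fd g (t, x) (0, v))) (at x)"
proof -
  have "((\<lambda>y. (t, y)) has_derivative (\<lambda>h. (0, h))) (at x)"
    by (intro has_derivative_Pair has_derivative_const has_derivative_ident)
  from has_derivative_compose[OF this has_derivative_fd[OF assms]] show ?thesis .
qed

lemma has_vector_derivative_compose_fd:
  assumes "(c has_vector_derivative c') (at t)" "g differentiable at (c t)"
  shows "((\<lambda>s. g (c s)) has_vector_derivative fd g (c t) c') (at t)"
  using vector_derivative_diff_chain_within[OF assms(1), of g "fd g (c t)"]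
    has_derivative_at_withinI[OF has_derivative_fd[OF assms(2)]] by (simp add: o_def)

context local_flow begin

lemma open_dom: "open ({-d<..<d} \<times> N)"
  by (intro open_Times open_N) auto

lemma N_subset_U: "x \<in> N \<Longrightarrow> x \<in> U"
  using flow_in[of 0 x] flow_0[of x] d_pos by simp

lemma in_dom: "\<bar>t\<bar> < d \<Longrightarrow> x \<in> N \<Longrightarrow> (t, x) \<in> {-d<..<d} \<times> N"
  by auto

lemma flow_differentiable: "\<bar>t\<bar> < d \<Longrightarrow> x \<in> N \<Longrightarrow> \<phi> differentiable at (t, x)"
  using smooth_on_differentiable[OF smooth_flow in_dom] .

lemma fd_time:
  assumes "\<bar>t\<bar> < d" "x \<in> N"
  shows "fd \<phi> (t, x) (1, 0) = f (\<phi> (t, x))"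
  using vector_derivative_unique_at[OF time_derivative[OF flow_differentiable[OF assms]] flow_deriv[OF assms]] .

lemma fd_space_0:
  assumes "x \<in> N"
  shows "fd \<phi> (0, x) (0, v) = v"
proof -
  have "((\<lambda>y. \<phi> (0, y)) has_derivative (\<lambda>v. fd \<phi> (0, x) (0, v))) (at x)"
    by (rule space_derivative[OF flow_differentiable]) (use d_pos assms in auto)
  then have "((\<lambda>y. y) has_derivative (\<lambda>v. fd \<phi> (0, x) (0, v))) (at x)"
    by (rule has_derivative_transform_within_open[OF _ open_N assms]) (rule flow_0)
  then have "(\<lambda>v. fd \<phi> (0, x) (0, v)) = (\<lambda>v. v)"
    using has_derivative_unique has_derivative_ident by blast
  then show ?thesis by meson
qed

text \<open>Symmetry of mixed derivatives: the time derivative of the space derivative of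
  \<open>\<phi>\<close> is the space derivative of \<open>f \<circ> \<phi>\<close>.\<close>

lemma variational:
  assumes "\<bar>t\<bar> < d" "x \<in> N"
  shows "((\<lambda>s. fd \<phi> (s, x) (0, v)) has_vector_derivative fd f (\<phi> (t, x)) (fd \<phi> (t, x) (0, v))) (at t)"
proof -
  have "((\<lambda>s. fd \<phi> (s, x) (0, v)) has_vector_derivative fd (\<lambda>p. fd \<phi> p (0, v)) (t, x) (1, 0)) (at t)"
    by (rule time_derivative[OF smooth_on_differentiable[OF smooth_on_fd[OF smooth_flow] in_dom[OF assms]]])
  also have "fd (\<lambda>p. fd \<phi> p (0, v)) (t, x) (1, 0) = fd (\<lambda>p. fd \<phi> p (1, 0)) (t, x) (0, v)"
    by (rule fd_commute[OF smooth_flow open_dom in_dom[OF assms]])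
  also have "fd (\<lambda>p. fd \<phi> p (1, 0)) (t, x) = fd (\<lambda>p. f (\<phi> p)) (t, x)"
    by (rule fd_cong[OF open_dom in_dom[OF assms]]) (auto intro!: fd_time)
  also have "fd (\<lambda>p. f (\<phi> p)) (t, x) = (\<lambda>h. fd f (\<phi> (t, x)) (fd \<phi> (t, x) h))"
    by (rule fd_eq[OF has_derivative_compose[OF has_derivative_fd[OF flow_differentiable[OF assms]]
          smooth_on_has_derivative[OF smooth_f flow_in[OF assms]]]])
  finally show ?thesis .
qed

text \<open>Uniqueness for the variational equation along a fixed orbit. On a compact time interval
  the operator norm of the derivative of \<open>f\<close> along the orbit is bounded, so
  \<open>ode_zero\<close> applies.\<close>

lemma transport_zero:
  assumes x: "x \<in> N" and s: "\<bar>s\<bar> < d" and t: "\<bar>t\<bar> < d" and "e s = 0"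
    and de: "\<And>t. \<bar>t\<bar> < d \<Longrightarrow> (e has_vector_derivative fd f (\<phi> (t, x)) (e t)) (at t)"
  shows "e t = 0"
proof -
  \<comment> \<open>Both \<open>s\<close> and \<open>t\<close> lie in \<open>[-T, T]\<close>, which
    is compact and contained in the open time domain.\<close>
  define T where "T = (max \<bar>s\<bar> \<bar>t\<bar> + d) / 2"
  have T: "\<bar>s\<bar> < T" "\<bar>t\<bar> < T" "T < d" using s t by (auto simp: T_def)
  obtain f' where f': "continuous_on U f'" "\<And>x. x \<in> U \<Longrightarrow> blinfun_apply (f' x) = fd f x"
    using C1_blinfun[OF smooth_onD[OF smooth_f] open_U] by metis
  have Td: "\<bar>r\<bar> < d" if "r \<in> {-T..T}" for r using that T by auto
  have "continuous_on {-T..T} (\<lambda>r. \<phi> (r, x))"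
    by (rule continuous_on_vector_derivative[OF has_vector_derivative_at_within[OF flow_deriv[OF Td x]]])
  then have "continuous_on {-T..T} (\<lambda>r. f' (\<phi> (r, x)))"
    by (rule continuous_on_compose2[OF f'(1)]) (use flow_in[OF Td x] in blast)
  then have "compact ((\<lambda>r. f' (\<phi> (r, x))) ` {-T..T})" by (intro compact_continuous_image) auto
  from compact_imp_bounded[OF this] obtain a where "\<forall>r\<in>{-T..T}. norm (f' (\<phi> (r, x))) \<le> a"
    unfolding bounded_iff by (simp add: ball_simps) blast
  then have a: "norm (f' (\<phi> (r, x))) \<le> a" if "r \<in> {-T..T}" for r using that by blast
  show ?thesis
  proof (rule ode_zero[of "{-T..T}" s t e "\<lambda>t. fd f (\<phi> (t, x)) (e t)" a])
    fix r assume r: "r \<in> {-T..T}"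
    show "(e has_vector_derivative fd f (\<phi> (r, x)) (e r)) (at r)" by (rule de[OF Td[OF r]])
    have "norm (f' (\<phi> (r, x)) (e r)) \<le> a * norm (e r)"
      using norm_blinfun[of "f' (\<phi> (r, x))" "e r"] mult_right_mono[OF a[OF r], of "norm (e r)"] by simp
    then show "norm (fd f (\<phi> (r, x)) (e r)) \<le> a * norm (e r)"
      using f'(2)[OF flow_in[OF Td[OF r] x]] by simp
  qed (use T \<open>e s = 0\<close> in \<open>auto simp: is_interval_cc\<close>)
qed

text \<open>If \<open>[f, Y] = 0\<close>, then \<open>D\<phi>\<^sub>t Y - Y \<circ> \<phi>\<^sub>t\<close> solves the variational equation with initial value \<open>0\<close>.\<close>

lemma commuting_transport:
  assumes Y: "smooth_on U Y" and comm: "\<And>w. w \<in> U \<Longrightarrow> fd Y w (f w) = fd f w (Y w)"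
    and x: "x \<in> N" and t: "\<bar>t\<bar> < d"
  shows "fd \<phi> (t, x) (0, Y x) = Y (\<phi> (t, x))"
proof -
  have "fd \<phi> (t, x) (0, Y x) - Y (\<phi> (t, x)) = 0"
  proof (rule transport_zero[OF x _ t, of 0 "\<lambda>t. fd \<phi> (t, x) (0, Y x) - Y (\<phi> (t, x))"])
    show "fd \<phi> (0, x) (0, Y x) - Y (\<phi> (0, x)) = 0"
      using fd_space_0[OF x] flow_0[OF x] by simp
    fix t assume t: "\<bar>t\<bar> < d"
    have "((\<lambda>t. fd \<phi> (t, x) (0, Y x) - Y (\<phi> (t, x))) has_vector_derivative
        fd f (\<phi> (t, x)) (fd \<phi> (t, x) (0, Y x)) - fd Y (\<phi> (t, x)) (f (\<phi> (t, x)))) (at t)"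
      by (intro has_vector_derivative_diff variational[OF t x]
          has_vector_derivative_compose_fd[OF flow_deriv[OF t x]] smooth_on_differentiable[OF Y] flow_in[OF t x])
    then show "((\<lambda>t. fd \<phi> (t, x) (0, Y x) - Y (\<phi> (t, x))) has_vector_derivative
        fd f (\<phi> (t, x)) (fd \<phi> (t, x) (0, Y x) - Y (\<phi> (t, x)))) (at t)"
      using comm[OF flow_in[OF t x]] linear_diff[OF linear_fd[OF smooth_on_differentiable[OF smooth_f flow_in[OF t x]]]]
      by simp
  qed (use d_pos in simp)
  then show ?thesis by simp
qed

text \<open>Both sides of the invariance are differentiated at time 0, the left by the variational
  equation and the right by the chain rule. Invariance along the orbit of the one point
  \<open>x\<close> yields the identity at \<open>x\<close>.\<close>

lemma transport_commutes:
  assumes Y: "smooth_on U Y" and x: "x \<in> N" and e: "e > 0"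
    and inv: "\<And>t. \<bar>t\<bar> < e \<Longrightarrow> fd \<phi> (t, x) (0, Y x) = Y (\<phi> (t, x))"
  shows "fd Y x (f x) = fd f x (Y x)"
proof -
  have 0: "\<bar>0\<bar> < d" using d_pos by simp
  have "((\<lambda>t. fd \<phi> (t, x) (0, Y x)) has_vector_derivative fd f x (Y x)) (at 0)"
    using variational[OF 0 x, of "Y x"] flow_0[OF x] fd_space_0[OF x] by simp
  then have "((\<lambda>t. Y (\<phi> (t, x))) has_vector_derivative fd f x (Y x)) (at 0)"
    by (rule has_vector_derivative_transform_within_open[of _ _ _ "{-e<..<e}"]) (use e inv in auto)
  moreover have "((\<lambda>t. Y (\<phi> (t, x))) has_vector_derivative fd Y x (f x)) (at 0)"
    using has_vector_derivative_compose_fd[OF flow_deriv[OF 0 x], of Y]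
      smooth_on_differentiable[OF Y N_subset_U[OF x]] flow_0[OF x] by simp
  ultimately show ?thesis using vector_derivative_unique_at by blast
qed

end

section \<open>Lifting local flows to the tangent bundle\<close>

definition lift :: "('e::euclidean_space \<Rightarrow> 'e) \<Rightarrow> 'e \<times> 'e \<Rightarrow> 'e \<times> 'e" where
  "lift f z = (f (fst z), fd f (fst z) (snd z))"

definition flow_lift :: "(real \<times> 'e::euclidean_space \<Rightarrow> 'e) \<Rightarrow> real \<times> 'e \<times> 'e \<Rightarrow> 'e \<times> 'e" where
  "flow_lift \<phi> p = (\<phi> (fst p, fst (snd p)), fd \<phi> (fst p, fst (snd p)) (0, snd (snd p)))"

lemma smooth_on_lift:
  assumes "smooth_on U f" "open U" "open B"
  shows "smooth_on (U \<times> B) (lift f)"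
proof -
  have op: "open (U \<times> B)" using assms by (simp add: open_Times)
  have "smooth_on (U \<times> B) fst" "smooth_on (U \<times> B) snd"
    using op by (auto intro!: smooth_on_bounded_linear bounded_linear_fst bounded_linear_snd)
  then show ?thesis
    unfolding lift_def[abs_def]
    by (intro smooth_on_Pair op smooth_on_compose[OF op assms(2,1)] smooth_on_fd_comp[OF op assms(2,1)]) auto
qed

text \<open>The fibre component of the lifted field is the variational equation. \<open>B\<close> is
  a set of fibre vectors preserved by the derivative of the flow: all vectors for the complete lift
  itself, the nonzero ones for comparison with the spray.\<close>

lemma local_flow_lift_gen:
  assumes "local_flow f U N d \<phi>" "open B"
    and B: "\<And>t x y. \<lbrakk>\<bar>t\<bar> < d; x \<in> N; y \<in> B\<rbrakk> \<Longrightarrow> fd \<phi> (t, x) (0, y) \<in> B"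
  shows "local_flow (lift f) (U \<times> B) (N \<times> B) d (flow_lift \<phi>)"
proof -
  interpret local_flow f U N d \<phi> by fact
  let ?O = "{-d<..<d} \<times> (N \<times> B)"
  have op: "open ?O" using open_N assms(2) by (intro open_Times) auto
  show ?thesis
  proof
    show "open (U \<times> B)" "open (N \<times> B)" using open_U open_N assms(2) by (auto intro: open_Times)
    show "smooth_on (U \<times> B) (lift f)" by (rule smooth_on_lift[OF smooth_f open_U assms(2)])
    show "0 < d" by (rule d_pos)
    have b: "bounded_linear (\<lambda>p::real \<times> 'a \<times> 'a. (fst p, fst (snd p)))"
      "bounded_linear (\<lambda>p::real \<times> 'a \<times> 'a. (0::real, snd (snd p)))"
      by (intro bounded_linear_Pair bounded_linear_fst bounded_linear_snd bounded_linear_zero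
          bounded_linear_compose[OF bounded_linear_fst] bounded_linear_compose[OF bounded_linear_snd])+
    have s: "smooth_on ?O (\<lambda>p. (fst p, fst (snd p)))" "smooth_on ?O (\<lambda>p. (0::real, snd (snd p)))"
      by (rule smooth_on_bounded_linear[OF b(1) op], rule smooth_on_bounded_linear[OF b(2) op])
    have i: "(\<lambda>p. (fst p, fst (snd p))) ` ?O \<subseteq> {-d<..<d} \<times> N" by auto
    show "smooth_on ?O (flow_lift \<phi>)"
      unfolding flow_lift_def[abs_def]
      by (intro smooth_on_Pair[OF op] smooth_on_compose[OF op open_dom smooth_flow s(1) i]
          smooth_on_fd_comp[OF op open_dom smooth_flow s i])
  next
    fix z assume "z \<in> N \<times> B"
    then show "flow_lift \<phi> (0, z) = z" by (auto simp: flow_lift_def flow_0 fd_space_0)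
  next
    fix t z assume t: "\<bar>t\<bar> < d" and z: "z \<in> N \<times> B"
    obtain x y where xy: "z = (x, y)" "x \<in> N" "y \<in> B" using z by auto
    show "flow_lift \<phi> (t, z) \<in> U \<times> B" using xy t by (simp add: flow_lift_def flow_in B)
    show "((\<lambda>s. flow_lift \<phi> (s, z)) has_vector_derivative lift f (flow_lift \<phi> (t, z))) (at t)"
      using has_vector_derivative_Pair[OF flow_deriv[OF t xy(2)] variational[OF t xy(2), of y]]
      by (simp add: flow_lift_def lift_def xy(1))
  qed
qed

lemma local_flow_lift:
  "local_flow f U N d \<phi> \<Longrightarrow> local_flow (lift f) (U \<times> UNIV) (N \<times> UNIV) d (flow_lift \<phi>)"
  by (rule local_flow_lift_gen) auto

text \<open>The derivative of the flow map is injective: a vector transported to zero would be a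
  solution of the variational equation vanishing at time \<open>t\<close>, hence zero at time 0 as
  well.\<close>

lemma local_flow_lift_slit:
  assumes "local_flow f U N d \<phi>"
  shows "local_flow (lift f) (U \<times> (- {0})) (N \<times> (- {0})) d (flow_lift \<phi>)"
proof (rule local_flow_lift_gen[OF assms])
  interpret local_flow f U N d \<phi> by fact
  fix t x and y :: 'a assume t: "\<bar>t\<bar> < d" and x: "x \<in> N" and y: "y \<in> - {0}"
  have "fd \<phi> (t, x) (0, y) \<noteq> 0"
  proof
    assume "fd \<phi> (t, x) (0, y) = 0"
    then have "fd \<phi> (0, x) (0, y) = 0"
      using transport_zero[OF x t, of 0 "\<lambda>t. fd \<phi> (t, x) (0, y)"] variational[OF _ x] d_pos by simp
    then show False using y fd_space_0[OF x] by simp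
  qed
  then show "fd \<phi> (t, x) (0, y) \<in> - {0}" by simp
qed auto

section \<open>Charts and smooth maps\<close>

lemma chart_inv_left: "smooth_atlas A \<Longrightarrow> c \<in> A \<Longrightarrow> p \<in> fst c \<Longrightarrow> chart_inv c (snd c p) = p"
  unfolding smooth_atlas_def by (simp add: inv_into_f_f)

lemma chart_inv_right: "x \<in> snd c ` fst c \<Longrightarrow> snd c (chart_inv c x) = x"
  by (rule f_inv_into_f)

lemma chart_inv_in: "x \<in> snd c ` fst c \<Longrightarrow> chart_inv c x \<in> fst c"
  by (rule inv_into_into)

lemma topspace_atlas:
  assumes A: "smooth_atlas A" shows "topspace (atlas_topology A) = carrier A"
proof -
  have "openin (atlas_topology A) (carrier A)"
    unfolding openin_atlas_topology[OF A]
  proof (intro conjI ballI order_refl)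
    fix c assume c: "c \<in> A"
    then have "fst c \<inter> carrier A = fst c \<inter> fst c" by (auto simp: carrier_def)
    then show "open (snd c ` (fst c \<inter> carrier A))"
      using A c unfolding smooth_atlas_def by metis
  qed
  then show ?thesis
    using openin_subset openin_topspace[of "atlas_topology A"] openin_atlas_topology[OF A] by blast
qed

lemma chart_subset_carrier: "c \<in> A \<Longrightarrow> fst c \<subseteq> carrier A"
  by (auto simp: carrier_def)

lemma carrierE:
  assumes "p \<in> carrier A" obtains c where "c \<in> A" "p \<in> fst c"
  using assms by (auto simp: carrier_def)

lemma openin_chart: "smooth_atlas A \<Longrightarrow> c \<in> A \<Longrightarrow> openin (atlas_topology A) (fst c)"
  unfolding openin_atlas_topology using chart_subset_carrier[of c A]
  by (simp add: smooth_atlas_def Int_commute)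

lemma open_chart_image:
  "smooth_atlas A \<Longrightarrow> c \<in> A \<Longrightarrow> openin (atlas_topology A) W \<Longrightarrow> open (snd c ` (fst c \<inter> W))"
  by (simp add: openin_atlas_topology)

lemma open_chart_range: "smooth_atlas A \<Longrightarrow> c \<in> A \<Longrightarrow> open (snd c ` fst c)"
  using open_chart_image[OF _ _ openin_chart, of A c c] by simp

lemma transition_eq: "smooth_atlas A \<Longrightarrow> c \<in> A \<Longrightarrow> p \<in> fst c \<Longrightarrow> transition c d (snd c p) = snd d p"
  by (simp add: transition_def chart_inv_left)

lemma smooth_transition:
  "smooth_atlas A \<Longrightarrow> c \<in> A \<Longrightarrow> d \<in> A \<Longrightarrow> smooth_on (snd c ` (fst c \<inter> fst d)) (transition c d)"
  by (simp add: smooth_atlas_def)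

lemma openin_chart_preimage:
  assumes A: "smooth_atlas A" and c: "c \<in> A" and S: "open S"
  shows "openin (atlas_topology A) {p \<in> fst c. snd c p \<in> S}"
  unfolding openin_atlas_topology[OF A]
proof (intro conjI ballI)
  show "{p \<in> fst c. snd c p \<in> S} \<subseteq> carrier A" using chart_subset_carrier[OF c] by auto
  fix d assume d: "d \<in> A"
  have op: "open (snd d ` (fst d \<inter> fst c))" by (rule open_chart_image[OF A d openin_chart[OF A c]])
  have eq: "snd d ` (fst d \<inter> {p \<in> fst c. snd c p \<in> S}) = snd d ` (fst d \<inter> fst c) \<inter> transition d c -` S" (is "?l = ?r")
  proof
    show "?l \<subseteq> ?r" using transition_eq[OF A d, of _ c] by auto
    show "?r \<subseteq> ?l"
    proof
      fix x assume "x \<in> ?r"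
      then obtain q where q: "q \<in> fst d" "q \<in> fst c" "x = snd d q" "transition d c x \<in> S" by blast
      then have "snd c q \<in> S" using transition_eq[OF A d q(1), of c] by simp
      with q(1,2) show "x \<in> ?l" unfolding q(3) by simp
    qed
  qed
  show "open ?l" unfolding eq
    by (rule continuous_open_preimage[OF smooth_on_imp_continuous_on[OF smooth_transition[OF A d c]] op S])
qed

lemma openin_map_preimage:
  assumes "smooth_map A W B f" "openin (atlas_topology B) V"
  shows "openin (atlas_topology A) {p \<in> W. f p \<in> V}"
proof -
  have W: "openin (atlas_topology A) W" and f: "continuous_map (subtopology (atlas_topology A) W) (atlas_topology B) f"
    using assms(1) by (auto simp: smooth_map_def)
  have topW: "topspace (subtopology (atlas_topology A) W) = W"
    using openin_subset[OF W] by (simp add: topspace_subtopology Int_absorb1)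
  have "openin (subtopology (atlas_topology A) W) {p \<in> W. f p \<in> V}"
    using openin_continuous_map_preimage[OF f assms(2)] by (simp only: topW)
  then show ?thesis by (rule openin_trans_full[OF _ W])
qed

lemma smooth_map_openin: "smooth_map A W B f \<Longrightarrow> openin (atlas_topology A) W"
  by (simp add: smooth_map_def)

lemma smooth_map_carrier:
  assumes "smooth_atlas A" "smooth_atlas B" "smooth_map A W B f" "p \<in> W"
  shows "f p \<in> carrier B"
proof -
  have "f \<in> topspace (subtopology (atlas_topology A) W) \<rightarrow> topspace (atlas_topology B)"
    using assms(3) by (simp add: smooth_map_def continuous_map_def)
  moreover have "p \<in> topspace (subtopology (atlas_topology A) W)"
    using assms(4) openin_subset[OF smooth_map_openin[OF assms(3)]] by auto
  ultimately show ?thesis using topspace_atlas[OF assms(2)] by auto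
qed

lemma smooth_map_smooth_on:
  "smooth_map A W B f \<Longrightarrow> c \<in> A \<Longrightarrow> d \<in> B \<Longrightarrow>
    smooth_on (snd c ` {p \<in> fst c \<inter> W. f p \<in> fst d}) (\<lambda>x. snd d (f (chart_inv c x)))"
  by (simp add: smooth_map_def comp_def)

text \<open>A local certificate for \<open>smooth_map\<close> in a single pair of charts; the
  definition of \<open>smooth_map\<close> itself quantifies over all pairs and asks for continuity
  separately.\<close>

definition smooth_rep ::
  "('m, 'e::euclidean_space) atlas \<Rightarrow> ('p, 'f::euclidean_space) atlas \<Rightarrow> ('m \<Rightarrow> 'p)
     \<Rightarrow> ('m, 'e) chart \<Rightarrow> ('p, 'f) chart \<Rightarrow> 'm set \<Rightarrow> bool" where
  "smooth_rep A B f c d N \<longleftrightarrow> c \<in> A \<and> d \<in> B \<and> openin (atlas_topology A) N \<and> N \<subseteq> fst c \<and>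
     f ` N \<subseteq> fst d \<and> smooth_on (snd c ` N) (\<lambda>x. snd d (f (chart_inv c x)))"

lemma smooth_repD:
  assumes "smooth_rep A B f c d N"
  shows "c \<in> A" "d \<in> B" "openin (atlas_topology A) N" "N \<subseteq> fst c" "f ` N \<subseteq> fst d"
    "smooth_on (snd c ` N) (\<lambda>x. snd d (f (chart_inv c x)))"
  using assms by (simp_all add: smooth_rep_def)

lemma smooth_repI:
  assumes "c \<in> A" "d \<in> B" "openin (atlas_topology A) N" "N \<subseteq> fst c" "f ` N \<subseteq> fst d"
    "smooth_on (snd c ` N) (\<lambda>x. snd d (f (chart_inv c x)))"
  shows "smooth_rep A B f c d N"
  unfolding smooth_rep_def by (intro conjI assms)

text \<open>Continuity comes first: it makes the set of points that are mapped into another chart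
  domain open. On such a set the representation in new charts is the given one composed with
  transition maps on both sides.\<close>

lemma smooth_map_localI:
  assumes A: "smooth_atlas A" and B: "smooth_atlas B" and W: "openin (atlas_topology A) W"
    and loc: "\<And>p. p \<in> W \<Longrightarrow> \<exists>c d N. smooth_rep A B f c d N \<and> p \<in> N \<and> N \<subseteq> W"
  shows "smooth_map A W B f"
proof -
  have op: "openin (atlas_topology A) {p \<in> W. f p \<in> V}" if V: "openin (atlas_topology B) V" for V
  proof (rule iffD2[OF openin_subopen], rule ballI)
    fix p assume p: "p \<in> {p \<in> W. f p \<in> V}"
    then have "p \<in> W" by simp
    from loc[OF this] obtain c d N where rep: "smooth_rep A B f c d N" and pN: "p \<in> N" "N \<subseteq> W" by blast
    note c = smooth_repD(1)[OF rep] and d = smooth_repD(2)[OF rep] and sm = smooth_repD(6)[OF rep]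
    note N = smooth_repD(3)[OF rep] pN smooth_repD(4,5)[OF rep]
    have opN: "open (snd c ` N)" using open_chart_image[OF A c N(1)] N(4) by (simp add: Int_absorb1)
    let ?S = "snd c ` N \<inter> (\<lambda>x. snd d (f (chart_inv c x))) -` (snd d ` (fst d \<inter> V))"
    have "open ?S"
      by (rule continuous_open_preimage[OF smooth_on_imp_continuous_on[OF sm] opN open_chart_image[OF B d V]])
    then have "openin (atlas_topology A) {q \<in> fst c. snd c q \<in> ?S}" by (rule openin_chart_preimage[OF A c])
    moreover have "p \<in> {q \<in> fst c. snd c q \<in> ?S}"
    proof -
      have "p \<in> fst c" "f p \<in> fst d \<inter> V" using p N by auto
      then show ?thesis using N(2) chart_inv_left[OF A c, of p] by auto
    qed
    moreover have "{q \<in> fst c. snd c q \<in> ?S} \<subseteq> {p \<in> W. f p \<in> V}"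
    proof
      fix q assume "q \<in> {q \<in> fst c. snd c q \<in> ?S}"
      then have q: "q \<in> fst c" "snd c q \<in> snd c ` N" "snd d (f (chart_inv c (snd c q))) \<in> snd d ` (fst d \<inter> V)" by auto
      from q(2) obtain q' where q': "q' \<in> N" "snd c q = snd c q'" by auto
      have "q = q'" using chart_inv_left[OF A c q(1)] chart_inv_left[OF A c, of q'] q' N(4) by auto
      then have qN: "q \<in> N" using q' by simp
      from q(3) obtain r where r: "r \<in> fst d" "r \<in> V" "snd d (f q) = snd d r"
        using chart_inv_left[OF A c q(1)] by auto
      have "f q = r" using chart_inv_left[OF B d r(1)] chart_inv_left[OF B d, of "f q"] r(3) qN N(5) by auto
      then show "q \<in> {p \<in> W. f p \<in> V}" using r qN N(3) by auto
    qed
    ultimately show "\<exists>T. openin (atlas_topology A) T \<and> p \<in> T \<and> T \<subseteq> {p \<in> W. f p \<in> V}" by blast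
  qed
  have topW: "topspace (subtopology (atlas_topology A) W) = W"
    using openin_subset[OF W] by (simp add: topspace_subtopology Int_absorb1)
  have cont: "continuous_map (subtopology (atlas_topology A) W) (atlas_topology B) f"
    unfolding continuous_map_def topW topspace_atlas[OF B]
  proof (intro conjI allI impI)
    show "f \<in> W \<rightarrow> carrier B"
    proof
      fix p assume "p \<in> W"
      from loc[OF this] obtain c d N where "smooth_rep A B f c d N" "p \<in> N" by blast
      with smooth_repD(2,5)[OF this(1)] show "f p \<in> carrier B" using chart_subset_carrier[of d B] by auto
    qed
    fix V assume "openin (atlas_topology B) V"
    from op[OF this] show "openin (subtopology (atlas_topology A) W) {x \<in> W. f x \<in> V}"
      using openin_open_subtopology[OF W] by auto
  qed
  have "smooth_on (snd c' ` {p \<in> fst c' \<inter> W. f p \<in> fst d'}) (\<lambda>x. snd d' (f (chart_inv c' x)))"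
    if c': "c' \<in> A" and d': "d' \<in> B" for c' d'
  proof (rule smooth_on_locally)
    fix x assume "x \<in> snd c' ` {p \<in> fst c' \<inter> W. f p \<in> fst d'}"
    then obtain p where p: "p \<in> fst c'" "p \<in> W" "f p \<in> fst d'" "x = snd c' p" by auto
    from loc[OF p(2)] obtain c d N where rep: "smooth_rep A B f c d N" and pN: "p \<in> N" "N \<subseteq> W" by blast
    note c = smooth_repD(1)[OF rep] and d = smooth_repD(2)[OF rep] and sm = smooth_repD(6)[OF rep]
    note N = smooth_repD(3)[OF rep] pN smooth_repD(4,5)[OF rep]
    define M where "M = N \<inter> {q \<in> W. f q \<in> fst d'}"
    have M: "openin (atlas_topology A) M" unfolding M_def by (intro openin_Int N op openin_chart B d')
    define S where "S = snd c' ` (fst c' \<inter> M)"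
    have opS: "open S" unfolding S_def by (rule open_chart_image[OF A c' M])
    have opN: "open (snd c ` N)" using open_chart_image[OF A c N(1)] N(4) by (simp add: Int_absorb1)
    have opd: "open (snd d ` (fst d \<inter> fst d'))" by (rule open_chart_image[OF B d openin_chart[OF B d']])
    have t: "smooth_on S (transition c' c)"
      by (rule smooth_on_subset[OF smooth_transition[OF A c' c]]) (use N in \<open>auto simp: S_def M_def\<close>)
    have t_eq: "chart_inv c (transition c' c x) = chart_inv c' x" if "x \<in> S" for x
    proof -
      from that obtain q where q: "q \<in> fst c'" "q \<in> M" "x = snd c' q" by (auto simp: S_def)
      then have "q \<in> fst c" using N by (auto simp: M_def)
      then show ?thesis using q transition_eq[OF A c' q(1)] chart_inv_left[OF A] c c' by simp
    qed
    have tS: "transition c' c ` S \<subseteq> snd c ` N"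
      using transition_eq[OF A c', of _ c] by (auto simp: S_def M_def)
    have s1: "smooth_on S (\<lambda>x. snd d (f (chart_inv c (transition c' c x))))"
      by (rule smooth_on_compose[OF opS opN sm t tS])
    have fS: "f (chart_inv c' x) \<in> fst d \<inter> fst d'" if "x \<in> S" for x
      using that chart_inv_left[OF A c'] N by (auto simp: S_def M_def)
    have s2: "smooth_on S (\<lambda>x. transition d d' (snd d (f (chart_inv c (transition c' c x)))))"
      by (rule smooth_on_compose[OF opS opd smooth_transition[OF B d d'] s1]) (use fS t_eq in auto)
    have eq: "transition d d' (snd d (f (chart_inv c (transition c' c x)))) = snd d' (f (chart_inv c' x))"
      if "x \<in> S" for x
      using t_eq[OF that] fS[OF that] transition_eq[OF B d, of "f (chart_inv c' x)" d'] by simp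
    have "smooth_on S (\<lambda>x. snd d' (f (chart_inv c' x)))"
      by (rule smooth_on_cong[OF s2 opS]) (rule eq)
    moreover have "x \<in> S" using p N by (auto simp: S_def M_def)
    ultimately show "\<exists>T. open T \<and> x \<in> T \<and> smooth_on T (\<lambda>x. snd d' (f (chart_inv c' x)))" using opS by blast
  qed
  then show ?thesis using W cont by (simp add: smooth_map_def comp_def)
qed

lemma smooth_map_localE:
  assumes A: "smooth_atlas A" and B: "smooth_atlas B" and f: "smooth_map A W B f"
    and c: "c \<in> A" and d: "d \<in> B"
  defines "N \<equiv> {p \<in> fst c \<inter> W. f p \<in> fst d}"
  shows "openin (atlas_topology A) N" "smooth_on (snd c ` N) (\<lambda>x. snd d (f (chart_inv c x)))"
proof -
  have "N = fst c \<inter> {p \<in> W. f p \<in> fst d}" by (auto simp: N_def)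
  then show "openin (atlas_topology A) N"
    using openin_map_preimage[OF f openin_chart[OF B d]] openin_chart[OF A c] by auto
  show "smooth_on (snd c ` N) (\<lambda>x. snd d (f (chart_inv c x)))"
    unfolding N_def by (rule smooth_map_smooth_on[OF f c d])
qed

text \<open>Smoothness is local, and values off the domain are irrelevant. Restriction and change of
  representative are special cases, and flow maps on their maximal domains are assembled from small
  pieces in this way.\<close>

lemma smooth_map_glue:
  assumes A: "smooth_atlas A" and B: "smooth_atlas B" and W: "openin (atlas_topology A) W"
    and loc: "\<And>p. p \<in> W \<Longrightarrow> \<exists>W' g. p \<in> W' \<and> smooth_map A W' B g \<and> (\<forall>q\<in>W'. g q = f q)"
  shows "smooth_map A W B f"
proof (rule smooth_map_localI[OF A B W])
  fix p assume p: "p \<in> W"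
  from loc[OF p] obtain W' g where W': "p \<in> W'" "smooth_map A W' B g" and eq: "\<forall>q\<in>W'. g q = f q"
    by (elim exE conjE) (rule that)
  have "p \<in> carrier A" using p openin_subset[OF W] topspace_atlas[OF A] by auto
  then obtain c where c: "c \<in> A" "p \<in> fst c" by (rule carrierE)
  obtain d where d: "d \<in> B" "g p \<in> fst d" using smooth_map_carrier[OF A B W'(2,1)] by (rule carrierE)
  note l = smooth_map_localE[OF A B W'(2) c(1) d(1)]
  define N where "N = {p \<in> fst c \<inter> W'. g p \<in> fst d} \<inter> W"
  have N: "openin (atlas_topology A) N" unfolding N_def by (rule openin_Int[OF l(1) W])
  have Nc: "N \<subseteq> fst c" by (auto simp: N_def)
  have opN: "open (snd c ` N)" using open_chart_image[OF A c(1) N] Nc by (simp add: Int_absorb1)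
  have "smooth_on (snd c ` N) (\<lambda>x. snd d (g (chart_inv c x)))"
    by (rule smooth_on_subset[OF l(2)]) (auto simp: N_def)
  then have "smooth_on (snd c ` N) (\<lambda>x. snd d (f (chart_inv c x)))"
    by (rule smooth_on_cong[OF _ opN]) (use chart_inv_left[OF A c(1)] eq in \<open>auto simp: N_def\<close>)
  then have "smooth_rep A B f c d N"
    by (intro smooth_repI c d N Nc) (use eq in \<open>auto simp: N_def\<close>)
  moreover have "p \<in> N" "N \<subseteq> W" using c d p W'(1) by (auto simp: N_def)
  ultimately show "\<exists>c d N. smooth_rep A B f c d N \<and> p \<in> N \<and> N \<subseteq> W" by blast
qed

lemma smooth_map_subset:
  assumes "smooth_atlas A" "smooth_atlas B" "smooth_map A W B f" "openin (atlas_topology A) W'" "W' \<subseteq> W"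
  shows "smooth_map A W' B f"
  by (rule smooth_map_glue[OF assms(1,2,4)])
     (intro exI[of _ W] exI[of _ f] conjI ballI refl assms(3), use assms(5) in blast)

lemma smooth_map_cong:
  assumes "smooth_atlas A" "smooth_atlas B" "smooth_map A W B f" "\<And>p. p \<in> W \<Longrightarrow> f p = g p"
  shows "smooth_map A W B g"
  by (rule smooth_map_glue[OF assms(1,2) smooth_map_openin[OF assms(3)]])
     (intro exI[of _ W] exI[of _ f] conjI ballI assms(3,4))

lemma smooth_map_compose:
  assumes A: "smooth_atlas A" and B: "smooth_atlas B" and C: "smooth_atlas C"
    and f: "smooth_map A W B f" and g: "smooth_map B W' C g" and sub: "f ` W \<subseteq> W'"
  shows "smooth_map A W C (g \<circ> f)"
proof (rule smooth_map_localI[OF A C smooth_map_openin[OF f]])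
  fix p assume p: "p \<in> W"
  have "p \<in> carrier A" using p openin_subset[OF smooth_map_openin[OF f]] topspace_atlas[OF A] by auto
  then obtain c where c: "c \<in> A" "p \<in> fst c" by (rule carrierE)
  obtain d where d: "d \<in> B" "f p \<in> fst d" using smooth_map_carrier[OF A B f p] by (rule carrierE)
  have "f p \<in> W'" using sub p by auto
  then obtain e where e: "e \<in> C" "g (f p) \<in> fst e" using smooth_map_carrier[OF B C g] carrierE by metis
  note lf = smooth_map_localE[OF A B f c(1) d(1)] and lg = smooth_map_localE[OF B C g d(1) e(1)]
  let ?M = "{q \<in> fst d \<inter> W'. g q \<in> fst e}"
  define N where "N = fst c \<inter> {q \<in> W. f q \<in> ?M}"
  have N: "openin (atlas_topology A) N" unfolding N_def
    by (rule openin_Int[OF openin_chart[OF A c(1)] openin_map_preimage[OF f lg(1)]])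
  have Nc: "N \<subseteq> fst c" by (auto simp: N_def)
  have opN: "open (snd c ` N)" using open_chart_image[OF A c(1) N] Nc by (simp add: Int_absorb1)
  have "fst d \<inter> ?M = ?M" by auto
  then have opM: "open (snd d ` ?M)" using open_chart_image[OF B d(1) lg(1)] by simp
  have s: "smooth_on (snd c ` N) (\<lambda>x. snd d (f (chart_inv c x)))"
    by (rule smooth_on_subset[OF lf(2)]) (auto simp: N_def)
  have M: "f (chart_inv c x) \<in> ?M" if "x \<in> snd c ` N" for x
    using that chart_inv_left[OF A c(1)] by (auto simp: N_def)
  have "smooth_on (snd c ` N) (\<lambda>x. snd e (g (chart_inv d (snd d (f (chart_inv c x))))))"
    by (rule smooth_on_compose[OF opN opM lg(2) s]) (use M in blast)
  then have "smooth_on (snd c ` N) (\<lambda>x. snd e ((g \<circ> f) (chart_inv c x)))"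
    by (rule smooth_on_cong[OF _ opN]) (use M chart_inv_left[OF B d(1)] in auto)
  then have "smooth_rep A C (g \<circ> f) c e N"
    by (intro smooth_repI c e N Nc) (auto simp: N_def)
  moreover have "p \<in> N" "N \<subseteq> W" using c d e p sub by (auto simp: N_def)
  ultimately show "\<exists>c d N. smooth_rep A C (g \<circ> f) c d N \<and> p \<in> N \<and> N \<subseteq> W" by blast
qed

section \<open>Curves\<close>

lemma smooth_atlas_line: "smooth_atlas line_atlas"
proof -
  have "transition (UNIV, \<lambda>t::real. t) (UNIV, \<lambda>t. t) = (\<lambda>t. t)"
    by (rule ext) (simp add: transition_def inv_into_f_f)
  then show ?thesis
    using smooth_on_id[of "UNIV::real set"] by (auto simp: smooth_atlas_def line_atlas_def)
qed

lemma chart_inv_line: "chart_inv (UNIV, \<lambda>t::real. t) x = x"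
  by (simp add: inv_into_f_f)

lemma openin_line: "openin (atlas_topology line_atlas) S \<longleftrightarrow> open S"
  unfolding openin_atlas_topology[OF smooth_atlas_line] by (simp add: line_atlas_def carrier_def)

lemma smooth_curve_localI:
  assumes A: "smooth_atlas A" and I: "open I" "is_interval I" "I \<noteq> {}"
    and loc: "\<And>t. t \<in> I \<Longrightarrow> \<exists>c\<in>A. \<exists>J. open J \<and> t \<in> J \<and> \<gamma> ` J \<subseteq> fst c \<and> smooth_on J (\<lambda>s. snd c (\<gamma> s))"
  shows "smooth_curve A I \<gamma>"
  unfolding smooth_curve_def
proof (intro conjI I smooth_map_localI[OF smooth_atlas_line A])
  show "openin (atlas_topology line_atlas) I" by (simp add: openin_line I)
  fix t assume t: "t \<in> I"
  then obtain c J where c: "c \<in> A" and J: "open J" "t \<in> J" "\<gamma> ` J \<subseteq> fst c" "smooth_on J (\<lambda>s. snd c (\<gamma> s))"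
    using loc by blast
  have "smooth_rep line_atlas A \<gamma> (UNIV, \<lambda>t. t) c (I \<inter> J)"
  proof (rule smooth_repI)
    show "smooth_on (snd (UNIV, \<lambda>t. t) ` (I \<inter> J)) (\<lambda>x. snd c (\<gamma> (chart_inv (UNIV, \<lambda>t. t) x)))"
      using smooth_on_subset[OF J(4)] by (simp add: inv_into_f_f)
    show "openin (atlas_topology line_atlas) (I \<inter> J)" using I(1) J(1) by (simp add: openin_line open_Int)
  qed (use c J(3) in \<open>auto simp: line_atlas_def\<close>)
  then show "\<exists>c d N. smooth_rep line_atlas A \<gamma> c d N \<and> t \<in> N \<and> N \<subseteq> I" using t J(2) by blast
qed

lemma smooth_curve_chart:
  assumes A: "smooth_atlas A" and \<gamma>: "smooth_curve A I \<gamma>" and c: "c \<in> A"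
  shows "open {t \<in> I. \<gamma> t \<in> fst c}" "smooth_on {t \<in> I. \<gamma> t \<in> fst c} (\<lambda>s. snd c (\<gamma> s))"
proof -
  have m: "smooth_map line_atlas I A \<gamma>" using \<gamma> by (simp add: smooth_curve_def)
  have l: "(UNIV, \<lambda>t. t) \<in> line_atlas" by (simp add: line_atlas_def)
  show "open {t \<in> I. \<gamma> t \<in> fst c}" "smooth_on {t \<in> I. \<gamma> t \<in> fst c} (\<lambda>s. snd c (\<gamma> s))"
    using smooth_map_localE[OF smooth_atlas_line A m l c] by (simp_all add: openin_line chart_inv_line)
qed

lemma smooth_curve_carrier: "smooth_atlas A \<Longrightarrow> smooth_curve A I \<gamma> \<Longrightarrow> t \<in> I \<Longrightarrow> \<gamma> t \<in> carrier A"
  unfolding smooth_curve_def using smooth_map_carrier[OF smooth_atlas_line, of A I \<gamma> t] by simp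

lemma open_curve_preimage:
  "smooth_curve A I \<gamma> \<Longrightarrow> openin (atlas_topology A) W \<Longrightarrow> open {t \<in> I. \<gamma> t \<in> W}"
  unfolding smooth_curve_def openin_line[symmetric] by (elim conjE) (rule openin_map_preimage)

section \<open>Tangent vectors and velocities\<close>

lemma fd_transition_compose:
  assumes A: "smooth_atlas A" and c: "c \<in> A" "p \<in> fst c" and d: "d \<in> A" "p \<in> fst d" and e: "e \<in> A" "p \<in> fst e"
  shows "fd (transition d e) (snd d p) (fd (transition c d) (snd c p) y) = fd (transition c e) (snd c p) y"
proof -
  let ?W = "fst c \<inter> (fst d \<inter> fst e)"
  have S: "open (snd c ` ?W)"
    by (intro open_chart_image[OF A c(1)] openin_Int openin_chart[OF A] d e)
  have p: "snd c p \<in> snd c ` ?W" using c d e by auto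
  have "fd (transition c e) (snd c p) = fd (\<lambda>x. transition d e (transition c d x)) (snd c p)"
    by (rule fd_cong[OF S p]) (use transition_eq[OF A c(1), of _ d] transition_eq[OF A c(1), of _ e]
        transition_eq[OF A d(1), of _ e] in auto)
  moreover have "(transition c d has_derivative fd (transition c d) (snd c p)) (at (snd c p))"
    by (rule smooth_on_has_derivative[OF smooth_transition[OF A c(1) d(1)]]) (use c d in auto)
  moreover have "(transition d e has_derivative fd (transition d e) (snd d p)) (at (transition c d (snd c p)))"
    unfolding transition_eq[OF A c]
    by (rule smooth_on_has_derivative[OF smooth_transition[OF A d(1) e(1)]]) (use d e in auto)
  ultimately show ?thesis using fd_eq[OF has_derivative_compose] by metis
qed

lemma fd_transition_self:
  assumes A: "smooth_atlas A" and c: "c \<in> A" "p \<in> fst c"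
  shows "fd (transition c c) (snd c p) y = y"
proof -
  have p: "snd c p \<in> snd c ` fst c" using c by auto
  have "fd (transition c c) (snd c p) = fd (\<lambda>x. x) (snd c p)"
    by (rule fd_cong[OF open_chart_range[OF A c(1)] p]) (use transition_eq[OF A c(1), of _ c] in auto)
  then show ?thesis using fd_eq[OF has_derivative_ident] by metis
qed

lemma tangent_fd:
  "v \<in> tangent_space A p \<Longrightarrow> c \<in> A \<Longrightarrow> d \<in> A \<Longrightarrow> p \<in> fst c \<Longrightarrow> p \<in> fst d \<Longrightarrow>
    v d = fd (transition c d) (snd c p) (v c)"
  unfolding tangent_space_def by blast

lemma tangent_zero: "v \<in> tangent_space A p \<Longrightarrow> \<not> (c \<in> A \<and> p \<in> fst c) \<Longrightarrow> v c = 0"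
  unfolding tangent_space_def by blast

lemma tangent_eqI:
  assumes v: "v \<in> tangent_space A p" and w: "w \<in> tangent_space A p" and c: "c \<in> A" "p \<in> fst c" and eq: "v c = w c"
  shows "v = w"
proof
  fix d
  show "v d = w d"
  proof (cases "d \<in> A \<and> p \<in> fst d")
    case True
    then show ?thesis using tangent_fd[OF v c(1) _ c(2)] tangent_fd[OF w c(1) _ c(2)] eq by simp
  next
    case False
    then show ?thesis using tangent_zero[OF v False] tangent_zero[OF w False] by simp
  qed
qed

text \<open>The inverse of the component map \<open>v \<mapsto> v c\<close> on the tangent space at
  \<open>p\<close>, that is, the fibre part of the inverse of the natural chart.\<close>

definition tvec :: "('m, 'e::euclidean_space) atlas \<Rightarrow> ('m, 'e) chart \<Rightarrow> 'm \<Rightarrow> 'e \<Rightarrow> ('m, 'e) tvec" where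
  "tvec A c p y = (\<lambda>d. if d \<in> A \<and> p \<in> fst d then fd (transition c d) (snd c p) y else 0)"

lemma tvec_in: "smooth_atlas A \<Longrightarrow> c \<in> A \<Longrightarrow> p \<in> fst c \<Longrightarrow> tvec A c p y \<in> tangent_space A p"
  unfolding tangent_space_def tvec_def using fd_transition_compose[of A c p] by simp

lemma tvec_self: "smooth_atlas A \<Longrightarrow> c \<in> A \<Longrightarrow> p \<in> fst c \<Longrightarrow> tvec A c p y c = y"
  by (simp add: tvec_def fd_transition_self)

lemma local_rep_at: "smooth_atlas A \<Longrightarrow> c \<in> A \<Longrightarrow> p \<in> fst c \<Longrightarrow> local_rep c X (snd c p) = X p c"
  by (simp add: local_rep_def chart_inv_left)

section \<open>Velocities and integral curves in charts\<close>

lemma velocity_chart: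
  assumes A: "smooth_atlas A" and \<gamma>: "smooth_curve A I \<gamma>" and t: "t \<in> I" and c: "c \<in> A" "\<gamma> t \<in> fst c"
  shows "((\<lambda>s. snd c (\<gamma> s)) has_vector_derivative velocity A \<gamma> t c) (at t)"
proof -
  have "(\<lambda>s. snd c (\<gamma> s)) differentiable (at t)"
    by (rule smooth_on_differentiable[OF smooth_curve_chart(2)[OF A \<gamma> c(1)]]) (use t c in simp)
  then show ?thesis
    using c by (simp add: vector_derivative_works velocity_def comp_def)
qed

lemma smooth_on_velocity:
  assumes A: "smooth_atlas A" and \<gamma>: "smooth_curve A I \<gamma>" and c: "c \<in> A"
  shows "smooth_on {t \<in> I. \<gamma> t \<in> fst c} (\<lambda>s. velocity A \<gamma> s c)"
proof (rule smooth_on_cong[OF smooth_on_fd[OF smooth_curve_chart(2)[OF A \<gamma> c]] smooth_curve_chart(1)[OF A \<gamma> c]])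
  fix t assume "t \<in> {t \<in> I. \<gamma> t \<in> fst c}"
  then have "((\<lambda>s. snd c (\<gamma> s)) has_vector_derivative velocity A \<gamma> t c) (at t)"
    by (intro velocity_chart[OF A \<gamma> _ c]) auto
  then show "fd (\<lambda>s. snd c (\<gamma> s)) t 1 = velocity A \<gamma> t c"
    using fd_eq[of "\<lambda>s. snd c (\<gamma> s)"] by (simp add: has_vector_derivative_def)
qed

lemma velocity_in:
  assumes A: "smooth_atlas A" and \<gamma>: "smooth_curve A I \<gamma>" and t: "t \<in> I"
  shows "velocity A \<gamma> t \<in> tangent_space A (\<gamma> t)"
proof -
  have "velocity A \<gamma> t d = fd (transition c d) (snd c (\<gamma> t)) (velocity A \<gamma> t c)"
    if c: "c \<in> A" "\<gamma> t \<in> fst c" and d: "d \<in> A" "\<gamma> t \<in> fst d" for c d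
  proof -
    have "transition c d differentiable (at (snd c (\<gamma> t)))"
      by (rule smooth_on_differentiable[OF smooth_transition[OF A c(1) d(1)]]) (use c d in auto)
    from has_vector_derivative_compose_fd[OF velocity_chart[OF A \<gamma> t c] this]
    have 1: "((\<lambda>s. transition c d (snd c (\<gamma> s))) has_vector_derivative
        fd (transition c d) (snd c (\<gamma> t)) (velocity A \<gamma> t c)) (at t)" .
    have "((\<lambda>s. snd d (\<gamma> s)) has_vector_derivative
        fd (transition c d) (snd c (\<gamma> t)) (velocity A \<gamma> t c)) (at t)"
      by (rule has_vector_derivative_transform_within_open[OF 1 smooth_curve_chart(1)[OF A \<gamma> c(1)]])
         (use t c transition_eq[OF A c(1), of _ d] in auto)
    with velocity_chart[OF A \<gamma> t d] show ?thesis by (rule vector_derivative_unique_at)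
  qed
  moreover have "velocity A \<gamma> t c = 0" if "\<not> (c \<in> A \<and> \<gamma> t \<in> fst c)" for c
    unfolding velocity_def using that by (rule if_not_P)
  ultimately show ?thesis unfolding tangent_space_def by blast
qed

text \<open>A criterion at one time in one chart, convenient for curves that are glued from pieces.
  Membership in the tangent space is included because it allows equality of tangent vectors to be
  concluded from a single component.\<close>

definition integral_at ::
  "('m, 'e::euclidean_space) atlas \<Rightarrow> ('m \<Rightarrow> ('m, 'e) tvec) \<Rightarrow> (real \<Rightarrow> 'm) \<Rightarrow> real \<Rightarrow> bool" where
  "integral_at A X \<gamma> t \<longleftrightarrow> X (\<gamma> t) \<in> tangent_space A (\<gamma> t) \<and> (\<exists>c J. c \<in> A \<and> open J \<and> t \<in> J \<and>
     (\<forall>s\<in>J. \<gamma> s \<in> fst c) \<and> smooth_on J (\<lambda>s. snd c (\<gamma> s)) \<and>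
     ((\<lambda>s. snd c (\<gamma> s)) has_vector_derivative X (\<gamma> t) c) (at t))"

lemma integral_atE:
  assumes "integral_at A X \<gamma> t"
  obtains c J where "X (\<gamma> t) \<in> tangent_space A (\<gamma> t)" "c \<in> A" "open J" "t \<in> J" "\<forall>s\<in>J. \<gamma> s \<in> fst c"
    "smooth_on J (\<lambda>s. snd c (\<gamma> s))" "((\<lambda>s. snd c (\<gamma> s)) has_vector_derivative X (\<gamma> t) c) (at t)"
  using assms unfolding integral_at_def by (elim conjE exE) (rule that)

lemma integral_curve_localI:
  assumes A: "smooth_atlas A" and I: "open I" "is_interval I" "I \<noteq> {}" and loc: "\<And>t. t \<in> I \<Longrightarrow> integral_at A X \<gamma> t"
  shows "integral_curve A X I \<gamma>"
proof -
  have \<gamma>: "smooth_curve A I \<gamma>"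
  proof (rule smooth_curve_localI[OF A I])
    fix t assume "t \<in> I"
    from loc[OF this] obtain c J where "c \<in> A" "open J" "t \<in> J" "\<forall>s\<in>J. \<gamma> s \<in> fst c"
      "smooth_on J (\<lambda>s. snd c (\<gamma> s))" by (rule integral_atE)
    then show "\<exists>c\<in>A. \<exists>J. open J \<and> t \<in> J \<and> \<gamma> ` J \<subseteq> fst c \<and> smooth_on J (\<lambda>s. snd c (\<gamma> s))"
      by (intro bexI[of _ c] exI[of _ J]) auto
  qed
  have "velocity A \<gamma> t = X (\<gamma> t)" if t: "t \<in> I" for t
  proof -
    obtain c J where X: "X (\<gamma> t) \<in> tangent_space A (\<gamma> t)" and c: "c \<in> A" "t \<in> J" "\<forall>s\<in>J. \<gamma> s \<in> fst c"
      and d: "((\<lambda>s. snd c (\<gamma> s)) has_vector_derivative X (\<gamma> t) c) (at t)"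
      using loc[OF t] by (rule integral_atE)
    have c2: "\<gamma> t \<in> fst c" using c by blast
    from velocity_chart[OF A \<gamma> t c(1) c2] d have "velocity A \<gamma> t c = X (\<gamma> t) c"
      by (rule vector_derivative_unique_at)
    with velocity_in[OF A \<gamma> t] X c(1) c2 show ?thesis by (rule tangent_eqI)
  qed
  then show ?thesis using \<gamma> by (simp add: integral_curve_def)
qed

lemma integral_curve_integral_at:
  assumes A: "smooth_atlas A" and \<gamma>: "integral_curve A X I \<gamma>" and t: "t \<in> I"
  shows "integral_at A X \<gamma> t"
proof -
  have s: "smooth_curve A I \<gamma>" and v: "velocity A \<gamma> t = X (\<gamma> t)" using \<gamma> t by (auto simp: integral_curve_def)
  obtain c where c: "c \<in> A" "\<gamma> t \<in> fst c" using smooth_curve_carrier[OF A s t] by (rule carrierE)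
  show ?thesis
    unfolding integral_at_def
  proof (intro conjI exI[of _ c] exI[of _ "{s \<in> I. \<gamma> s \<in> fst c}"])
    show "X (\<gamma> t) \<in> tangent_space A (\<gamma> t)" using velocity_in[OF A s t] v by simp
    show "((\<lambda>s. snd c (\<gamma> s)) has_vector_derivative X (\<gamma> t) c) (at t)"
      using velocity_chart[OF A s t c] v by simp
    show "open {s \<in> I. \<gamma> s \<in> fst c}" "smooth_on {s \<in> I. \<gamma> s \<in> fst c} (\<lambda>s. snd c (\<gamma> s))"
      by (rule smooth_curve_chart[OF A s c(1)])+
  qed (use c t in auto)
qed

lemma integral_curve_chart:
  assumes A: "smooth_atlas A" and \<gamma>: "integral_curve A X I \<gamma>" and t: "t \<in> I" and c: "c \<in> A" "\<gamma> t \<in> fst c"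
  shows "((\<lambda>s. snd c (\<gamma> s)) has_vector_derivative X (\<gamma> t) c) (at t)"
proof -
  have s: "smooth_curve A I \<gamma>" and v: "velocity A \<gamma> t = X (\<gamma> t)" using \<gamma> t by (auto simp: integral_curve_def)
  show ?thesis using velocity_chart[OF A s t c] v by simp
qed

lemma integral_at_cong:
  assumes "integral_at A X \<gamma> t" "open S" "t \<in> S" "\<And>s. s \<in> S \<Longrightarrow> \<gamma> s = \<gamma>' s"
  shows "integral_at A X \<gamma>' t"
proof -
  obtain c J where X: "X (\<gamma> t) \<in> tangent_space A (\<gamma> t)" and c: "c \<in> A"
    and J: "open J" "t \<in> J" "\<forall>s\<in>J. \<gamma> s \<in> fst c"
    and sm: "smooth_on J (\<lambda>s. snd c (\<gamma> s))"
    and d: "((\<lambda>s. snd c (\<gamma> s)) has_vector_derivative X (\<gamma> t) c) (at t)"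
    using assms(1) by (rule integral_atE)
  have op: "open (J \<inter> S)" using J(1) assms(2) by (rule open_Int)
  show ?thesis
    unfolding integral_at_def
  proof (intro conjI exI[of _ c] exI[of _ "J \<inter> S"])
    show "smooth_on (J \<inter> S) (\<lambda>s. snd c (\<gamma>' s))"
      by (rule smooth_on_cong[OF smooth_on_subset[OF sm] op]) (use assms(4) in auto)
    show "((\<lambda>s. snd c (\<gamma>' s)) has_vector_derivative X (\<gamma>' t) c) (at t)"
      using has_vector_derivative_transform_within_open[OF d assms(2,3), of "\<lambda>s. snd c (\<gamma>' s)"] assms(3,4) by simp
    show "X (\<gamma>' t) \<in> tangent_space A (\<gamma>' t)" using X assms(3,4) by simp
    show "\<forall>s\<in>J \<inter> S. \<gamma>' s \<in> fst c" using J(3) assms(4) by (metis IntE)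
  qed (use c J op assms in auto)
qed

lemma integral_at_shift:
  assumes "integral_at A X \<gamma> (t + r)"
  shows "integral_at A X (\<lambda>s. \<gamma> (s + r)) t"
proof -
  obtain c J where X: "X (\<gamma> (t + r)) \<in> tangent_space A (\<gamma> (t + r))" and c: "c \<in> A"
    and J: "open J" "t + r \<in> J" "\<forall>s\<in>J. \<gamma> s \<in> fst c"
    and sm: "smooth_on J (\<lambda>s. snd c (\<gamma> s))"
    and d: "((\<lambda>s. snd c (\<gamma> s)) has_vector_derivative X (\<gamma> (t + r)) c) (at (t + r))"
    using assms by (rule integral_atE)
  define K where "K = {s. s + r \<in> J}"
  have K_eq: "K = (\<lambda>s. s + r) -` J" by (auto simp: K_def)
  have op: "open K" unfolding K_eq by (intro open_vimage J(1) continuous_intros)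
  have sh: "smooth_on K (\<lambda>s. s + r)"
    by (intro smooth_on_add op smooth_on_const smooth_on_id)
  show ?thesis
    unfolding integral_at_def
  proof (intro conjI exI[of _ c] exI[of _ K])
    show "smooth_on K (\<lambda>s. snd c (\<gamma> (s + r)))"
      by (rule smooth_on_compose[OF op J(1) sm sh]) (auto simp: K_def)
    have "((\<lambda>s. s + r) has_vector_derivative 1) (at t)" by (auto intro!: derivative_eq_intros)
    from vector_diff_chain_at[OF this, of "\<lambda>s. snd c (\<gamma> s)"] d
    show "((\<lambda>s. snd c (\<gamma> (s + r))) has_vector_derivative X (\<gamma> (t + r)) c) (at t)"
      by (simp add: comp_def)
  qed (use c J op X in \<open>auto simp: K_def\<close>)
qed

section \<open>The tangent bundle\<close>

lemma in_natural_chart: "(p, v) \<in> fst (natural_chart A c) \<longleftrightarrow> p \<in> fst c \<and> v \<in> tangent_space A p"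
  by (simp add: natural_chart_def)

lemma snd_natural_chart: "snd (natural_chart A c) (p, v) = (snd c p, v c)"
  by (simp add: natural_chart_def)

lemma inj_natural_chart:
  assumes A: "smooth_atlas A" and c: "c \<in> A"
  shows "inj_on (snd (natural_chart A c)) (fst (natural_chart A c))"
proof (rule inj_onI, clarify)
  fix p v q w assume "(p, v) \<in> fst (natural_chart A c)" "(q, w) \<in> fst (natural_chart A c)"
    and eq: "snd (natural_chart A c) (p, v) = snd (natural_chart A c) (q, w)"
  then have p: "p \<in> fst c" "v \<in> tangent_space A p" and q: "q \<in> fst c" "w \<in> tangent_space A q"
    by (simp_all add: in_natural_chart)
  have e: "snd c p = snd c q" "v c = w c" using eq by (simp_all add: snd_natural_chart)
  have pq: "p = q" by (metis e(1) chart_inv_left[OF A c p(1)] chart_inv_left[OF A c q(1)])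
  have "v = w" by (rule tangent_eqI[where v=v and w=w, OF p(2) _ c p(1) e(2)]) (simp only: pq q(2))
  with pq show "p = q \<and> v = w" by (intro conjI)
qed

lemma natural_chart_image:
  assumes A: "smooth_atlas A" and c: "c \<in> A"
  shows "snd (natural_chart A c) ` (fst (natural_chart A c) \<inter> fst (natural_chart A d))
    = (snd c ` (fst c \<inter> fst d)) \<times> UNIV"
proof
  show "snd (natural_chart A c) ` (fst (natural_chart A c) \<inter> fst (natural_chart A d))
    \<subseteq> (snd c ` (fst c \<inter> fst d)) \<times> UNIV"
    by (auto simp: in_natural_chart snd_natural_chart)
  show "(snd c ` (fst c \<inter> fst d)) \<times> UNIV
    \<subseteq> snd (natural_chart A c) ` (fst (natural_chart A c) \<inter> fst (natural_chart A d))"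
  proof clarify
    fix x y p assume p: "p \<in> fst c" "p \<in> fst d"
    have "(snd c p, y) = snd (natural_chart A c) (p, tvec A c p y)"
      by (simp add: snd_natural_chart tvec_self[OF A c p(1)])
    moreover have "(p, tvec A c p y) \<in> fst (natural_chart A c) \<inter> fst (natural_chart A d)"
      using p by (simp add: in_natural_chart tvec_in[OF A c])
    ultimately show "(snd c p, y) \<in> snd (natural_chart A c) ` (fst (natural_chart A c) \<inter> fst (natural_chart A d))"
      by (rule image_eqI)
  qed
qed

lemma natural_chart_inv:
  assumes A: "smooth_atlas A" and c: "c \<in> A" and p: "p \<in> fst c"
  shows "chart_inv (natural_chart A c) (snd c p, y) = (p, tvec A c p y)"
proof -
  have "(p, tvec A c p y) \<in> fst (natural_chart A c)"
    using p by (simp add: in_natural_chart tvec_in[OF A c])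
  from inv_into_f_f[OF inj_natural_chart[OF A c] this]
  show ?thesis by (simp add: snd_natural_chart tvec_self[OF A c p])
qed

text \<open>The transition maps of natural charts are the lifts of the transition maps below; the
  derivative costs one order, which is harmless for smooth maps.\<close>

lemma smooth_atlas_tangent:
  assumes A: "smooth_atlas A"
  shows "smooth_atlas (tangent_atlas A)"
proof -
  have *: "open (snd (natural_chart A c) ` (fst (natural_chart A c) \<inter> fst (natural_chart A d))) \<and>
    smooth_on (snd (natural_chart A c) ` (fst (natural_chart A c) \<inter> fst (natural_chart A d)))
      (transition (natural_chart A c) (natural_chart A d))" if c: "c \<in> A" and d: "d \<in> A" for c d
  proof
  let ?S = "snd c ` (fst c \<inter> fst d)"
  have S: "open ?S" by (rule open_chart_image[OF A c openin_chart[OF A d]])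
  then have op: "open (?S \<times> (UNIV :: 'b set))" by (intro open_Times) auto
  show "open (snd (natural_chart A c) ` (fst (natural_chart A c) \<inter> fst (natural_chart A d)))"
    unfolding natural_chart_image[OF A c] by (rule op)
  have f: "smooth_on (?S \<times> (UNIV :: 'b set)) fst" "smooth_on (?S \<times> (UNIV :: 'b set)) snd"
    using op by (auto intro!: smooth_on_bounded_linear bounded_linear_fst bounded_linear_snd)
  have "smooth_on (?S \<times> UNIV) (\<lambda>z. (transition c d (fst z), fd (transition c d) (fst z) (snd z)))"
    by (intro smooth_on_Pair[OF op] smooth_on_compose[OF op S smooth_transition[OF A c d] f(1)]
        smooth_on_fd_comp[OF op S smooth_transition[OF A c d] f]) auto
  then show "smooth_on (snd (natural_chart A c) ` (fst (natural_chart A c) \<inter> fst (natural_chart A d)))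
      (transition (natural_chart A c) (natural_chart A d))"
    unfolding natural_chart_image[OF A c]
  proof (rule smooth_on_cong[OF _ op])
    fix z assume "z \<in> ?S \<times> (UNIV :: 'b set)"
    then obtain p y where p: "p \<in> fst c" "p \<in> fst d" and z: "z = (snd c p, y)" by auto
    show "(transition c d (fst z), fd (transition c d) (fst z) (snd z)) = transition (natural_chart A c) (natural_chart A d) z"
      using transition_eq[OF A c p(1), of d] p d
      by (simp add: z transition_def natural_chart_inv[OF A c p(1)] snd_natural_chart) (simp add: tvec_def transition_def)
  qed
  qed
  show ?thesis unfolding smooth_atlas_def tangent_atlas_def
    by (simp add: inj_natural_chart[OF A] *)
qed

lemma tangent_atlasI: "c \<in> A \<Longrightarrow> natural_chart A c \<in> tangent_atlas A"
  by (simp add: tangent_atlas_def)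

lemma local_rep_natural:
  assumes A: "smooth_atlas A" and c: "c \<in> A" "p \<in> fst c" and v: "v \<in> tangent_space A p"
  shows "local_rep (natural_chart A c) X (snd c p, v c) = X (p, v) (natural_chart A c)"
  using local_rep_at[OF smooth_atlas_tangent[OF A] tangent_atlasI[OF c(1)], of "(p, v)" X] c v
  by (simp add: in_natural_chart snd_natural_chart)

lemma tangent_nonzero:
  assumes "v \<in> tangent_space A p" "smooth_atlas A" "c \<in> A" "p \<in> fst c"
  shows "v \<noteq> (\<lambda>_. 0) \<longleftrightarrow> v c \<noteq> 0"
proof -
  have "(\<lambda>_. 0) \<in> tangent_space A p"
  proof -
    have "fd (transition c d) (snd c p) 0 = 0" if "c \<in> A" "d \<in> A" "p \<in> fst c" "p \<in> fst d" for c d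
      using linear_0[OF linear_fd[OF smooth_on_differentiable[OF smooth_transition[OF assms(2) that(1,2)]]], of "snd c p"] that
      by auto
    then show ?thesis unfolding tangent_space_def by simp
  qed
  from tangent_eqI[OF assms(1) this assms(3,4)] show ?thesis by auto
qed

lemma slit_natural_image:
  assumes A: "smooth_atlas A" and c: "c \<in> A"
  shows "snd (natural_chart A c) ` (fst (natural_chart A c) \<inter> slit_bundle A) = (snd c ` fst c) \<times> (- {0})" (is "?l = ?r")
proof
  show "?l \<subseteq> ?r"
    using tangent_nonzero[OF _ A c] by (auto simp: in_natural_chart snd_natural_chart slit_bundle_def)
  show "?r \<subseteq> ?l"
  proof
    fix z assume "z \<in> ?r"
    then obtain p y where p: "p \<in> fst c" and y: "y \<noteq> 0" and z: "z = (snd c p, y)" by auto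
    have "(p, tvec A c p y) \<in> fst (natural_chart A c) \<inter> slit_bundle A"
      using p y chart_subset_carrier[OF c] tangent_nonzero[OF tvec_in[OF A c p, of y] A c p]
      by (auto simp: in_natural_chart slit_bundle_def tvec_in[OF A c] tvec_self[OF A c p])
    moreover have "(snd c p, y) = snd (natural_chart A c) (p, tvec A c p y)"
      by (simp add: snd_natural_chart tvec_self[OF A c p])
    ultimately show "z \<in> ?l" unfolding z by (rule rev_image_eqI)
  qed
qed

section \<open>The flow of a vector field\<close>

locale vector_field =
  fixes A :: "('m, 'e::euclidean_space) atlas" and V :: "'m \<Rightarrow> ('m, 'e) tvec"
  assumes manifold: "smooth_manifold A" and field: "smooth_vector_field A (carrier A) V"
begin

lemma atlas: "smooth_atlas A"
  using manifold by (simp add: smooth_manifold_def)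

lemma field_in: "p \<in> carrier A \<Longrightarrow> V p \<in> tangent_space A p"
  using field by (simp add: smooth_vector_field_def)

lemma field_smooth:
  assumes "c \<in> A" shows "smooth_on (snd c ` fst c) (local_rep c V)"
proof -
  have "fst c \<inter> carrier A = fst c" using chart_subset_carrier[OF assms] by auto
  then show ?thesis using field assms by (auto simp: smooth_vector_field_def)
qed

lemma integral_curve_carrier: "integral_curve A V I \<gamma> \<Longrightarrow> t \<in> I \<Longrightarrow> \<gamma> t \<in> carrier A"
  unfolding integral_curve_def using smooth_curve_carrier[OF atlas] by blast

lemma integral_curve_interval:
  assumes "integral_curve A V I \<gamma>" shows "open I" "is_interval I"
  using assms by (simp_all add: integral_curve_def smooth_curve_def)

text \<open>The times of agreement form an open and closed subset of a connected set. Near a time of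
  agreement both curves solve the same equation in a chart; near a time of disagreement disjoint
  neighbourhoods keep them apart.\<close>

lemma integral_curve_unique:
  assumes g1: "integral_curve A V I1 \<gamma>1" and g2: "integral_curve A V I2 \<gamma>2"
    and s: "s \<in> I1 \<inter> I2" and t: "t \<in> I1 \<inter> I2" and eq: "\<gamma>1 s = \<gamma>2 s"
  shows "\<gamma>1 t = \<gamma>2 t"
proof -
  have sc: "smooth_curve A I1 \<gamma>1" "smooth_curve A I2 \<gamma>2" using g1 g2 by (auto simp: integral_curve_def)
  have "connected (I1 \<inter> I2)"
    using integral_curve_interval(2)[OF g1] integral_curve_interval(2)[OF g2] is_interval_Int is_interval_connected by blast
  then show ?thesis
  proof (rule connected_induction_simple[where P="\<lambda>t. \<gamma>1 t = \<gamma>2 t", OF _ s t eq])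
    fix a assume a: "a \<in> I1 \<inter> I2"
    have op: "open (I1 \<inter> I2)" using integral_curve_interval(1)[OF g1] integral_curve_interval(1)[OF g2] by (rule open_Int)
    have "\<exists>T. open T \<and> a \<in> T \<and> (\<forall>x\<in>T. \<forall>y\<in>T. x \<in> I1 \<inter> I2 \<longrightarrow> y \<in> I1 \<inter> I2 \<longrightarrow> \<gamma>1 x = \<gamma>2 x \<longrightarrow> \<gamma>1 y = \<gamma>2 y)"
    proof (cases "\<gamma>1 a = \<gamma>2 a")
      case True
      have "\<gamma>1 a \<in> carrier A" using integral_curve_carrier[OF g1] a by blast
      then obtain c where c: "c \<in> A" "\<gamma>1 a \<in> fst c" by (rule carrierE)
      define J where "J = {t \<in> I1. \<gamma>1 t \<in> fst c} \<inter> {t \<in> I2. \<gamma>2 t \<in> fst c}"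
      have J: "open J" "a \<in> J"
        unfolding J_def using smooth_curve_chart(1)[OF atlas sc(1) c(1)] smooth_curve_chart(1)[OF atlas sc(2) c(1)] a c(2) True
        by (auto intro: open_Int)
      have d1: "((\<lambda>s. snd c (\<gamma>1 s)) has_vector_derivative local_rep c V (snd c (\<gamma>1 t))) (at t)" if "t \<in> J" for t
        using integral_curve_chart[OF atlas g1 _ c(1), of t] local_rep_at[OF atlas c(1), of "\<gamma>1 t" V] that
        by (simp add: J_def)
      have d2: "((\<lambda>s. snd c (\<gamma>2 s)) has_vector_derivative local_rep c V (snd c (\<gamma>2 t))) (at t)" if "t \<in> J" for t
        using integral_curve_chart[OF atlas g2 _ c(1), of t] local_rep_at[OF atlas c(1), of "\<gamma>2 t" V] that
        by (simp add: J_def)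
      obtain e where e: "e > 0" "\<And>t. \<bar>t - a\<bar> < e \<Longrightarrow> snd c (\<gamma>1 t) = snd c (\<gamma>2 t)"
        by (rule ode_unique_local[OF field_smooth[OF c(1)] open_chart_range[OF atlas c(1)] J _ d1 _ d2])
           (use True in \<open>auto simp: J_def\<close>)
      have "\<gamma>1 y = \<gamma>2 y" if "y \<in> J" "y \<in> ball a e" for y
      proof -
        have "\<gamma>1 y \<in> fst c" "\<gamma>2 y \<in> fst c" using that(1) by (auto simp: J_def)
        moreover have "snd c (\<gamma>1 y) = snd c (\<gamma>2 y)" using e(2) that(2) by (simp add: dist_real_def abs_minus_commute)
        ultimately show ?thesis using chart_inv_left[OF atlas c(1)] by metis
      qed
      then show ?thesis using J e(1) by (intro exI[of _ "J \<inter> ball a e"]) auto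
    next
      case False
      have "\<gamma>1 a \<in> topspace (atlas_topology A)" "\<gamma>2 a \<in> topspace (atlas_topology A)"
        using integral_curve_carrier[OF g1, of a] integral_curve_carrier[OF g2, of a] a by (auto simp: topspace_atlas[OF atlas])
      moreover have "Hausdorff_space (atlas_topology A)" using manifold by (simp add: smooth_manifold_def)
      ultimately obtain U W where UW: "openin (atlas_topology A) U" "openin (atlas_topology A) W"
        "\<gamma>1 a \<in> U" "\<gamma>2 a \<in> W" "disjnt U W"
        using False unfolding Hausdorff_space_def by metis
      have "open ({t \<in> I1. \<gamma>1 t \<in> U} \<inter> {t \<in> I2. \<gamma>2 t \<in> W})"
        using open_curve_preimage[OF sc(1) UW(1)] open_curve_preimage[OF sc(2) UW(2)] by (rule open_Int)
      then show ?thesis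
        using UW(3-5) a by (intro exI[of _ "{t \<in> I1. \<gamma>1 t \<in> U} \<inter> {t \<in> I2. \<gamma>2 t \<in> W}"]) (auto simp: disjnt_iff)
    qed
    then obtain T where T: "open T" "a \<in> T"
      "\<forall>x\<in>T. \<forall>y\<in>T. x \<in> I1 \<inter> I2 \<longrightarrow> y \<in> I1 \<inter> I2 \<longrightarrow> \<gamma>1 x = \<gamma>2 x \<longrightarrow> \<gamma>1 y = \<gamma>2 y" by blast
    show "\<exists>T. openin (top_of_set (I1 \<inter> I2)) T \<and> a \<in> T \<and> (\<forall>x\<in>T. \<forall>y\<in>T. \<gamma>1 x = \<gamma>2 x \<longrightarrow> \<gamma>1 y = \<gamma>2 y)"
      using T a by (intro exI[of _ "(I1 \<inter> I2) \<inter> T"]) (auto simp: openin_open)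
  qed
qed

section \<open>Gluing of integral curves and the group law of the flow\<close>

lemma integral_curve_union:
  assumes g1: "integral_curve A V I1 \<gamma>1" and g2: "integral_curve A V I2 \<gamma>2"
    and s: "s \<in> I1 \<inter> I2" and eq: "\<gamma>1 s = \<gamma>2 s"
  shows "integral_curve A V (I1 \<union> I2) (\<lambda>t. if t \<in> I1 then \<gamma>1 t else \<gamma>2 t)"
proof (rule integral_curve_localI[OF atlas])
  note i1 = integral_curve_interval[OF g1] and i2 = integral_curve_interval[OF g2]
  show "open (I1 \<union> I2)" using i1 i2 by blast
  show "is_interval (I1 \<union> I2)"
    using i1 i2 s unfolding is_interval_connected_1 by (intro connected_Un) auto
  show "I1 \<union> I2 \<noteq> {}" using s by auto
  fix t assume t: "t \<in> I1 \<union> I2"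
  show "integral_at A V (\<lambda>t. if t \<in> I1 then \<gamma>1 t else \<gamma>2 t) t"
  proof (cases "t \<in> I1")
    case True
    show ?thesis
      by (rule integral_at_cong[OF integral_curve_integral_at[OF atlas g1 True] i1(1) True]) simp
  next
    case False
    then have t2: "t \<in> I2" using t by simp
    show ?thesis
      by (rule integral_at_cong[OF integral_curve_integral_at[OF atlas g2 t2] i2(1) t2])
         (use integral_curve_unique[OF g1 g2 s _ eq] in auto)
  qed
qed

lemma integral_curve_shift:
  assumes "integral_curve A V I \<gamma>"
  shows "integral_curve A V {t. t + s \<in> I} (\<lambda>t. \<gamma> (t + s))"
proof (rule integral_curve_localI[OF atlas])
  note i = integral_curve_interval[OF assms]
  obtain r where "r \<in> I" using assms by (auto simp: integral_curve_def smooth_curve_def)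
  then have "r - s \<in> {t. t + s \<in> I}" by simp
  then show "{t. t + s \<in> I} \<noteq> {}" by blast
  have "{t. t + s \<in> I} = (\<lambda>t. t + s) -` I" by auto
  then show "open {t. t + s \<in> I}" using i(1) by (simp add: open_vimage continuous_intros)
  show "is_interval {t. t + s \<in> I}"
    unfolding is_interval_1
  proof (intro ballI allI impI)
    fix a b x assume "a \<in> {t. t + s \<in> I}" "b \<in> {t. t + s \<in> I}" "a \<le> x \<and> x \<le> b"
    then show "x \<in> {t. t + s \<in> I}" using mem_is_interval_1_I[OF i(2), of "a + s" "b + s" "x + s"] by simp
  qed
  fix t assume "t \<in> {t. t + s \<in> I}"
  then show "integral_at A V (\<lambda>t. \<gamma> (t + s)) t"
    by (intro integral_at_shift integral_curve_integral_at[OF atlas assms]) simp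
qed

text \<open>Evaluates the definite description in \<open>flow\<close>: by uniqueness every integral
  curve through the point gives the same value at time \<open>t\<close>.\<close>

lemma flow_eqI:
  assumes \<gamma>: "integral_curve A V I \<gamma>" and I: "0 \<in> I" "t \<in> I"
  shows "\<gamma> 0 \<in> flow_dom A V t" "flow A V t (\<gamma> 0) = \<gamma> t"
proof -
  show "\<gamma> 0 \<in> flow_dom A V t"
    unfolding flow_dom_def using assms integral_curve_carrier[OF \<gamma> I(1)] by blast
  show "flow A V t (\<gamma> 0) = \<gamma> t"
    unfolding flow_def
  proof (rule the_equality)
    show "\<exists>J \<sigma>. integral_curve A V J \<sigma> \<and> 0 \<in> J \<and> t \<in> J \<and> \<sigma> 0 = \<gamma> 0 \<and> \<sigma> t = \<gamma> t" using assms by blast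
    fix q assume "\<exists>J \<sigma>. integral_curve A V J \<sigma> \<and> 0 \<in> J \<and> t \<in> J \<and> \<sigma> 0 = \<gamma> 0 \<and> \<sigma> t = q"
    then obtain J \<sigma> where \<sigma>: "integral_curve A V J \<sigma>" "0 \<in> J" "t \<in> J" "\<sigma> 0 = \<gamma> 0" "\<sigma> t = q" by blast
    show "q = \<gamma> t" using integral_curve_unique[OF \<sigma>(1) \<gamma>, of 0 t] \<sigma> I by simp
  qed
qed

lemma flow_domE:
  assumes "p \<in> flow_dom A V t"
  obtains I \<gamma> where "integral_curve A V I \<gamma>" "0 \<in> I" "t \<in> I" "\<gamma> 0 = p" "flow A V t p = \<gamma> t"
proof -
  from assms obtain I \<gamma> where g: "integral_curve A V I \<gamma>" "0 \<in> I" "t \<in> I" "\<gamma> 0 = p" unfolding flow_dom_def by blast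
  show ?thesis by (rule that[OF g]) (use flow_eqI(2)[OF g(1-3)] g(4) in simp)
qed

lemma flow_dom_carrier: "p \<in> flow_dom A V t \<Longrightarrow> p \<in> carrier A"
  by (simp add: flow_dom_def)

text \<open>The orbit of \<open>p\<close> and the time-shifted orbit of its image meet at time
  \<open>s\<close>, so they splice to one integral curve that reaches time
  \<open>s + t\<close>.\<close>

lemma flow_add:
  assumes "p \<in> flow_dom A V s" "flow A V s p \<in> flow_dom A V t"
  shows "p \<in> flow_dom A V (s + t)" "flow A V (s + t) p = flow A V t (flow A V s p)"
proof -
  obtain I \<gamma> where \<gamma>: "integral_curve A V I \<gamma>" "0 \<in> I" "s \<in> I" "\<gamma> 0 = p" "flow A V s p = \<gamma> s"
    using assms(1) by (rule flow_domE)
  obtain J \<sigma> where \<sigma>: "integral_curve A V J \<sigma>" "0 \<in> J" "t \<in> J" "\<sigma> 0 = flow A V s p"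
    "flow A V t (flow A V s p) = \<sigma> t"
    using assms(2) by (rule flow_domE)
  define J' where "J' = {r. r + - s \<in> J}"
  define \<sigma>' where "\<sigma>' = (\<lambda>r. \<sigma> (r + - s))"
  have \<sigma>': "integral_curve A V J' \<sigma>'" unfolding J'_def \<sigma>'_def by (rule integral_curve_shift[OF \<sigma>(1)])
  let ?g = "\<lambda>r. if r \<in> I then \<gamma> r else \<sigma>' r"
  have sJ: "s \<in> I \<inter> J'" using \<gamma>(3) \<sigma>(2) by (simp add: J'_def)
  have eq: "\<gamma> s = \<sigma>' s" using \<sigma>(4) \<gamma>(5) by (simp add: \<sigma>'_def)
  have g: "integral_curve A V (I \<union> J') ?g" by (rule integral_curve_union[OF \<gamma>(1) \<sigma>' sJ eq])
  have st: "s + t \<in> J'" using \<sigma>(3) by (simp add: J'_def)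
  have "?g (s + t) = \<sigma> t"
    using integral_curve_unique[OF \<gamma>(1) \<sigma>' sJ _ eq, of "s + t"] st by (auto simp: \<sigma>'_def)
  with flow_eqI[OF g, of "s + t"] show "p \<in> flow_dom A V (s + t)"
    "flow A V (s + t) p = flow A V t (flow A V s p)"
    using \<gamma>(2,4) \<sigma>(5) st by auto
qed

lemma flow_uminus:
  assumes "p \<in> flow_dom A V t"
  shows "flow A V t p \<in> flow_dom A V (- t)" "flow A V (- t) (flow A V t p) = p"
proof -
  obtain I \<gamma> where \<gamma>: "integral_curve A V I \<gamma>" "0 \<in> I" "t \<in> I" "\<gamma> 0 = p" "flow A V t p = \<gamma> t"
    using assms by (rule flow_domE)
  from flow_eqI[OF integral_curve_shift[OF \<gamma>(1), of t], of "- t"]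
  show "flow A V t p \<in> flow_dom A V (- t)" "flow A V (- t) (flow A V t p) = p"
    using \<gamma> by simp_all
qed

text \<open>The link between the globally defined flow and a flow box in coordinates: the coordinate
  solution is pulled back to an integral curve on the manifold.\<close>

lemma flow_chart:
  assumes c: "c \<in> A" and lf: "local_flow (local_rep c V) (snd c ` fst c) N d \<phi>"
    and x: "x \<in> N" and t: "\<bar>t\<bar> < d"
  shows "chart_inv c x \<in> flow_dom A V t" "flow A V t (chart_inv c x) = chart_inv c (\<phi> (t, x))"
proof -
  interpret local_flow "local_rep c V" "snd c ` fst c" N d \<phi> by fact
  let ?I = "{-d<..<d}" and ?g = "\<lambda>s. chart_inv c (\<phi> (s, x))"
  have in_c: "?g s \<in> fst c" and inv: "snd c (?g s) = \<phi> (s, x)" if "s \<in> ?I" for s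
    using flow_in[of s x] that x chart_inv_in[of _ c] chart_inv_right[of _ c] by auto
  have g: "integral_curve A V ?I ?g"
  proof (rule integral_curve_localI[OF atlas])
    show "?I \<noteq> {}" using d_pos by simp
    fix s assume s: "s \<in> ?I"
    have sd: "\<bar>s\<bar> < d" using s by auto
    show "integral_at A V ?g s"
      unfolding integral_at_def
    proof (intro conjI exI[of _ c] exI[of _ ?I] ballI)
      show "V (?g s) \<in> tangent_space A (?g s)"
        using field_in in_c[OF s] chart_subset_carrier[OF c] by blast
      have i: "smooth_on ?I (\<lambda>s. (s, x))"
        by (intro smooth_on_Pair smooth_on_id smooth_on_const open_greaterThanLessThan)
      have "smooth_on ?I (\<lambda>s. \<phi> (s, x))"
        by (rule smooth_on_compose[OF open_greaterThanLessThan open_dom smooth_flow i]) (use x in auto)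
      then show "smooth_on ?I (\<lambda>s. snd c (?g s))"
        by (rule smooth_on_cong) (simp_all add: inv)
      show "((\<lambda>s. snd c (?g s)) has_vector_derivative V (?g s) c) (at s)"
        by (rule has_vector_derivative_transform_within_open[OF flow_deriv[OF sd x, unfolded local_rep_def] open_greaterThanLessThan s])
           (simp add: inv)
    qed (use c s in_c in auto)
  qed (auto simp: is_interval_oo)
  have "\<phi> (0, x) = x" by (rule flow_0[OF x])
  moreover have "0 \<in> ?I" "t \<in> ?I" using t d_pos by auto
  ultimately show "chart_inv c x \<in> flow_dom A V t" "flow A V t (chart_inv c x) = chart_inv c (\<phi> (t, x))"
    using flow_eqI[OF g, of t] by simp_all
qed

lemma local_flow_at:
  assumes c: "c \<in> A" and p: "p \<in> fst c"
  obtains N d \<phi> where "snd c p \<in> N" "local_flow (local_rep c V) (snd c ` fst c) N d \<phi>"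
proof -
  have "snd c p \<in> snd c ` fst c" using p by (rule imageI)
  from local_flow_exists[OF field_smooth[OF c] open_chart_range[OF atlas c] this]
  obtain d N \<phi> where "snd c p \<in> N" "local_flow (local_rep c V) (snd c ` fst c) N d \<phi>" .
  then show ?thesis by (rule that)
qed

text \<open>Along an integral curve, being good at time \<open>r\<close> (the flow map \<open>\<phi>\<^sub>r\<close> is defined and has property
  \<open>Q\<close> near the initial point) is a locally constant condition, since \<open>\<phi>\<^sub>r\<close> is locally composed of a flow map
  for a nearby time and one for a short time.\<close>

lemma flow_propagation:
  assumes comp: "\<And>f g W W'. Q W f \<Longrightarrow> Q W' g \<Longrightarrow> f ` W \<subseteq> W' \<Longrightarrow> Q W (g \<circ> f)"
    and cong: "\<And>f g W. Q W f \<Longrightarrow> (\<And>p. p \<in> W \<Longrightarrow> f p = g p) \<Longrightarrow> Q W g"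
    and sub: "\<And>f W W'. Q W f \<Longrightarrow> openin (atlas_topology A) W' \<Longrightarrow> W' \<subseteq> W \<Longrightarrow> Q W' f"
    and smooth: "\<And>f W. Q W f \<Longrightarrow> smooth_map A W A f"
    and local: "\<And>q. q \<in> carrier A \<Longrightarrow> \<exists>d>0. \<exists>W. openin (atlas_topology A) W \<and> q \<in> W \<and>
        (\<forall>t. \<bar>t\<bar> < d \<longrightarrow> W \<subseteq> flow_dom A V t \<and> Q W (flow A V t))"
    and p: "p \<in> flow_dom A V t"
  shows "\<exists>W. p \<in> W \<and> W \<subseteq> flow_dom A V t \<and> Q W (flow A V t)"
proof -
  obtain I \<gamma> where \<gamma>: "integral_curve A V I \<gamma>" "0 \<in> I" "t \<in> I" "\<gamma> 0 = p" "flow A V t p = \<gamma> t"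
    using p by (rule flow_domE)
  have sc: "smooth_curve A I \<gamma>" using \<gamma>(1) by (simp add: integral_curve_def)
  define good where "good r \<longleftrightarrow> (\<exists>W. p \<in> W \<and> W \<subseteq> flow_dom A V r \<and> Q W (flow A V r))" for r
  have "connected I" using integral_curve_interval(2)[OF \<gamma>(1)] by (rule is_interval_connected)
  then have "good t"
  proof (rule connected_induction_simple[OF _ \<gamma>(2,3)])
    obtain d W where "d > 0" "p \<in> W" "\<forall>t. \<bar>t\<bar> < d \<longrightarrow> W \<subseteq> flow_dom A V t \<and> Q W (flow A V t)"
      using local[OF flow_dom_carrier[OF p]] by blast
    then show "good 0" unfolding good_def by (intro exI[of _ W]) auto
    fix a assume a: "a \<in> I"
    obtain d W where d: "d > 0" and W: "openin (atlas_topology A) W" "\<gamma> a \<in> W"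
      and Wd: "\<forall>t. \<bar>t\<bar> < d \<longrightarrow> W \<subseteq> flow_dom A V t \<and> Q W (flow A V t)"
      using local[OF integral_curve_carrier[OF \<gamma>(1) a]] by blast
    \<comment> \<open>Radius \<open>d / 2\<close>, so that any two times in \<open>T\<close> differ
      by less than \<open>d\<close>. Their difference may have either sign, and goodness passes
      between them in both directions.\<close>
    define T where "T = {r \<in> I. \<gamma> r \<in> W} \<inter> ball a (d / 2)"
    have T: "open T" "a \<in> T" "T \<subseteq> I"
      using open_curve_preimage[OF sc W(1)] a W(2) d by (auto simp: T_def intro: open_Int)
    have "good y" if x: "x \<in> T" and y: "y \<in> T" and gx: "good x" for x y
    proof -
      obtain W1 where W1: "p \<in> W1" "W1 \<subseteq> flow_dom A V x" "Q W1 (flow A V x)" using gx unfolding good_def by blast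
      \<comment> \<open>The points whose image at time \<open>x\<close> lies where the short flow is
        controlled; open by continuity of the flow map at time \<open>x\<close>.\<close>
      define W2 where "W2 = {q \<in> W1. flow A V x q \<in> W}"
      have W2: "openin (atlas_topology A) W2"
        unfolding W2_def by (rule openin_map_preimage[OF smooth[OF W1(3)] W(1)])
      have "dist x y < d" using x y dist_triangle_half_r[of a x d y] by (simp add: T_def)
      then have "\<bar>y - x\<bar> < d" by (simp add: dist_real_def abs_minus_commute)
      with Wd have yx: "W \<subseteq> flow_dom A V (y - x)" "Q W (flow A V (y - x))" by blast+
      have step: "q \<in> flow_dom A V y \<and> flow A V y q = flow A V (y - x) (flow A V x q)" if "q \<in> W2" for q
      proof -
        have "q \<in> flow_dom A V x" "flow A V x q \<in> flow_dom A V (y - x)"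
          using that W1(2) yx(1) by (auto simp: W2_def)
        from flow_add[OF this] show ?thesis by simp
      qed
      have "flow A V x p = \<gamma> x" using flow_eqI(2)[OF \<gamma>(1,2), of x] x T(3) \<gamma>(4) by auto
      then have "p \<in> W2" using W1(1) x by (simp add: W2_def T_def)
      moreover have "Q W2 (flow A V y)"
      proof (rule cong)
        show "Q W2 (flow A V (y - x) \<circ> flow A V x)"
        proof (rule comp[OF sub[OF W1(3) W2] yx(2)])
          show "W2 \<subseteq> W1" "flow A V x ` W2 \<subseteq> W" by (auto simp: W2_def)
        qed
      qed (simp add: step)
      ultimately show ?thesis unfolding good_def using step by blast
    qed
    then show "\<exists>T. openin (top_of_set I) T \<and> a \<in> T \<and> (\<forall>x\<in>T. \<forall>y\<in>T. good x \<longrightarrow> good y)"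
      by (intro exI[of _ T] conjI ballI impI open_subset T)
  qed
  then show ?thesis unfolding good_def .
qed

end

section \<open>The complete lift and the Lie bracket in natural charts\<close>

context vector_field begin

lemma flow_zero:
  assumes "p \<in> carrier A" shows "flow A V 0 p = p"
proof -
  obtain c where c: "c \<in> A" "p \<in> fst c" using assms by (rule carrierE)
  obtain N d \<phi> where lf: "snd c p \<in> N" "local_flow (local_rep c V) (snd c ` fst c) N d \<phi>"
    using local_flow_at[OF c] .
  interpret local_flow "local_rep c V" "snd c ` fst c" N d \<phi> by (rule lf(2))
  have "\<bar>0\<bar> < d" using d_pos by simp
  from flow_chart(2)[OF c(1) lf(2,1) this] show ?thesis
    by (simp add: chart_inv_left[OF atlas c] flow_0[OF lf(1)])
qed

lemma flow_chart_coord: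
  assumes c: "c \<in> A" and lf: "local_flow (local_rep c V) (snd c ` fst c) N d \<phi>"
    and p: "p \<in> fst c" "snd c p \<in> N" and t: "\<bar>t\<bar> < d"
  shows "p \<in> flow_dom A V t" "flow A V t p \<in> fst c" "snd c (flow A V t p) = \<phi> (t, snd c p)"
proof -
  interpret local_flow "local_rep c V" "snd c ` fst c" N d \<phi> by (rule lf)
  have \<phi>: "\<phi> (t, snd c p) \<in> snd c ` fst c" by (rule flow_in[OF t p(2)])
  note fc = flow_chart[OF c lf p(2) t, unfolded chart_inv_left[OF atlas c p(1)]]
  show "p \<in> flow_dom A V t" by (rule fc(1))
  show "flow A V t p \<in> fst c" unfolding fc(2) by (rule chart_inv_in[OF \<phi>])
  show "snd c (flow A V t p) = \<phi> (t, snd c p)" unfolding fc(2) by (rule chart_inv_right[OF \<phi>])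
qed

lemma tangent_map_eq:
  assumes c0: "c0 = (SOME c. c \<in> A \<and> p \<in> fst c)"
  shows "tangent_map A A F (p, v) = (F p, \<lambda>d. if d \<in> A \<and> F p \<in> fst d
               then fd (\<lambda>x. snd d (F (chart_inv c0 x))) (snd c0 p) (v c0) else 0)"
  unfolding tangent_map_def c0 Let_def comp_def by simp

text \<open>\<open>tangent_map\<close> measures the vector in an arbitrarily chosen chart
  \<open>c0\<close>, while the result is read in \<open>c\<close>. The transformation rule for
  \<open>v\<close> absorbs the difference, and the lifted curve becomes an orbit of
  \<open>flow_lift \<phi>\<close>.\<close>

lemma complete_lift_chart:
  assumes v: "v \<in> tangent_space A p" and c: "c \<in> A" "p \<in> fst c"
  shows "complete_lift A V (p, v) (natural_chart A c) = lift (local_rep c V) (snd c p, v c)"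
proof -
  define c0 where c0: "c0 = (SOME c. c \<in> A \<and> p \<in> fst c)"
  have "c0 \<in> A \<and> p \<in> fst c0" unfolding c0 using c by (intro someI[of "\<lambda>c. c \<in> A \<and> p \<in> fst c" c]) auto
  then have c0A: "c0 \<in> A" "p \<in> fst c0" by auto
  have pc: "p \<in> carrier A" using c chart_subset_carrier by blast
  let ?\<sigma> = "\<lambda>t. tangent_map A A (flow A V t) (p, v)"
  \<comment> \<open>\<open>velocity\<close> takes the default value 0 in a chart that does not
    contain the curve at that time, so the position at time 0 must be identified as
    \<open>(p, v)\<close>.\<close>
  have \<sigma>0: "?\<sigma> 0 = (p, v)"
  proof -
    have eq: "fd (\<lambda>x. snd d (flow A V 0 (chart_inv c0 x))) (snd c0 p) = fd (transition c0 d) (snd c0 p)" for d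
    proof (rule fd_cong[OF open_chart_range[OF atlas c0A(1)]])
      show "snd c0 p \<in> snd c0 ` fst c0" using c0A(2) by (rule imageI)
      fix x assume "x \<in> snd c0 ` fst c0"
      then have "chart_inv c0 x \<in> carrier A"
        by (rule subsetD[OF chart_subset_carrier[OF c0A(1)] chart_inv_in])
      then show "snd d (flow A V 0 (chart_inv c0 x)) = transition c0 d x"
        by (simp add: flow_zero transition_def)
    qed
    have "?\<sigma> 0 = (p, tvec A c0 p (v c0))"
      unfolding tangent_map_eq[OF c0] tvec_def flow_zero[OF pc] eq ..
    also have "tvec A c0 p (v c0) = v"
      by (rule tangent_eqI[OF tvec_in[OF atlas c0A] v c0A tvec_self[OF atlas c0A]])
    finally show ?thesis .
  qed
  obtain N d \<phi> where N: "snd c p \<in> N" and lf: "local_flow (local_rep c V) (snd c ` fst c) N d \<phi>"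
    using local_flow_at[OF c] .
  interpret F: local_flow "local_rep c V" "snd c ` fst c" N d \<phi> by (rule lf)
  interpret L: local_flow "lift (local_rep c V)" "(snd c ` fst c) \<times> UNIV" "N \<times> UNIV" d "flow_lift \<phi>"
    by (rule local_flow_lift[OF lf])
  have d0: "\<bar>0\<bar> < d" using F.d_pos by simp
  let ?z = "(snd c p, v c)"
  have \<sigma>: "snd (natural_chart A c) (?\<sigma> t) = flow_lift \<phi> (t, ?z)" if t: "\<bar>t\<bar> < d" for t
  proof -
    note fc = flow_chart_coord[OF c(1) lf c(2) N t]
    let ?T = "snd c0 ` (fst c0 \<inter> fst c)"
    let ?S = "?T \<inter> transition c0 c -` N"
    have opT: "open ?T" by (rule open_chart_image[OF atlas c0A(1) openin_chart[OF atlas c(1)]])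
    have tr: "smooth_on ?T (transition c0 c)" by (rule smooth_transition[OF atlas c0A(1) c(1)])
    have opS: "open ?S" by (rule continuous_open_preimage[OF smooth_on_imp_continuous_on[OF tr] opT F.open_N])
    have pT: "snd c0 p \<in> ?T" using c0A(2) c(2) by blast
    have trp: "transition c0 c (snd c0 p) = snd c p" by (rule transition_eq[OF atlas c0A])
    have pS: "snd c0 p \<in> ?S" using pT trp N by simp
    have "fd (\<lambda>x. snd c (flow A V t (chart_inv c0 x))) (snd c0 p) = fd (\<lambda>x. \<phi> (t, transition c0 c x)) (snd c0 p)"
    proof (rule fd_cong[OF opS pS])
      fix x assume x: "x \<in> ?S"
      then obtain q where q: "q \<in> fst c0" "q \<in> fst c" "x = snd c0 q" by blast
      have tq: "transition c0 c x = snd c q" unfolding q(3) by (rule transition_eq[OF atlas c0A(1) q(1)])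
      have "snd c q \<in> N" using x tq by simp
      from flow_chart_coord(3)[OF c(1) lf q(2) this t]
      show "snd c (flow A V t (chart_inv c0 x)) = \<phi> (t, transition c0 c x)"
        unfolding tq unfolding q(3) chart_inv_left[OF atlas c0A(1) q(1)] .
    qed
    also have "\<dots> = (\<lambda>h. fd \<phi> (t, snd c p) (0, fd (transition c0 c) (snd c0 p) h))"
    proof (rule fd_eq)
      have 1: "(transition c0 c has_derivative fd (transition c0 c) (snd c0 p)) (at (snd c0 p))"
        by (rule smooth_on_has_derivative[OF tr pT])
      have 2: "((\<lambda>y. \<phi> (t, y)) has_derivative (\<lambda>h. fd \<phi> (t, snd c p) (0, h))) (at (transition c0 c (snd c0 p)))"
        unfolding trp by (rule space_derivative[OF F.flow_differentiable[OF t N]])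
      from has_derivative_compose[OF 1 2]
      show "((\<lambda>x. \<phi> (t, transition c0 c x)) has_derivative
          (\<lambda>h. fd \<phi> (t, snd c p) (0, fd (transition c0 c) (snd c0 p) h))) (at (snd c0 p))" .
    qed
    finally have fd: "fd (\<lambda>x. snd c (flow A V t (chart_inv c0 x))) (snd c0 p) (v c0)
        = fd \<phi> (t, snd c p) (0, fd (transition c0 c) (snd c0 p) (v c0))" by simp
    have "fd (transition c0 c) (snd c0 p) (v c0) = v c"
      by (rule tangent_fd[OF v c0A(1) c(1) c0A(2) c(2), symmetric])
    with fd have "fd (\<lambda>x. snd c (flow A V t (chart_inv c0 x))) (snd c0 p) (v c0) = fd \<phi> (t, snd c p) (0, v c)"
      by simp
    then show ?thesis
      unfolding tangent_map_eq[OF c0] snd_natural_chart flow_lift_def by (simp add: fc c)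
  qed
  have zN: "?z \<in> N \<times> UNIV" using N by simp
  have "(flow_lift \<phi> (0, ?z)) = ?z" by (rule L.flow_0[OF zN])
  then have der: "((\<lambda>s. flow_lift \<phi> (s, ?z)) has_vector_derivative lift (local_rep c V) ?z) (at 0)"
    using L.flow_deriv[OF d0 zN] by simp
  have "((\<lambda>s. snd (natural_chart A c) (?\<sigma> s)) has_vector_derivative lift (local_rep c V) ?z) (at 0)"
    by (rule has_vector_derivative_transform_within_open[OF der, of "{-d<..<d}"]) (use F.d_pos \<sigma> in auto)
  then have "vector_derivative (\<lambda>s. snd (natural_chart A c) (?\<sigma> s)) (at 0) = lift (local_rep c V) ?z"
    by (rule vector_derivative_at)
  moreover have "?\<sigma> 0 \<in> fst (natural_chart A c)" unfolding \<sigma>0 in_natural_chart using v c by simp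
  ultimately show ?thesis
    unfolding complete_lift_def velocity_def using tangent_atlasI[OF c(1)] by (simp add: comp_def)
qed

lemma complete_lift_rep:
  assumes c: "c \<in> A" and x: "x \<in> snd c ` fst c"
  shows "local_rep (natural_chart A c) (complete_lift A V) (x, y) = lift (local_rep c V) (x, y)"
proof -
  obtain p where p: "p \<in> fst c" "x = snd c p" using x by blast
  let ?v = "tvec A c p y"
  have v: "?v \<in> tangent_space A p" by (rule tvec_in[OF atlas c p(1)])
  have vc: "?v c = y" by (rule tvec_self[OF atlas c p(1)])
  show ?thesis
    using local_rep_natural[OF atlas c p(1) v, of "complete_lift A V"] complete_lift_chart[OF v c p(1)]
    by (simp add: vc p(2))
qed

end

section \<open>Sprays and the bracket in natural coordinates\<close>

locale spray_field = vector_field A V for A :: "('m, 'e::euclidean_space) atlas" and V +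
  fixes G :: "('m, 'e) bundle_field"
  assumes spray: "spray A G"
begin

abbreviation spray_rep :: "('m, 'e) chart \<Rightarrow> 'e \<times> 'e \<Rightarrow> 'e \<times> 'e" where
  "spray_rep c \<equiv> local_rep (natural_chart A c) G"

abbreviation slit_range :: "('m, 'e) chart \<Rightarrow> ('e \<times> 'e) set" where
  "slit_range c \<equiv> (snd c ` fst c) \<times> (- {0})"

lemma open_slit_range: "c \<in> A \<Longrightarrow> open (slit_range c)"
  by (intro open_Times open_chart_range[OF atlas]) auto

lemma smooth_spray_rep:
  assumes "c \<in> A" shows "smooth_on (slit_range c) (spray_rep c)"
proof -
  have "smooth_vector_field (tangent_atlas A) (slit_bundle A) G" using spray by (simp add: spray_def)
  then have "smooth_on (snd (natural_chart A c) ` (fst (natural_chart A c) \<inter> slit_bundle A)) (spray_rep c)"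
    using tangent_atlasI[OF assms] by (simp add: smooth_vector_field_def)
  then show ?thesis by (simp only: slit_natural_image[OF atlas assms])
qed

lemma spray_in: "u \<in> slit_bundle A \<Longrightarrow> G u \<in> tangent_space (tangent_atlas A) u"
  using spray by (simp add: spray_def smooth_vector_field_def)

lemma spray_rep_eq:
  assumes "c \<in> A" "z \<in> slit_range c"
  shows "spray_rep c z = (snd z, - 2 *\<^sub>R spray_coeff A G c z)"
  using spray assms unfolding spray_def by (cases z) auto

lemma lie_derivative_chart:
  assumes v: "v \<in> tangent_space A p" and c: "c \<in> A" "p \<in> fst c"
  shows "lie_derivative (tangent_atlas A) (complete_lift A V) G (p, v) (natural_chart A c) =
    fd (spray_rep c) (snd c p, v c) (lift (local_rep c V) (snd c p, v c))
      - fd (lift (local_rep c V)) (snd c p, v c) (spray_rep c (snd c p, v c))"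
proof -
  let ?z = "(snd c p, v c)"
  have op: "open ((snd c ` fst c) \<times> (UNIV :: 'e set))"
    by (rule open_Times[OF open_chart_range[OF atlas c(1)] open_UNIV])
  have z: "?z \<in> (snd c ` fst c) \<times> UNIV" using c(2) by simp
  have "fd (local_rep (natural_chart A c) (complete_lift A V)) ?z = fd (lift (local_rep c V)) ?z"
    by (rule fd_cong[OF op z]) (use complete_lift_rep[OF c(1)] in auto)
  moreover have "natural_chart A c \<in> tangent_atlas A \<and> (p, v) \<in> fst (natural_chart A c)"
    using c v tangent_atlasI by (simp add: in_natural_chart)
  ultimately show ?thesis
    unfolding lie_bracket_def
    by (simp add: snd_natural_chart complete_lift_chart[OF v c] local_rep_natural[OF atlas c v])
qed

lemma lie_zero_iff:
  "(\<forall>u\<in>slit_bundle A. lie_derivative (tangent_atlas A) (complete_lift A V) G u = (\<lambda>_. 0)) \<longleftrightarrow>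
   (\<forall>c\<in>A. \<forall>z\<in>slit_range c. fd (spray_rep c) z (lift (local_rep c V) z) = fd (lift (local_rep c V)) z (spray_rep c z))"
  (is "?L \<longleftrightarrow> ?R")
proof
  assume L: ?L
  show ?R
  proof (intro ballI)
    fix c z assume c: "c \<in> A" and z: "z \<in> slit_range c"
    then obtain p y where p: "p \<in> fst c" and y: "y \<noteq> 0" and z_eq: "z = (snd c p, y)" by auto
    let ?v = "tvec A c p y"
    have v: "?v \<in> tangent_space A p" by (rule tvec_in[OF atlas c p])
    have vc: "?v c = y" by (rule tvec_self[OF atlas c p])
    have "(p, ?v) \<in> slit_bundle A"
      using v y vc chart_subset_carrier[OF c] p tangent_nonzero[OF v atlas c p] by (auto simp: slit_bundle_def)
    with L have "lie_derivative (tangent_atlas A) (complete_lift A V) G (p, ?v) (natural_chart A c) = 0" by simp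
    then show "fd (spray_rep c) z (lift (local_rep c V) z) = fd (lift (local_rep c V)) z (spray_rep c z)"
      unfolding lie_derivative_chart[OF v c p] vc z_eq by simp
  qed
next
  assume R: ?R
  show ?L
  proof (intro ballI ext)
    fix u C assume u: "u \<in> slit_bundle A"
    obtain p v where u_eq: "u = (p, v)" by (cases u)
    have v: "v \<in> tangent_space A p" "v \<noteq> (\<lambda>_. 0)" using u by (auto simp: u_eq slit_bundle_def)
    show "lie_derivative (tangent_atlas A) (complete_lift A V) G u C = 0"
    proof (cases "C \<in> tangent_atlas A \<and> u \<in> fst C")
      case True
      then obtain c where c: "c \<in> A" "C = natural_chart A c" by (auto simp: tangent_atlas_def)
      have p: "p \<in> fst c" using True by (simp add: c u_eq in_natural_chart)
      have z: "(snd c p, v c) \<in> slit_range c" using p tangent_nonzero[OF v(1) atlas c(1) p] v(2) by simp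
      show ?thesis
        unfolding u_eq c(2) lie_derivative_chart[OF v(1) c(1) p] R[rule_format, OF c(1) z] by simp
    next
      case False
      then show ?thesis unfolding lie_bracket_def by (rule if_not_P)
    qed
  qed
qed

end

section \<open>Geodesics and affine vector fields\<close>

context spray_field begin

text \<open>The second-order equation of a geodesic in one chart, as a first-order system with
  velocity \<open>y\<close>. The spray equation is imposed at \<open>t\<close> only, but
  \<open>y\<close> has to be the velocity on all of \<open>J\<close>, since its derivative at
  \<open>t\<close> involves nearby times.\<close>

definition geodesic_rep :: "(real \<Rightarrow> 'm) \<Rightarrow> real \<Rightarrow> ('m, 'e) chart \<Rightarrow> real set \<Rightarrow> (real \<Rightarrow> 'e) \<Rightarrow> bool" where
  "geodesic_rep \<gamma> t c J y \<longleftrightarrow> c \<in> A \<and> open J \<and> t \<in> J \<and> (\<forall>s\<in>J. \<gamma> s \<in> fst c) \<and>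
     smooth_on J (\<lambda>s. snd c (\<gamma> s)) \<and> (\<forall>s\<in>J. ((\<lambda>s. snd c (\<gamma> s)) has_vector_derivative y s) (at s)) \<and>
     y t \<noteq> 0 \<and> ((\<lambda>s. (snd c (\<gamma> s), y s)) has_vector_derivative spray_rep c (snd c (\<gamma> t), y t)) (at t)"

lemma geodesic_repD:
  assumes "geodesic_rep \<gamma> t c J y"
  shows "c \<in> A" "open J" "t \<in> J" "\<forall>s\<in>J. \<gamma> s \<in> fst c" "smooth_on J (\<lambda>s. snd c (\<gamma> s))"
    "\<forall>s\<in>J. ((\<lambda>s. snd c (\<gamma> s)) has_vector_derivative y s) (at s)" "y t \<noteq> 0"
    "((\<lambda>s. (snd c (\<gamma> s), y s)) has_vector_derivative spray_rep c (snd c (\<gamma> t), y t)) (at t)"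
  using assms by (simp_all add: geodesic_rep_def)

lemma geodesic_repI:
  assumes "c \<in> A" "open J" "t \<in> J" "\<And>s. s \<in> J \<Longrightarrow> \<gamma> s \<in> fst c" "smooth_on J (\<lambda>s. snd c (\<gamma> s))"
    "\<And>s. s \<in> J \<Longrightarrow> ((\<lambda>s. snd c (\<gamma> s)) has_vector_derivative y s) (at s)" "y t \<noteq> 0"
    "((\<lambda>s. (snd c (\<gamma> s), y s)) has_vector_derivative spray_rep c (snd c (\<gamma> t), y t)) (at t)"
  shows "geodesic_rep \<gamma> t c J y"
  unfolding geodesic_rep_def by (intro conjI ballI assms)

definition geodesic_at :: "(real \<Rightarrow> 'm) \<Rightarrow> real \<Rightarrow> bool" where
  "geodesic_at \<gamma> t \<longleftrightarrow> (\<exists>c J y. geodesic_rep \<gamma> t c J y)"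

lemma geodesic_at_cong:
  assumes "geodesic_at \<gamma> t" "open S" "t \<in> S" and eq: "\<And>s. s \<in> S \<Longrightarrow> \<gamma> s = \<gamma>' s"
  shows "geodesic_at \<gamma>' t"
proof -
  obtain c J y where rep: "geodesic_rep \<gamma> t c J y" using assms(1) unfolding geodesic_at_def by blast
  note r = geodesic_repD[OF rep]
  have op: "open (J \<inter> S)" using r(2) assms(2) by (rule open_Int)
  have "geodesic_rep \<gamma>' t c (J \<inter> S) y"
  proof (rule geodesic_repI)
    show "smooth_on (J \<inter> S) (\<lambda>s. snd c (\<gamma>' s))"
      by (rule smooth_on_cong[OF smooth_on_subset[OF r(5)] op]) (auto simp: eq)
    show "((\<lambda>s. snd c (\<gamma>' s)) has_vector_derivative y s) (at s)" if s: "s \<in> J \<inter> S" for s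
      using has_vector_derivative_transform_within_open[OF bspec[OF r(6)] assms(2), of s "\<lambda>s. snd c (\<gamma>' s)"] s eq
      by simp
    show "((\<lambda>s. (snd c (\<gamma>' s), y s)) has_vector_derivative spray_rep c (snd c (\<gamma>' t), y t)) (at t)"
      using has_vector_derivative_transform_within_open[OF r(8) assms(2,3), of "\<lambda>s. (snd c (\<gamma>' s), y s)"] eq assms(3)
      by simp
    show "\<gamma>' s \<in> fst c" if "s \<in> J \<inter> S" for s using r(4) that eq[of s] by auto
  qed (use r assms(3) op in auto)
  then show ?thesis unfolding geodesic_at_def by blast
qed

lemma geodesic_localI:
  assumes I: "open I" "is_interval I" "I \<noteq> {}" and loc: "\<And>t. t \<in> I \<Longrightarrow> geodesic_at \<gamma> t"
  shows "geodesic A G I \<gamma>"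
proof -
  have sc: "smooth_curve A I \<gamma>"
  proof (rule smooth_curve_localI[OF atlas I])
    fix t assume "t \<in> I"
    then obtain c J y where rep: "geodesic_rep \<gamma> t c J y" using loc unfolding geodesic_at_def by blast
    note r = geodesic_repD[OF rep]
    show "\<exists>c\<in>A. \<exists>J. open J \<and> t \<in> J \<and> \<gamma> ` J \<subseteq> fst c \<and> smooth_on J (\<lambda>s. snd c (\<gamma> s))"
      using r(4) by (intro bexI[of _ c] exI[of _ J] conjI r(1,2,3,5)) auto
  qed
  have main: "dot A \<gamma> t \<in> slit_bundle A \<and> integral_at (tangent_atlas A) G (dot A \<gamma>) t" if t: "t \<in> I" for t
  proof -
    obtain c J y where rep: "geodesic_rep \<gamma> t c J y" using loc[OF t] unfolding geodesic_at_def by blast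
    note r = geodesic_repD[OF rep]
    have vel: "velocity A \<gamma> s c = y s" if "s \<in> I \<inter> J" for s
      using vector_derivative_unique_at[OF velocity_chart[OF atlas sc _ r(1)] bspec[OF r(6)]] r(4) that by auto
    have op: "open (I \<inter> J)" using I(1) r(2) by (rule open_Int)
    have tIJ: "t \<in> I \<inter> J" and tc: "\<gamma> t \<in> fst c" using t r by auto
    note vt = velocity_in[OF atlas sc t]
    have nz: "velocity A \<gamma> t \<noteq> (\<lambda>_. 0)"
      using tangent_nonzero[OF vt atlas r(1) tc] vel[OF tIJ] r(7) by simp
    have slit: "dot A \<gamma> t \<in> slit_bundle A"
      using nz vt tc chart_subset_carrier[OF r(1)] by (auto simp: slit_bundle_def dot_def)
    have eq: "(snd c (\<gamma> s), y s) = snd (natural_chart A c) (dot A \<gamma> s)" if "s \<in> I \<inter> J" for s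
      using vel[OF that] by (simp add: dot_def snd_natural_chart)
    have "integral_at (tangent_atlas A) G (dot A \<gamma>) t"
      unfolding integral_at_def
    proof (intro conjI exI[of _ "natural_chart A c"] exI[of _ "I \<inter> J"] ballI)
      show "G (dot A \<gamma> t) \<in> tangent_space (tangent_atlas A) (dot A \<gamma> t)" by (rule spray_in[OF slit])
      show "natural_chart A c \<in> tangent_atlas A" by (rule tangent_atlasI[OF r(1)])
      show "dot A \<gamma> s \<in> fst (natural_chart A c)" if "s \<in> I \<inter> J" for s
        using velocity_in[OF atlas sc, of s] r(4) that by (auto simp: dot_def in_natural_chart)
      have "smooth_on (I \<inter> J) (\<lambda>s. velocity A \<gamma> s c)"
        by (rule smooth_on_subset[OF smooth_on_velocity[OF atlas sc r(1)]]) (use r(4) in auto)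
      then have "smooth_on (I \<inter> J) (\<lambda>s. (snd c (\<gamma> s), velocity A \<gamma> s c))"
        by (intro smooth_on_Pair op smooth_on_subset[OF r(5)]) auto
      then show "smooth_on (I \<inter> J) (\<lambda>s. snd (natural_chart A c) (dot A \<gamma> s))"
        by (simp add: dot_def snd_natural_chart)
      have "G (dot A \<gamma> t) (natural_chart A c) = spray_rep c (snd c (\<gamma> t), y t)"
        using local_rep_natural[OF atlas r(1) tc vt, of G] vel[OF tIJ] by (simp add: dot_def)
      with has_vector_derivative_transform_within_open[OF r(8) op tIJ eq]
      show "((\<lambda>s. snd (natural_chart A c) (dot A \<gamma> s)) has_vector_derivative G (dot A \<gamma> t) (natural_chart A c)) (at t)"
        by simp
    qed (use tIJ op in auto)
    with slit show ?thesis by blast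
  qed
  have "integral_curve (tangent_atlas A) G I (dot A \<gamma>)"
    by (rule integral_curve_localI[OF smooth_atlas_tangent[OF atlas] I]) (use main in blast)
  moreover have "dot A \<gamma> ` I \<subseteq> slit_bundle A" using main by blast
  ultimately show ?thesis using sc by (simp add: geodesic_def)
qed

lemma geodesic_chart:
  assumes g: "geodesic A G I \<gamma>" and t: "t \<in> I" and c: "c \<in> A" "\<gamma> t \<in> fst c"
  shows "geodesic_rep \<gamma> t c {s \<in> I. \<gamma> s \<in> fst c} (\<lambda>s. velocity A \<gamma> s c)"
proof -
  have sc: "smooth_curve A I \<gamma>" and slit: "dot A \<gamma> t \<in> slit_bundle A"
    and ic: "integral_curve (tangent_atlas A) G I (dot A \<gamma>)"
    using g t by (auto simp: geodesic_def)
  let ?J = "{s \<in> I. \<gamma> s \<in> fst c}"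
  note vt = velocity_in[OF atlas sc t]
  have tJ: "t \<in> ?J" using t c by simp
  note J = smooth_curve_chart[OF atlas sc c(1)]
  show ?thesis
  proof (rule geodesic_repI)
    show "((\<lambda>s. snd c (\<gamma> s)) has_vector_derivative velocity A \<gamma> s c) (at s)" if "s \<in> ?J" for s
      using velocity_chart[OF atlas sc _ c(1)] that by simp
    show "velocity A \<gamma> t c \<noteq> 0"
      using slit tangent_nonzero[OF vt atlas c] by (simp add: dot_def slit_bundle_def)
    have "dot A \<gamma> t \<in> fst (natural_chart A c)" using vt c(2) by (simp add: dot_def in_natural_chart)
    from integral_curve_chart[OF smooth_atlas_tangent[OF atlas] ic t tangent_atlasI[OF c(1)] this]
    show "((\<lambda>s. (snd c (\<gamma> s), velocity A \<gamma> s c)) has_vector_derivative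
        spray_rep c (snd c (\<gamma> t), velocity A \<gamma> t c)) (at t)"
      using local_rep_natural[OF atlas c vt, of G] by (simp add: dot_def snd_natural_chart)
  qed (use c tJ J in auto)
qed

lemma geodesic_geodesic_at:
  assumes g: "geodesic A G I \<gamma>" and t: "t \<in> I"
  shows "geodesic_at \<gamma> t"
proof -
  have "smooth_curve A I \<gamma>" using g by (simp add: geodesic_def)
  from smooth_curve_carrier[OF atlas this t] obtain c where c: "c \<in> A" "\<gamma> t \<in> fst c" by (rule carrierE)
  from geodesic_chart[OF g t c] show ?thesis unfolding geodesic_at_def by blast
qed

lemma geodesic_interval: "geodesic A G I \<gamma> \<Longrightarrow> open I \<and> is_interval I \<and> I \<noteq> {}"
  by (simp add: geodesic_def smooth_curve_def)

lemma geodesic_subinterval: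
  assumes "geodesic A G I \<gamma>" "open I'" "is_interval I'" "I' \<noteq> {}" "I' \<subseteq> I"
  shows "geodesic A G I' \<gamma>"
  by (rule geodesic_localI[OF assms(2-4)]) (use geodesic_geodesic_at[OF assms(1)] assms(5) in blast)

lemma geodesic_cong:
  assumes "geodesic A G I \<gamma>" "\<And>t. t \<in> I \<Longrightarrow> \<gamma> t = \<gamma>' t"
  shows "geodesic A G I \<gamma>'"
proof -
  have I: "open I" "is_interval I" "I \<noteq> {}" using geodesic_interval[OF assms(1)] by auto
  show ?thesis
    by (rule geodesic_localI[OF I], rule geodesic_at_cong[OF geodesic_geodesic_at[OF assms(1)] I(1)]) (use assms(2) in auto)
qed

text \<open>Geodesics with prescribed initial position and velocity, taken from a flow box of the
  spray. Restricting the base points to \<open>N\<close> keeps them inside a given flow box of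
  \<open>V\<close>.\<close>

lemma geodesic_through:
  assumes c: "c \<in> A" and z: "z \<in> slit_range c" and N: "open N" "fst z \<in> N" "N \<subseteq> snd c ` fst c"
  obtains I x y where "open I" "is_interval I" "0 \<in> I" "geodesic A G I (\<lambda>s. chart_inv c (x s))"
    "\<And>s. s \<in> I \<Longrightarrow> x s \<in> N" "\<And>s. s \<in> I \<Longrightarrow> y s \<noteq> 0" "(x 0, y 0) = z"
    "\<And>s. s \<in> I \<Longrightarrow> (x has_vector_derivative y s) (at s)"
    "\<And>s. s \<in> I \<Longrightarrow> ((\<lambda>s. (x s, y s)) has_vector_derivative spray_rep c (x s, y s)) (at s)"
proof -
  have op: "open (N \<times> (- {0 :: 'e}))" by (intro open_Times N(1)) auto
  have sub: "N \<times> (- {0}) \<subseteq> slit_range c" using N(3) by auto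
  have sm: "smooth_on (N \<times> (- {0})) (spray_rep c)" by (rule smooth_on_subset[OF smooth_spray_rep[OF c] sub])
  have zN: "z \<in> N \<times> (- {0})" using z N(2) by (cases z) auto
  obtain d M \<Psi> where M: "z \<in> M" and lf: "local_flow (spray_rep c) (N \<times> (- {0})) M d \<Psi>"
    using local_flow_exists[OF sm op zN] .
  interpret L: local_flow "spray_rep c" "N \<times> (- {0})" M d \<Psi> by (rule lf)
  let ?I = "{-d<..<d}"
  define x where "x s = fst (\<Psi> (s, z))" for s
  define y where "y s = snd (\<Psi> (s, z))" for s
  have xy: "\<Psi> (s, z) = (x s, y s)" for s by (simp add: x_def y_def)
  have Id: "\<bar>s\<bar> < d" if "s \<in> ?I" for s using that by auto
  have in_N: "x s \<in> N" "y s \<noteq> 0" if "s \<in> ?I" for s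
    using L.flow_in[OF Id[OF that] M] unfolding xy by simp_all
  have d: "((\<lambda>s. (x s, y s)) has_vector_derivative spray_rep c (x s, y s)) (at s)" if "s \<in> ?I" for s
    using L.flow_deriv[OF Id[OF that] M] unfolding xy .
  \<comment> \<open>Here the spray condition enters: the base component of the spray at
    \<open>(x, y)\<close> is \<open>y\<close>, so the fibre part of the solution is the velocity of
    the base part.\<close>
  have dx: "(x has_vector_derivative y s) (at s)" if "s \<in> ?I" for s
  proof -
    have "(x s, y s) \<in> slit_range c" using sub in_N[OF that] by auto
    then have "fst (spray_rep c (x s, y s)) = y s" using spray_rep_eq[OF c] by simp
    with bounded_linear.has_vector_derivative[OF bounded_linear_fst d[OF that]] show ?thesis by simp
  qed
  have smx: "smooth_on ?I x"
  proof -
    have i: "smooth_on ?I (\<lambda>s. (s, z))"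
      by (intro smooth_on_Pair smooth_on_id smooth_on_const open_greaterThanLessThan)
    have "smooth_on ?I (\<lambda>s. \<Psi> (s, z))"
      by (rule smooth_on_compose[OF open_greaterThanLessThan L.open_dom L.smooth_flow i]) (use M in auto)
    from smooth_on_fst[OF open_greaterThanLessThan this] show ?thesis by (simp add: x_def[abs_def])
  qed
  have inv: "chart_inv c (x s) \<in> fst c" "snd c (chart_inv c (x s)) = x s" if "s \<in> ?I" for s
    using in_N(1)[OF that] N(3) chart_inv_in[of "x s" c] chart_inv_right[of "x s" c] by auto
  have I: "open ?I" "is_interval ?I" "?I \<noteq> {}" using L.d_pos by (auto simp: is_interval_oo)
  show ?thesis
  proof (rule that[OF I(1,2) _ _ in_N _ dx d])
    show "0 \<in> ?I" using L.d_pos by simp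
    show "(x 0, y 0) = z" using L.flow_0[OF M] xy[of 0] by simp
    show "geodesic A G ?I (\<lambda>s. chart_inv c (x s))"
    proof (rule geodesic_localI[OF I])
      fix t assume t: "t \<in> ?I"
      have "geodesic_rep (\<lambda>s. chart_inv c (x s)) t c ?I y"
      proof (rule geodesic_repI)
        show "smooth_on ?I (\<lambda>s. snd c (chart_inv c (x s)))"
          by (rule smooth_on_cong[OF smx I(1)]) (simp add: inv)
        show "((\<lambda>s. snd c (chart_inv c (x s))) has_vector_derivative y s) (at s)" if "s \<in> ?I" for s
          by (rule has_vector_derivative_transform_within_open[OF dx[OF that] I(1) that]) (simp add: inv)
        show "((\<lambda>s. (snd c (chart_inv c (x s)), y s)) has_vector_derivative
            spray_rep c (snd c (chart_inv c (x t)), y t)) (at t)"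
          unfolding inv(2)[OF t]
          by (rule has_vector_derivative_transform_within_open[OF d[OF t] I(1) t]) (simp add: inv)
      qed (use t c inv in_N in auto)
      then show "geodesic_at (\<lambda>s. chart_inv c (x s)) t" unfolding geodesic_at_def by blast
    qed
  qed
qed

abbreviation affine_at :: "('m, 'e) chart \<Rightarrow> 'e \<times> 'e \<Rightarrow> bool" where
  "affine_at c z \<equiv> fd (spray_rep c) z (lift (local_rep c V) z) = fd (lift (local_rep c V)) z (spray_rep c z)"

text \<open>In coordinates the velocity curve of the geodesic is an integral curve of the spray. The
  lifted flow commutes with the spray by \<open>commuting_transport\<close>, so it carries this
  curve to another integral curve, whose fibre part is the velocity of the image by the chain
  rule.\<close>

lemma flow_geodesic_local:
  assumes aff: "\<And>z. z \<in> slit_range c \<Longrightarrow> affine_at c z" and c: "c \<in> A"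
    and lf: "local_flow (local_rep c V) (snd c ` fst c) N d \<phi>" and t: "\<bar>t\<bar> < d"
    and g: "geodesic A G I \<gamma>" and IN: "\<And>s. s \<in> I \<Longrightarrow> \<gamma> s \<in> fst c" "\<And>s. s \<in> I \<Longrightarrow> snd c (\<gamma> s) \<in> N"
  shows "geodesic A G I (flow A V t \<circ> \<gamma>)"
proof -
  interpret F: local_flow "local_rep c V" "snd c ` fst c" N d \<phi> by (rule lf)
  interpret L: local_flow "lift (local_rep c V)" "slit_range c" "N \<times> (- {0})" d "flow_lift \<phi>"
    by (rule local_flow_lift_slit[OF lf])
  have I: "open I" "is_interval I" "I \<noteq> {}" using geodesic_interval[OF g] by auto
  have J: "{s \<in> I. \<gamma> s \<in> fst c} = I" using IN by auto
  define x where "x s = snd c (\<gamma> s)" for s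
  define y where "y s = velocity A \<gamma> s c" for s
  define z where "z s = (x s, y s)" for s
  note gr = geodesic_repD[OF geodesic_chart[OF g _ c IN(1), unfolded J]]
  have smx: "smooth_on I x" using gr(5) I(3) unfolding x_def by auto
  have dx: "(x has_vector_derivative y s) (at s)" if "s \<in> I" for s
    using gr(6)[OF that that] that unfolding x_def[abs_def] y_def by blast
  have y0: "y s \<noteq> 0" if "s \<in> I" for s using gr(7)[OF that that] unfolding y_def .
  have dz: "(z has_vector_derivative spray_rep c (z s)) (at s)" if "s \<in> I" for s
    using gr(8)[OF that that] unfolding z_def[abs_def] x_def y_def .
  have xN: "x s \<in> N" if "s \<in> I" for s using IN(2)[OF that] by (simp add: x_def)
  have zN: "z s \<in> N \<times> (- {0})" if "s \<in> I" for s using xN y0 that by (simp add: z_def)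
  define Y where "Y s = fd \<phi> (t, x s) (0, y s)" for s
  have FL: "flow_lift \<phi> (t, z s) = (\<phi> (t, x s), Y s)" for s by (simp add: flow_lift_def z_def Y_def)
  have fc: "flow A V t (\<gamma> s) \<in> fst c" "snd c (flow A V t (\<gamma> s)) = \<phi> (t, x s)" if "s \<in> I" for s
    using flow_chart_coord(2,3)[OF c lf IN(1)[OF that] IN(2)[OF that] t] by (simp_all add: x_def)
  show ?thesis
  proof (rule geodesic_localI[OF I])
    fix s assume s: "s \<in> I"
    have "geodesic_rep (flow A V t \<circ> \<gamma>) s c I Y"
    proof (rule geodesic_repI)
      have i: "smooth_on I (\<lambda>s. (t, x s))" by (intro smooth_on_Pair smooth_on_const I(1) smx)
      have "smooth_on I (\<lambda>s. \<phi> (t, x s))"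
        by (rule smooth_on_compose[OF I(1) F.open_dom F.smooth_flow i]) (use xN t in auto)
      then show "smooth_on I (\<lambda>s. snd c ((flow A V t \<circ> \<gamma>) s))"
        by (rule smooth_on_cong[OF _ I(1)]) (simp add: fc)
      show "((\<lambda>s. snd c ((flow A V t \<circ> \<gamma>) s)) has_vector_derivative Y r) (at r)" if r: "r \<in> I" for r
      proof -
        have d\<phi>: "((\<lambda>y. \<phi> (t, y)) has_derivative (\<lambda>v. fd \<phi> (t, x r) (0, v))) (at (x r))"
          by (rule space_derivative[OF F.flow_differentiable[OF t xN[OF r]]])
        have "((\<lambda>s. \<phi> (t, x s)) has_vector_derivative Y r) (at r)"
          using has_vector_derivative_compose_fd[OF dx[OF r], of "\<lambda>y. \<phi> (t, y)"] d\<phi> fd_eq[OF d\<phi>]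
          unfolding Y_def differentiable_def by auto
        then show ?thesis
          by (rule has_vector_derivative_transform_within_open[OF _ I(1) r]) (simp add: fc)
      qed
      have zs: "flow_lift \<phi> (t, z s) \<in> slit_range c" by (rule L.flow_in[OF t zN[OF s]])
      then show "Y s \<noteq> 0" unfolding FL by simp
      have d\<phi>: "((\<lambda>y. flow_lift \<phi> (t, y)) has_derivative (\<lambda>v. fd (flow_lift \<phi>) (t, z s) (0, v))) (at (z s))"
        by (rule space_derivative[OF L.flow_differentiable[OF t zN[OF s]]])
      have "((\<lambda>s. flow_lift \<phi> (t, z s)) has_vector_derivative fd (flow_lift \<phi>) (t, z s) (0, spray_rep c (z s))) (at s)"
        using has_vector_derivative_compose_fd[OF dz[OF s], of "\<lambda>y. flow_lift \<phi> (t, y)"] d\<phi> fd_eq[OF d\<phi>]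
        unfolding differentiable_def by auto
      also have "fd (flow_lift \<phi>) (t, z s) (0, spray_rep c (z s)) = spray_rep c (flow_lift \<phi> (t, z s))"
        by (rule L.commuting_transport[OF smooth_spray_rep[OF c] aff zN[OF s] t])
      finally have "((\<lambda>s. (\<phi> (t, x s), Y s)) has_vector_derivative spray_rep c (\<phi> (t, x s), Y s)) (at s)"
        unfolding FL .
      then have "((\<lambda>s. (snd c ((flow A V t \<circ> \<gamma>) s), Y s)) has_vector_derivative spray_rep c (\<phi> (t, x s), Y s)) (at s)"
        by (rule has_vector_derivative_transform_within_open[OF _ I(1) s]) (simp add: fc)
      then show "((\<lambda>s. (snd c ((flow A V t \<circ> \<gamma>) s), Y s)) has_vector_derivative
          spray_rep c (snd c ((flow A V t \<circ> \<gamma>) s), Y s)) (at s)" by (simp add: fc[OF s])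
    qed (use c I s fc in auto)
    then show "geodesic_at (flow A V t \<circ> \<gamma>) s" unfolding geodesic_at_def by blast
  qed
qed

text \<open>Invariance of the spray at \<open>z\<close> is tested on the geodesic with initial
  velocity \<open>z\<close>. The velocity curve of its image is the image of its velocity curve
  under the lifted flow; the derivative at parameter 0 is given by the geodesic equation on one side
  and by the chain rule on the other.\<close>

lemma affine_imp_affine_at:
  assumes aff: "affine_vector_field A G V" and c: "c \<in> A" and z: "z \<in> slit_range c"
  shows "affine_at c z"
proof -
  have "fst z \<in> snd c ` fst c" using z by (cases z) simp
  then obtain p where p: "p \<in> fst c" "fst z = snd c p" by blast
  obtain N d \<phi> where pN: "snd c p \<in> N" and lf: "local_flow (local_rep c V) (snd c ` fst c) N d \<phi>"
    using local_flow_at[OF c p(1)] .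
  interpret F: local_flow "local_rep c V" "snd c ` fst c" N d \<phi> by (rule lf)
  interpret L: local_flow "lift (local_rep c V)" "slit_range c" "N \<times> (- {0})" d "flow_lift \<phi>"
    by (rule local_flow_lift_slit[OF lf])
  have Nsub: "N \<subseteq> snd c ` fst c" using F.N_subset_U by blast
  have zfN: "fst z \<in> N" using pN p(2) by simp
  obtain I x y where I: "open I" "is_interval I" "0 \<in> I" and g: "geodesic A G I (\<lambda>s. chart_inv c (x s))"
    and xN: "\<And>s. s \<in> I \<Longrightarrow> x s \<in> N" and y0: "\<And>s. s \<in> I \<Longrightarrow> y s \<noteq> 0" and z0: "(x 0, y 0) = z"
    and dx: "\<And>s. s \<in> I \<Longrightarrow> (x has_vector_derivative y s) (at s)"
    and dz: "\<And>s. s \<in> I \<Longrightarrow> ((\<lambda>s. (x s, y s)) has_vector_derivative spray_rep c (x s, y s)) (at s)"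
    by (rule geodesic_through[OF c z F.open_N zfN Nsub]) blast
  have zN: "z \<in> N \<times> (- {0})" using xN[OF I(3)] y0[OF I(3)] z0 by auto
  have "fd (flow_lift \<phi>) (t, z) (0, spray_rep c z) = spray_rep c (flow_lift \<phi> (t, z))" if t: "\<bar>t\<bar> < d" for t
  proof -
    let ?h = "flow A V t \<circ> (\<lambda>s. chart_inv c (x s))"
    have fc: "chart_inv c (x s) \<in> flow_dom A V t" "?h s \<in> fst c" "snd c (?h s) = \<phi> (t, x s)" if "s \<in> I" for s
    proof -
      have xs: "x s \<in> snd c ` fst c" using xN[OF that] Nsub by blast
      have "snd c (chart_inv c (x s)) \<in> N" using xN[OF that] chart_inv_right[OF xs] by simp
      from flow_chart_coord[OF c lf chart_inv_in[OF xs] this t]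
      show "chart_inv c (x s) \<in> flow_dom A V t" "?h s \<in> fst c" "snd c (?h s) = \<phi> (t, x s)"
        using chart_inv_right[OF xs] by simp_all
    qed
    have "affine_transformation A G (flow_dom A V t) (flow A V t)"
      using aff by (simp add: affine_vector_field_def)
    then have gh: "geodesic A G I ?h"
      using g fc(1) unfolding affine_transformation_def by blast
    have J: "{s \<in> I. ?h s \<in> fst c} = I" using fc(2) by blast
    note gr = geodesic_repD[OF geodesic_chart[OF gh I(3) c fc(2)[OF I(3)], unfolded J]]
    define Y where "Y s = fd \<phi> (t, x s) (0, y s)" for s
    have FL: "flow_lift \<phi> (t, (x s, y s)) = (\<phi> (t, x s), Y s)" for s by (simp add: flow_lift_def Y_def)
    have vel: "velocity A ?h s c = Y s" if s: "s \<in> I" for s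
    proof -
      have d\<phi>: "((\<lambda>y. \<phi> (t, y)) has_derivative (\<lambda>v. fd \<phi> (t, x s) (0, v))) (at (x s))"
        by (rule space_derivative[OF F.flow_differentiable[OF t xN[OF s]]])
      have "((\<lambda>s. \<phi> (t, x s)) has_vector_derivative Y s) (at s)"
        using has_vector_derivative_compose_fd[OF dx[OF s], of "\<lambda>y. \<phi> (t, y)"] d\<phi> fd_eq[OF d\<phi>]
        unfolding Y_def differentiable_def by auto
      moreover have "((\<lambda>s. \<phi> (t, x s)) has_vector_derivative velocity A ?h s c) (at s)"
        by (rule has_vector_derivative_transform_within_open[OF bspec[OF gr(6) s] I(1) s]) (rule fc(3))
      ultimately show ?thesis using vector_derivative_unique_at by blast
    qed
    have 1: "((\<lambda>s. (\<phi> (t, x s), Y s)) has_vector_derivative spray_rep c (\<phi> (t, x 0), Y 0)) (at 0)"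
      using has_vector_derivative_transform_within_open[OF gr(8) I(1,3), of "\<lambda>s. (\<phi> (t, x s), Y s)"]
      by (simp add: fc(3) vel I(3) del: comp_apply)
    have d\<phi>: "((\<lambda>y. flow_lift \<phi> (t, y)) has_derivative (\<lambda>v. fd (flow_lift \<phi>) (t, (x 0, y 0)) (0, v))) (at (x 0, y 0))"
      unfolding z0 by (rule space_derivative[OF L.flow_differentiable[OF t zN]])
    have "((\<lambda>s. flow_lift \<phi> (t, (x s, y s))) has_vector_derivative
        fd (flow_lift \<phi>) (t, (x 0, y 0)) (0, spray_rep c (x 0, y 0))) (at 0)"
      using has_vector_derivative_compose_fd[OF dz[OF I(3)], of "\<lambda>y. flow_lift \<phi> (t, y)"] d\<phi> fd_eq[OF d\<phi>]
      unfolding differentiable_def by auto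
    with 1 have "fd (flow_lift \<phi>) (t, (x 0, y 0)) (0, spray_rep c (x 0, y 0)) = spray_rep c (flow_lift \<phi> (t, (x 0, y 0)))"
      unfolding FL by (intro vector_derivative_unique_at)
    then show ?thesis unfolding z0 .
  qed
  then show ?thesis by (rule L.transport_commutes[OF smooth_spray_rep[OF c] zN F.d_pos])
qed

text \<open>The part of affineness that survives composition and restriction to open subsets, as
  \<open>flow_propagation\<close> demands. Invertibility is recovered afterwards from the flow at
  the opposite time.\<close>

definition preserves :: "'m set \<Rightarrow> ('m \<Rightarrow> 'm) \<Rightarrow> bool" where
  "preserves W f \<longleftrightarrow> smooth_map A W A f \<and> (\<forall>I \<gamma>. geodesic A G I \<gamma> \<and> \<gamma> ` I \<subseteq> W \<longrightarrow> geodesic A G I (f \<circ> \<gamma>))"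

lemma preserves_smooth: "preserves W f \<Longrightarrow> smooth_map A W A f"
  by (simp add: preserves_def)

lemma flow_preserves:
  assumes aff: "\<And>c z. c \<in> A \<Longrightarrow> z \<in> slit_range c \<Longrightarrow> affine_at c z" and p: "p \<in> flow_dom A V t"
  shows "\<exists>W. p \<in> W \<and> W \<subseteq> flow_dom A V t \<and> preserves W (flow A V t)"
proof (rule flow_propagation[OF _ _ _ _ _ p])
  fix f g W W' assume f: "preserves W f" and g: "preserves W' g" and sub: "f ` W \<subseteq> W'"
  have "geodesic A G I ((g \<circ> f) \<circ> \<gamma>)" if \<gamma>: "geodesic A G I \<gamma>" "\<gamma> ` I \<subseteq> W" for I \<gamma>
  proof -
    have "geodesic A G I (f \<circ> \<gamma>)" using f \<gamma> unfolding preserves_def by blast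
    moreover have "(f \<circ> \<gamma>) ` I \<subseteq> W'" using \<gamma>(2) sub by auto
    ultimately have "geodesic A G I (g \<circ> (f \<circ> \<gamma>))" using g unfolding preserves_def by blast
    then show ?thesis by (simp add: comp_assoc)
  qed
  then show "preserves W (g \<circ> f)"
    using f g sub smooth_map_compose[OF atlas atlas atlas] unfolding preserves_def by blast
next
  fix f g W assume f: "preserves W f" and eq: "\<And>p. p \<in> W \<Longrightarrow> f p = g p"
  have "geodesic A G I (g \<circ> \<gamma>)" if \<gamma>: "geodesic A G I \<gamma>" "\<gamma> ` I \<subseteq> W" for I \<gamma>
    by (rule geodesic_cong[of I "f \<circ> \<gamma>"]) (use f eq \<gamma> in \<open>auto simp: preserves_def\<close>)
  moreover have sf: "smooth_map A W A f" using f unfolding preserves_def by blast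
  have "smooth_map A W A g" by (rule smooth_map_cong[OF atlas atlas sf]) (rule eq)
  ultimately show "preserves W g" unfolding preserves_def by blast
next
  fix f W W' assume "preserves W f" "openin (atlas_topology A) W'" "W' \<subseteq> W"
  then show "preserves W' f"
    using smooth_map_subset[OF atlas atlas] unfolding preserves_def by blast
next
  fix f W assume "preserves W f"
  then show "smooth_map A W A f" by (rule preserves_smooth)
next
  fix q assume "q \<in> carrier A"
  then obtain c where c: "c \<in> A" "q \<in> fst c" by (rule carrierE)
  obtain N d \<phi> where qN: "snd c q \<in> N" and lf: "local_flow (local_rep c V) (snd c ` fst c) N d \<phi>"
    using local_flow_at[OF c] .
  interpret F: local_flow "local_rep c V" "snd c ` fst c" N d \<phi> by (rule lf)
  define W where "W = {p \<in> fst c. snd c p \<in> N}"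
  have W: "openin (atlas_topology A) W" unfolding W_def by (rule openin_chart_preimage[OF atlas c(1) F.open_N])
  have WN: "snd c ` W \<subseteq> N" by (auto simp: W_def)
  have fc: "p \<in> flow_dom A V t" "flow A V t p \<in> fst c" "snd c (flow A V t p) = \<phi> (t, snd c p)"
    if "p \<in> W" "\<bar>t\<bar> < d" for p t
    using flow_chart_coord[OF c(1) lf _ _ that(2), of p] that(1) by (simp_all add: W_def)
  have opW: "open (snd c ` W)"
    using open_chart_image[OF atlas c(1) W] by (simp add: W_def Int_absorb1 Collect_mono)
  have "preserves W (flow A V t)" if t: "\<bar>t\<bar> < d" for t
    unfolding preserves_def
  proof (intro conjI allI impI)
    have i: "smooth_on (snd c ` W) (\<lambda>x. (t, x))" by (intro smooth_on_Pair opW smooth_on_const smooth_on_id)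
    have s: "smooth_on (snd c ` W) (\<lambda>x. \<phi> (t, x))"
      by (rule smooth_on_compose[OF opW F.open_dom F.smooth_flow i]) (use t WN in auto)
    have "smooth_rep A A (flow A V t) c c W"
    proof (rule smooth_repI[OF c(1) c(1) W])
      show "W \<subseteq> fst c" by (auto simp: W_def)
      show "flow A V t ` W \<subseteq> fst c" using fc(2)[OF _ t] by blast
      show "smooth_on (snd c ` W) (\<lambda>x. snd c (flow A V t (chart_inv c x)))"
      proof (rule smooth_on_cong[OF s opW])
        fix x assume "x \<in> snd c ` W"
        then obtain p where p: "p \<in> W" "x = snd c p" by blast
        have "p \<in> fst c" using p(1) by (simp add: W_def)
        then show "\<phi> (t, x) = snd c (flow A V t (chart_inv c x))"
          using fc(3)[OF p(1) t] chart_inv_left[OF atlas c(1)] p(2) by simp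
      qed
    qed
    then show "smooth_map A W A (flow A V t)" by (intro smooth_map_localI[OF atlas atlas W]) blast
    fix I \<gamma> assume g: "geodesic A G I \<gamma> \<and> \<gamma> ` I \<subseteq> W"
    show "geodesic A G I (flow A V t \<circ> \<gamma>)"
      by (rule flow_geodesic_local[OF aff[OF c(1)] c(1) lf t]) (use g in \<open>auto simp: W_def\<close>)
  qed
  moreover have "q \<in> W" using c(2) qN by (simp add: W_def)
  ultimately show "\<exists>d>0. \<exists>W. openin (atlas_topology A) W \<and> q \<in> W \<and>
      (\<forall>t. \<bar>t\<bar> < d \<longrightarrow> W \<subseteq> flow_dom A V t \<and> preserves W (flow A V t))"
    using F.d_pos W fc(1) by (intro exI[of _ d] exI[of _ W]) blast
qed

text \<open>The flow map is good only near each point, but openness of the domain, smoothness and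
  being a geodesic are local properties. The inverse is the flow at time \<open>- t\<close>, whose
  domain is exactly the image, so its smoothness is another instance of the same argument.\<close>

lemma affine_at_imp_affine:
  assumes aff: "\<And>c z. c \<in> A \<Longrightarrow> z \<in> slit_range c \<Longrightarrow> affine_at c z"
  shows "affine_vector_field A G V"
  unfolding affine_vector_field_def affine_transformation_def
proof (intro allI conjI impI)
  fix t
  have op: "openin (atlas_topology A) (flow_dom A V t)" for t
  proof (rule iffD2[OF openin_subopen], rule ballI)
    fix p assume "p \<in> flow_dom A V t"
    from flow_preserves[OF aff this] obtain W where W: "p \<in> W" "W \<subseteq> flow_dom A V t" "preserves W (flow A V t)" by blast
    show "\<exists>T. openin (atlas_topology A) T \<and> p \<in> T \<and> T \<subseteq> flow_dom A V t"
      by (intro exI[of _ W] conjI smooth_map_openin[OF preserves_smooth[OF W(3)]] W(1,2))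
  qed
  have sm: "smooth_map A (flow_dom A V t) A (flow A V t)" for t
  proof (rule smooth_map_glue[OF atlas atlas op])
    fix p assume "p \<in> flow_dom A V t"
    from flow_preserves[OF aff this] obtain W where "p \<in> W" "preserves W (flow A V t)" by blast
    then show "\<exists>W' g. p \<in> W' \<and> smooth_map A W' A g \<and> (\<forall>q\<in>W'. g q = flow A V t q)"
      unfolding preserves_def by (intro exI[of _ W] exI[of _ "flow A V t"]) auto
  qed
  have inj: "inj_on (flow A V t) (flow_dom A V t)"
    by (rule inj_on_inverseI[of _ "flow A V (- t)"]) (rule flow_uminus(2))
  have im: "flow A V t ` flow_dom A V t = flow_dom A V (- t)"
  proof
    show "flow A V t ` flow_dom A V t \<subseteq> flow_dom A V (- t)" using flow_uminus(1) by blast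
    show "flow_dom A V (- t) \<subseteq> flow A V t ` flow_dom A V t"
    proof
      fix q assume q: "q \<in> flow_dom A V (- t)"
      have "flow A V t (flow A V (- t) q) = q" "flow A V (- t) q \<in> flow_dom A V t"
        using flow_uminus[OF q] by simp_all
      then show "q \<in> flow A V t ` flow_dom A V t" by (metis imageI)
    qed
  qed
  have inv: "flow A V (- t) q = inv_into (flow_dom A V t) (flow A V t) q" if "q \<in> flow_dom A V (- t)" for q
  proof -
    have "q \<in> flow A V t ` flow_dom A V t" using that im by simp
    then obtain p where p: "p \<in> flow_dom A V t" "q = flow A V t p" by blast
    show ?thesis unfolding p(2) by (simp add: flow_uminus(2)[OF p(1)] inv_into_f_f[OF inj p(1)])
  qed
  have "smooth_map A (flow_dom A V (- t)) A (inv_into (flow_dom A V t) (flow A V t))"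
    by (rule smooth_map_cong[OF atlas atlas sm inv])
  then show "local_diffeo A (flow_dom A V t) (flow A V t)"
    unfolding local_diffeo_def im using inj sm by blast
  fix I \<gamma> assume g: "geodesic A G I \<gamma> \<and> \<gamma> ` I \<subseteq> flow_dom A V t"
  then have g1: "geodesic A G I \<gamma>" and gD: "\<gamma> ` I \<subseteq> flow_dom A V t" by auto
  have I: "open I" "is_interval I" "I \<noteq> {}" using geodesic_interval[OF g1] by auto
  show "geodesic A G I (flow A V t \<circ> \<gamma>)"
  proof (rule geodesic_localI[OF I])
    fix s assume s: "s \<in> I"
    then have "\<gamma> s \<in> flow_dom A V t" using gD by blast
    from flow_preserves[OF aff this] obtain W where W: "\<gamma> s \<in> W" "preserves W (flow A V t)" by blast
    have oW: "openin (atlas_topology A) W" by (rule smooth_map_openin[OF preserves_smooth[OF W(2)]])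
    have "smooth_curve A I \<gamma>" using g1 by (simp add: geodesic_def)
    from open_curve_preimage[OF this oW] have "open {r \<in> I. \<gamma> r \<in> W}" .
    then obtain e where e: "e > 0" "ball s e \<subseteq> {r \<in> I. \<gamma> r \<in> W}"
      using s W(1) open_contains_ball[of "{r \<in> I. \<gamma> r \<in> W}"] by auto
    have "geodesic A G (ball s e) \<gamma>"
      by (rule geodesic_subinterval[OF g1]) (use e in \<open>auto simp: is_interval_ball_real\<close>)
    moreover have "\<gamma> ` ball s e \<subseteq> W" using e(2) by blast
    ultimately have "geodesic A G (ball s e) (flow A V t \<circ> \<gamma>)" using W(2) unfolding preserves_def by blast
    then show "geodesic_at (flow A V t \<circ> \<gamma>) s" by (rule geodesic_geodesic_at) (use e(1) in simp)
  qed
qed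

end

section \<open>The equation in natural coordinates\<close>

lemma vec_basis_sum: "(\<Sum>i\<in>UNIV. a $ i *\<^sub>R axis i (1::real)) = (a :: real ^ 'n)"
  by (vector axis_def) (simp add: if_distrib cong: if_cong)

lemma linear_fst_vec:
  fixes l :: "(real ^ 'n) \<times> 'a::real_vector \<Rightarrow> 'b::real_vector"
  assumes "linear l" shows "l (a, 0) = (\<Sum>i\<in>UNIV. a $ i *\<^sub>R l (axis i 1, 0))"
proof -
  have "(a, 0) = (\<Sum>i\<in>UNIV. a $ i *\<^sub>R (axis i 1, 0 :: 'a))"
    by (rule prod_eqI) (simp_all add: fst_sum snd_sum vec_basis_sum)
  then have "l (a, 0) = l (\<Sum>i\<in>UNIV. a $ i *\<^sub>R (axis i 1, 0 :: 'a))" by (rule arg_cong)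
  also have "\<dots> = (\<Sum>i\<in>UNIV. a $ i *\<^sub>R l (axis i 1, 0))"
    by (simp only: linear_sum[OF assms] linear_scale[OF assms])
  finally show ?thesis .
qed

lemma linear_snd_vec:
  fixes l :: "'a::real_vector \<times> (real ^ 'n) \<Rightarrow> 'b::real_vector"
  assumes "linear l" shows "l (0, a) = (\<Sum>i\<in>UNIV. a $ i *\<^sub>R l (0, axis i 1))"
proof -
  have "(0, a) = (\<Sum>i\<in>UNIV. a $ i *\<^sub>R (0 :: 'a, axis i 1))"
    by (rule prod_eqI) (simp_all add: fst_sum snd_sum vec_basis_sum)
  then have "l (0, a) = l (\<Sum>i\<in>UNIV. a $ i *\<^sub>R (0 :: 'a, axis i 1))" by (rule arg_cong)
  also have "\<dots> = (\<Sum>i\<in>UNIV. a $ i *\<^sub>R l (0, axis i 1))"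
    by (simp only: linear_sum[OF assms] linear_scale[OF assms])
  finally show ?thesis .
qed

lemma linear_split_pair:
  assumes "linear l" shows "l (a, b) = l (a, 0) + l (0, b)"
  using linear_add[OF assms, of "(a, 0)" "(0, b)"] by simp

section \<open>Index sums as directional derivatives\<close>

lemma fd_vec_nth:
  fixes W :: "'a::euclidean_space \<Rightarrow> real ^ 'n"
  assumes "W differentiable at z"
  shows "(\<lambda>z. W z $ i) differentiable at z" "fd (\<lambda>z. W z $ i) z w = fd W z w $ i"
proof -
  have d: "((\<lambda>z. W z $ i) has_derivative (\<lambda>w. fd W z w $ i)) (at z)"
    by (rule bounded_linear.has_derivative[OF bounded_linear_vec_nth has_derivative_fd[OF assms]])
  show "(\<lambda>z. W z $ i) differentiable at z" using d by (rule differentiableI)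
  show "fd (\<lambda>z. W z $ i) z w = fd W z w $ i" using fd_eq[OF d] by simp
qed

text \<open>The spray as a derivation is a single directional derivative along
  \<open>(y, - 2 G)\<close>; this permits the later computation with vectors in place of
  indices.\<close>

lemma spray_deriv_fd:
  assumes "q differentiable at z"
  shows "spray_deriv G q z = fd q z (snd z, - 2 *\<^sub>R G z)"
proof -
  note l = linear_fd[OF assms]
  have "fd q z (snd z, - 2 *\<^sub>R G z) = (\<Sum>i\<in>UNIV. snd z $ i *\<^sub>R fd q z (axis i 1, 0))
      + (\<Sum>i\<in>UNIV. (- 2 *\<^sub>R G z) $ i *\<^sub>R fd q z (0, axis i 1))"
    unfolding linear_split_pair[OF l, of "snd z" "- 2 *\<^sub>R G z"] linear_fst_vec[OF l, of "snd z"]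
      linear_snd_vec[OF l, of "- 2 *\<^sub>R G z"] ..
  then show ?thesis
    unfolding spray_deriv_def partial_x_def partial_y_def by (simp add: sum_subtractf sum_negf)
qed

lemma nonlinear_conn_fd:
  "G differentiable at z \<Longrightarrow> nonlinear_conn G i l z = fd G z (0, axis l 1) $ i"
  unfolding nonlinear_conn_def partial_y_def by (rule fd_vec_nth(2))

lemma sum_nonlinear_conn:
  assumes "G differentiable at z"
  shows "(\<Sum>l\<in>UNIV. a $ l * nonlinear_conn G i l z) = fd G z (0, a) $ i"
  unfolding linear_snd_vec[OF linear_fd[OF assms], of a] nonlinear_conn_fd[OF assms] by (simp add: sum_component)

lemma dyn_deriv_fd:
  assumes "W differentiable at z" "G differentiable at z"
  shows "dyn_deriv G W z = fd W z (snd z, - 2 *\<^sub>R G z) + fd G z (0, W z)"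
  by (simp add: vec_eq_iff dyn_deriv_def spray_deriv_fd[OF fd_vec_nth(1)[OF assms(1)]]
      fd_vec_nth(2)[OF assms(1)] sum_nonlinear_conn[OF assms(2)])

text \<open>In the sum below, all terms with derivatives of \<open>N\<^sup>i\<^sub>j\<close> and all products of two \<open>N\<^sup>i\<^sub>j\<close> cancel.\<close>

lemma jacobi_expression:
  fixes G :: "(real ^ 'n) \<times> (real ^ 'n) \<Rightarrow> real ^ 'n" and f :: "real ^ 'n \<Rightarrow> real ^ 'n"
  assumes f: "smooth_on U f" and U: "open U" and G: "smooth_on (U \<times> B) G" and B: "open B" and z: "z \<in> U \<times> B"
  defines "W \<equiv> \<lambda>z. f (fst z)" and "h \<equiv> \<lambda>z. fd f (fst z) (snd z)"
  shows "dyn_deriv G (dyn_deriv G W) z $ i + (\<Sum>k\<in>UNIV. W z $ k * riemann_curv G i k z)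
    = (fd h z (snd z, - 2 *\<^sub>R G z) + 2 *\<^sub>R fd G z (f (fst z), h z)) $ i"
proof -
  have S: "open (U \<times> B)" using U B by (rule open_Times)
  have p: "smooth_on (U \<times> B) fst" "smooth_on (U \<times> B) snd"
    by (rule smooth_on_bounded_linear[OF bounded_linear_fst S], rule smooth_on_bounded_linear[OF bounded_linear_snd S])
  have fi: "fst ` (U \<times> B) \<subseteq> U" by auto
  have dG: "G differentiable at z" if "z \<in> U \<times> B" for z by (rule smooth_on_differentiable[OF G that])
  have smW: "smooth_on (U \<times> B) W" unfolding W_def by (rule smooth_on_compose[OF S U f p(1) fi])
  have smh: "smooth_on (U \<times> B) h" unfolding h_def by (rule smooth_on_fd_comp[OF S U f p fi])
  let ?K = "\<lambda>z. fd G z (0, W z)"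
  have smK: "smooth_on (U \<times> B) ?K"
    by (rule smooth_on_fd_comp[OF S S G smooth_on_id[OF S]]) (auto intro!: smooth_on_Pair S smooth_on_const smW)
  have fdW: "fd W z w = fd f (fst z) (fst w)" if "z \<in> U \<times> B" for z w
  proof -
    have "(f has_derivative fd f (fst z)) (at (fst z))" using smooth_on_has_derivative[OF f] that by auto
    from has_derivative_compose[OF bounded_linear_imp_has_derivative[OF bounded_linear_fst] this]
    have "(W has_derivative (\<lambda>w. fd f (fst z) (fst w))) (at z)" unfolding W_def .
    from fd_eq[OF this] show ?thesis by simp
  qed
  have H: "dyn_deriv G W z = h z + ?K z" if "z \<in> U \<times> B" for z
    using dyn_deriv_fd[OF smooth_on_differentiable[OF smW that] dG[OF that]] fdW[OF that] by (simp add: h_def)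
  let ?H = "\<lambda>z. h z + ?K z" and ?s = "(snd z, - 2 *\<^sub>R G z)"
  let ?N = "\<lambda>l z. fd G z (0, axis l 1)"
  note dh = smooth_on_differentiable[OF smh z] and dK = smooth_on_differentiable[OF smK z]
  have dH: "?H differentiable at z" by (intro differentiable_add dh dK)
  have "dyn_deriv G W differentiable at z"
    by (rule differentiable_cong_open[OF S z _ dH]) (simp add: H)
  moreover have "fd (dyn_deriv G W) z = fd ?H z" by (rule fd_cong[OF S z]) (simp add: H)
  ultimately have "dyn_deriv G (dyn_deriv G W) z = fd ?H z ?s + fd G z (0, ?H z)"
    using dyn_deriv_fd[OF _ dG[OF z], of "dyn_deriv G W"] H[OF z] by simp
  also have "fd ?H z ?s = fd h z ?s + fd ?K z ?s"
    using fd_eq[OF has_derivative_add[OF has_derivative_fd[OF dh] has_derivative_fd[OF dK]]] by simp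
  also have "fd G z (0, ?H z) = fd G z (0, h z) + fd G z (0, ?K z)"
    using linear_add[OF linear_fd[OF dG[OF z]], of "(0, h z)" "(0, ?K z)"] by simp
  \<comment> \<open>Product rule for \<open>W\<close> contracted with the connection. The direction
    \<open>W z\<close> moves with \<open>z\<close>, hence the expansion into fixed directions.
    Differentiating \<open>W\<close> along the spray gives \<open>h\<close>, because the base part
    of \<open>?s\<close> is \<open>snd z\<close>.\<close>
  also have "fd ?K z ?s = fd G z (0, h z) + (\<Sum>l\<in>UNIV. W z $ l *\<^sub>R fd (?N l) z ?s)"
  proof -
    have "fd ?K z = fd (\<lambda>z. \<Sum>l\<in>UNIV. W z $ l *\<^sub>R ?N l z) z"
      by (rule fd_cong[OF S z]) (rule linear_snd_vec[OF linear_fd[OF dG]])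
    also have "\<dots> = (\<lambda>w. \<Sum>l\<in>UNIV. W z $ l *\<^sub>R fd (?N l) z w + fd W z w $ l *\<^sub>R ?N l z)"
    proof (rule fd_eq, rule has_derivative_sum)
      fix l
      have 1: "((\<lambda>z. W z $ l) has_derivative (\<lambda>w. fd W z w $ l)) (at z)"
        by (rule bounded_linear.has_derivative[OF bounded_linear_vec_nth smooth_on_has_derivative[OF smW z]])
      from has_derivative_scaleR[OF 1 smooth_on_has_derivative[OF smooth_on_fd[OF G] z]]
      show "((\<lambda>z. W z $ l *\<^sub>R ?N l z) has_derivative (\<lambda>w. W z $ l *\<^sub>R fd (?N l) z w + fd W z w $ l *\<^sub>R ?N l z)) (at z)" .
    qed
    finally have "fd ?K z ?s = (\<Sum>l\<in>UNIV. W z $ l *\<^sub>R fd (?N l) z ?s) + (\<Sum>l\<in>UNIV. fd W z ?s $ l *\<^sub>R ?N l z)"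
      by (simp add: sum.distrib)
    also have "(\<Sum>l\<in>UNIV. fd W z ?s $ l *\<^sub>R ?N l z) = fd G z (0, fd W z ?s)"
      by (rule linear_snd_vec[OF linear_fd[OF dG[OF z]], symmetric])
    also have "fd W z ?s = h z" by (simp add: fdW[OF z] h_def)
    finally show ?thesis by simp
  qed
  finally have D: "dyn_deriv G (dyn_deriv G W) z = fd h z ?s + (fd G z (0, h z) + (\<Sum>l\<in>UNIV. W z $ l *\<^sub>R fd (?N l) z ?s))
    + (fd G z (0, h z) + fd G z (0, ?K z))" .
  \<comment> \<open>The curvature as a component of directional derivatives; the product of two
    connection matrices becomes an iterated fibre derivative.\<close>
  have R: "riemann_curv G i k z = (2 *\<^sub>R fd G z (axis k 1, 0) - fd (?N k) z ?s - fd G z (0, ?N k z)) $ i" for k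
  proof -
    have dN: "?N k differentiable at z" by (rule smooth_on_differentiable[OF smooth_on_fd[OF G] z])
    have "partial_x k (\<lambda>z. G z $ i) z = fd G z (axis k 1, 0) $ i"
      unfolding partial_x_def by (rule fd_vec_nth(2)[OF dG[OF z]])
    moreover have "spray_deriv G (nonlinear_conn G i k) z = fd (?N k) z ?s $ i"
    proof -
      have "nonlinear_conn G i k differentiable at z"
        by (rule differentiable_cong_open[OF S z _ fd_vec_nth(1)[OF dN, of i]]) (simp add: nonlinear_conn_fd[OF dG])
      then have "spray_deriv G (nonlinear_conn G i k) z = fd (nonlinear_conn G i k) z ?s" by (rule spray_deriv_fd)
      also have "fd (nonlinear_conn G i k) z = fd (\<lambda>z. ?N k z $ i) z"
        by (rule fd_cong[OF S z]) (simp add: nonlinear_conn_fd[OF dG])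
      finally show ?thesis by (simp add: fd_vec_nth(2)[OF dN])
    qed
    moreover have "(\<Sum>m\<in>UNIV. nonlinear_conn G i m z * nonlinear_conn G m k z) = fd G z (0, ?N k z) $ i"
      using sum_nonlinear_conn[OF dG[OF z], of "?N k z" i] by (simp add: nonlinear_conn_fd[OF dG[OF z]] mult.commute)
    ultimately show ?thesis unfolding riemann_curv_def by simp
  qed
  have lin: "linear (\<lambda>a. fd G z (0, a))"
  proof -
    note l = linear_fd[OF dG[OF z]]
    show ?thesis
    proof (rule linearI)
      show "fd G z (0, a + b) = fd G z (0, a) + fd G z (0, b)" for a b
        using linear_add[OF l, of "(0, a)" "(0, b)"] by simp
      show "fd G z (0, r *\<^sub>R a) = r *\<^sub>R fd G z (0, a)" for r a
        using linear_scale[OF l, of r "(0, a)"] by simp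
    qed
  qed
  have K: "fd G z (0, ?K z) = (\<Sum>k\<in>UNIV. W z $ k *\<^sub>R fd G z (0, ?N k z))"
    unfolding linear_snd_vec[OF linear_fd[OF dG[OF z]], of "W z"]
    by (simp only: linear_sum[OF lin] linear_scale[OF lin])
  have "(\<Sum>k\<in>UNIV. W z $ k * riemann_curv G i k z)
    = (\<Sum>k\<in>UNIV. W z $ k *\<^sub>R (2 *\<^sub>R fd G z (axis k 1, 0) - fd (?N k) z ?s - fd G z (0, ?N k z))) $ i"
    unfolding R by (simp add: sum_component)
  also have "(\<Sum>k\<in>UNIV. W z $ k *\<^sub>R (2 *\<^sub>R fd G z (axis k 1, 0) - fd (?N k) z ?s - fd G z (0, ?N k z)))
    = 2 *\<^sub>R (\<Sum>k\<in>UNIV. W z $ k *\<^sub>R fd G z (axis k 1, 0)) - (\<Sum>k\<in>UNIV. W z $ k *\<^sub>R fd (?N k) z ?s) - fd G z (0, ?K z)"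
    unfolding K by (simp add: scaleR_diff_right sum_subtractf scaleR_sum_right mult.commute)
  also have "(\<Sum>k\<in>UNIV. W z $ k *\<^sub>R fd G z (axis k 1, 0)) = fd G z (W z, 0)"
    by (rule linear_fst_vec[OF linear_fd[OF dG[OF z]], symmetric])
  finally have RS: "(\<Sum>k\<in>UNIV. W z $ k * riemann_curv G i k z)
    = (2 *\<^sub>R fd G z (W z, 0) - (\<Sum>k\<in>UNIV. W z $ k *\<^sub>R fd (?N k) z ?s) - fd G z (0, ?K z)) $ i" .
  \<comment> \<open>\<open>D\<close> contains \<open>fd G z (0, h z)\<close> twice, once from the
    product rule and once from the outer dynamical derivative. The curvature sum contributes
    \<open>fd G z (W z, 0)\<close> with factor 2, which completes twice the derivative in direction
    \<open>(f (fst z), h z)\<close>.\<close>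
  have sp: "fd G z (f (fst z), h z) = fd G z (W z, 0) + fd G z (0, h z)"
    using linear_split_pair[OF linear_fd[OF dG[OF z]], of "f (fst z)" "h z"] by (simp add: W_def)
  show ?thesis
    unfolding D RS sp vector_add_component[symmetric]
    by (rule arg_cong[where f="\<lambda>v. v $ i"]) (simp add: algebra_simps scaleR_2)
qed

locale vec_spray_field = spray_field A V G
  for A :: "('m, real ^ 'n) atlas" and V and G :: "('m, real ^ 'n) bundle_field"
begin

text \<open>The base components of the two sides agree automatically: both equal
  \<open>?h z\<close>, since the base component of the spray is the fibre coordinate. What remains
  is the fibre component, which \<open>jacobi_expression\<close> identifies with the stated
  equation.\<close>

lemma affine_at_iff:
  assumes c: "c \<in> A" and z: "z \<in> slit_range c"
  shows "affine_at c z \<longleftrightarrow> (\<forall>i.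
    dyn_deriv (spray_coeff A G c) (dyn_deriv (spray_coeff A G c) (lifted_rep c V)) z $ i
      + (\<Sum>k\<in>UNIV. lifted_rep c V z $ k * riemann_curv (spray_coeff A G c) i k z) = 0)"
proof -
  let ?f = "local_rep c V" and ?G = "spray_coeff A G c"
  let ?h = "\<lambda>z. fd ?f (fst z) (snd z)" and ?U = "snd c ` fst c"
  note U = open_chart_range[OF atlas c] and f = field_smooth[OF c] and S = open_slit_range[OF c]
  have G: "smooth_on (slit_range c) ?G"
    unfolding spray_coeff_def[abs_def]
    by (intro smooth_on_bounded_linear_comp[OF bounded_linear_scaleR_right S] smooth_on_snd S smooth_spray_rep c)
  have p: "smooth_on (slit_range c) fst" "smooth_on (slit_range c) snd"
    by (rule smooth_on_bounded_linear[OF bounded_linear_fst S], rule smooth_on_bounded_linear[OF bounded_linear_snd S])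
  have fi: "fst ` slit_range c \<subseteq> ?U" by auto
  have smf: "smooth_on (slit_range c) (\<lambda>z. ?f (fst z))" by (rule smooth_on_compose[OF S U f p(1) fi])
  have smh: "smooth_on (slit_range c) ?h" by (rule smooth_on_fd_comp[OF S U f p fi])
  let ?s = "(snd z, - 2 *\<^sub>R ?G z)"
  have "fd (spray_rep c) z = fd (\<lambda>z. (snd z, - 2 *\<^sub>R ?G z)) z"
    by (rule fd_cong[OF S z]) (rule spray_rep_eq[OF c])
  also have "\<dots> = (\<lambda>w. (snd w, - 2 *\<^sub>R fd ?G z w))"
    by (rule fd_eq) (intro has_derivative_Pair has_derivative_snd has_derivative_ident has_derivative_scaleR_right
        smooth_on_has_derivative[OF G z])
  finally have 1: "fd (spray_rep c) z (lift ?f z) = (?h z, - 2 *\<^sub>R fd ?G z (?f (fst z), ?h z))"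
    by (simp add: lift_def)
  have "fd (lift ?f) z = (\<lambda>w. (fd (\<lambda>z. ?f (fst z)) z w, fd ?h z w))"
    unfolding lift_def[abs_def]
    by (rule fd_eq) (intro has_derivative_Pair smooth_on_has_derivative[OF smf z] smooth_on_has_derivative[OF smh z])
  moreover have "fd (\<lambda>z. ?f (fst z)) z = (\<lambda>w. fd ?f (fst z) (fst w))"
  proof (rule fd_eq)
    have "(?f has_derivative fd ?f (fst z)) (at (fst z))" using smooth_on_has_derivative[OF f] z by auto
    from has_derivative_compose[OF bounded_linear_imp_has_derivative[OF bounded_linear_fst] this]
    show "((\<lambda>z. ?f (fst z)) has_derivative (\<lambda>w. fd ?f (fst z) (fst w))) (at z)" .
  qed
  ultimately have 2: "fd (lift ?f) z (spray_rep c z) = (?h z, fd ?h z ?s)"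
    using spray_rep_eq[OF c z] by simp
  have "affine_at c z \<longleftrightarrow> fd ?h z ?s + 2 *\<^sub>R fd ?G z (?f (fst z), ?h z) = 0"
  proof -
    have "(- 2 *\<^sub>R a = b) \<longleftrightarrow> (b + 2 *\<^sub>R a = 0)" for a b :: "real ^ 'n"
      using eq_neg_iff_add_eq_0[of b "2 *\<^sub>R a"] by auto
    then show ?thesis unfolding 1 2 by (simp only: prod.inject simp_thms)
  qed
  also have "\<dots> \<longleftrightarrow> (\<forall>i. (fd ?h z ?s + 2 *\<^sub>R fd ?G z (?f (fst z), ?h z)) $ i = 0)"
    by (simp add: vec_eq_iff)
  finally show ?thesis
    unfolding lifted_rep_def[abs_def] jacobi_expression[OF f U G _ z, OF open_Compl[OF closed_singleton]] .
qed

end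

theorem proposition3p2:
  fixes A :: "('m, real^'n) atlas"
    and G :: "('m, real^'n) bundle_field"
    and V :: "'m \<Rightarrow> ('m, real^'n) tvec"
  assumes "smooth_manifold A"
    and "spray A G"
    and "smooth_vector_field A (carrier A) V"
  shows "(affine_vector_field A G V \<longleftrightarrow>
            (\<forall>u\<in>slit_bundle A. lie_derivative (tangent_atlas A) (complete_lift A V) G u = (\<lambda>_. 0)))
       \<and> ((\<forall>u\<in>slit_bundle A. lie_derivative (tangent_atlas A) (complete_lift A V) G u = (\<lambda>_. 0)) \<longleftrightarrow>
            (\<forall>c\<in>A. \<forall>x\<in>snd c ` fst c. \<forall>y. y \<noteq> 0 \<longrightarrow> (\<forall>i.
               dyn_deriv (spray_coeff A G c) (dyn_deriv (spray_coeff A G c) (lifted_rep c V)) (x, y) $ i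
               + (\<Sum>k\<in>UNIV. lifted_rep c V (x, y) $ k * riemann_curv (spray_coeff A G c) i k (x, y)) = 0)))"
proof -
  interpret vec_spray_field A V G
    by unfold_locales (rule assms)+
  have "affine_vector_field A G V \<longleftrightarrow> (\<forall>c\<in>A. \<forall>z\<in>slit_range c. affine_at c z)"
    using affine_imp_affine_at affine_at_imp_affine by blast
  moreover have "(\<forall>c\<in>A. \<forall>z\<in>slit_range c. affine_at c z) \<longleftrightarrow>
      (\<forall>c\<in>A. \<forall>x\<in>snd c ` fst c. \<forall>y. y \<noteq> 0 \<longrightarrow> (\<forall>i.
         dyn_deriv (spray_coeff A G c) (dyn_deriv (spray_coeff A G c) (lifted_rep c V)) (x, y) $ i
         + (\<Sum>k\<in>UNIV. lifted_rep c V (x, y) $ k * riemann_curv (spray_coeff A G c) i k (x, y)) = 0))"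
    using affine_at_iff by auto
  ultimately show ?thesis unfolding lie_zero_iff by blast
qed

end
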